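(* Let $G$ be a second countable étale essentially principal groupoid whose unit space $G^{(0)}$ is compact and totally disconnected, and suppose $G$ is almost finite. Suppose $\gamma\in[[G]]$ lies in the kernel of the index map $I:[[G]]\to H_1(G)$. Then there exist $\gamma_1,\gamma_2,\gamma_3,\gamma_4\in[[G]]$ with $\gamma=\gamma_1\gamma_2\gamma_3\gamma_4$ such that $\gamma_1,\gamma_2^2,\gamma_3,\gamma_4$ are elementary. In particular, $\gamma$ is a product of four elements of $[[G]]$ of finite order.
   Context: An étale groupoid is a locally compact Hausdorff groupoid whose range map $r$ is a local homeomorphism; $s$ is the source map. $G$ is essentially principal if the interior of $\{g: r(g)=s(g)\}$ is $G^{(0)}$. A $G$-set is a subset $U$ with $r|_U,s|_U$ injective; $\tau_U=r\circ(s|_U)^{-1}$. $[[G]]$ is the group of homeomorphisms of $G^{(0)}$ of the form $\tau_U$, $U$ a compact open $G$-set (unique here). Homology: $\delta_1=s_*-r_*:C_c(G,\mathbb{Z})\to C(G^{(0)},\mathbb{Z})$, $\delta_2=d_{0*}-d_{1*}+d_{2*}:C_c(G^{(2)},\mathbb{Z})\to C_c(G,\mathbb{Z})$ with $G^{(2)}$ the composable pairs, $d_0(g_1,g_2)=g_2$, $d_1(g_1,g_2)=g_1g_2$, $d_2(g_1,g_2)=g_1$, and $\pi_*(f)(y)=\sum_{\pi(x)=y}f(x)$; $H_1(G)=\ker\delta_1/\operatorname{Im}\delta_2$. Index map: $I(\tau_U)=[1_U]$. A homeomorphism $\gamma$ of $G^{(0)}$ is elementary if it has finite order and $\{x:\gamma^k(x)=x\}$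 is clopen for every $k\in\mathbb{N}$. Elementary subgroupoid: compact open principal subgroupoid $K$ with $K^{(0)}=G^{(0)}$. $G$ is almost finite if for every compact $C\subset G$ and $\varepsilon>0$ there is an elementary subgroupoid $K$ with $|CKx\setminus Kx|/|K(x)|<\varepsilon$ for all $x$, where $Kx=\{k\in K:s(k)=x\}$, $CKx=\{ck:c\in C,k\in Kx,s(c)=r(k)\}$, $K(x)=r(Kx)$. *)

theory Defs
  imports "HOL-Analysis.Analysis"
begin

text \<open>A topological groupoid: arrows form the topspace of top; units is the unit
space (as a subset of the arrows); rng/src range and source; mul composition
(defined for s g = r h), inv inversion.\<close>

record 'a groupoid =
  top :: "'a topology"
  units :: "'a set"
  rng :: "'a \<Rightarrow> 'a"
  src :: "'a \<Rightarrow> 'a"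
  mul :: "'a \<Rightarrow> 'a \<Rightarrow> 'a"
  inv :: "'a \<Rightarrow> 'a"

definition arrows :: "'a groupoid \<Rightarrow> 'a set" where
  "arrows G = topspace (top G)"

definition composable :: "'a groupoid \<Rightarrow> ('a \<times> 'a) set" where
  "composable G = {(g, h). g \<in> arrows G \<and> h \<in> arrows G \<and> src G g = rng G h}"

definition unit_top :: "'a groupoid \<Rightarrow> 'a topology" where
  "unit_top G = subtopology (top G) (units G)"

definition groupoid_axioms :: "'a groupoid \<Rightarrow> bool" where
  "groupoid_axioms G \<longleftrightarrow>
     units G \<subseteq> arrows G \<and>
     (\<forall>g\<in>arrows G. rng G g \<in> units G \<and> src G g \<in> units G) \<and>
     (\<forall>u\<in>units G. rng G u = u \<and> src G u = u) \<and>
     (\<forall>(g,h)\<in>composable G. mul G g h \<in> arrows G \<and>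
          rng G (mul G g h) = rng G g \<and> src G (mul G g h) = src G h) \<and>
     (\<forall>g\<in>arrows G. \<forall>h\<in>arrows G. \<forall>k\<in>arrows G.
          src G g = rng G h \<longrightarrow> src G h = rng G k \<longrightarrow>
          mul G (mul G g h) k = mul G g (mul G h k)) \<and>
     (\<forall>g\<in>arrows G. mul G (rng G g) g = g \<and> mul G g (src G g) = g) \<and>
     (\<forall>g\<in>arrows G. inv G g \<in> arrows G \<and> rng G (inv G g) = src G g \<and>
          src G (inv G g) = rng G g \<and>
          mul G g (inv G g) = rng G g \<and> mul G (inv G g) g = src G g)"

definition topological_groupoid :: "'a groupoid \<Rightarrow> bool" where
  "topological_groupoid G \<longleftrightarrow> groupoid_axioms G \<and>
     continuous_map (subtopology (prod_topology (top G) (top G)) (composable G)) (top G)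
        (\<lambda>(g,h). mul G g h) \<and>
     continuous_map (top G) (top G) (inv G) \<and>
     continuous_map (top G) (unit_top G) (src G) \<and>
     continuous_map (top G) (unit_top G) (rng G)"

definition etale_groupoid :: "'a groupoid \<Rightarrow> bool" where
  "etale_groupoid G \<longleftrightarrow> topological_groupoid G \<and>
     Hausdorff_space (top G) \<and> locally_compact_space (top G) \<and>
     (\<forall>g\<in>arrows G. \<exists>V. openin (top G) V \<and> g \<in> V \<and>
        openin (unit_top G) (rng G ` V) \<and>
        homeomorphic_map (subtopology (top G) V) (subtopology (unit_top G) (rng G ` V)) (rng G))"

definition essentially_principal :: "'a groupoid \<Rightarrow> bool" where
  "essentially_principal G \<longleftrightarrow>
     (top G) interior_of {g \<in> arrows G. rng G g = src G g} = units G"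

definition totally_disconnected_space :: "'a topology \<Rightarrow> bool" where
  "totally_disconnected_space X \<longleftrightarrow> (\<forall>S. connectedin X S \<longrightarrow> (\<exists>a. S \<subseteq> {a}))"

definition Gset :: "'a groupoid \<Rightarrow> 'a set \<Rightarrow> bool" where
  "Gset G V \<longleftrightarrow> V \<subseteq> arrows G \<and> inj_on (rng G) V \<and> inj_on (src G) V"

definition tau :: "'a groupoid \<Rightarrow> 'a set \<Rightarrow> 'a \<Rightarrow> 'a" where
  "tau G V = (\<lambda>x. if x \<in> units G then rng G (the_inv_into V (src G) x) else x)"

text \<open>[[G]]: homeomorphisms tau_V of the unit space, V a compact open G-set
(necessarily with r(V) = s(V) = unit space).\<close>
definition full_bisection :: "'a groupoid \<Rightarrow> 'a set \<Rightarrow> bool" where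
  "full_bisection G V \<longleftrightarrow> Gset G V \<and> compactin (top G) V \<and> openin (top G) V \<and>
     src G ` V = units G \<and> rng G ` V = units G"

definition topological_full_group :: "'a groupoid \<Rightarrow> ('a \<Rightarrow> 'a) set" where
  "topological_full_group G = {tau G V | V. full_bisection G V}"

definition Cc_int :: "'b topology \<Rightarrow> 'b set \<Rightarrow> ('b \<Rightarrow> int) set" where
  "Cc_int X S = {f. (\<forall>x. x \<notin> S \<longrightarrow> f x = 0) \<and>
     (\<forall>x\<in>S. \<exists>W. openin (subtopology X S) W \<and> x \<in> W \<and> (\<forall>y\<in>W. f y = f x)) \<and>
     compactin (subtopology X S) {x \<in> S. f x \<noteq> 0}}"

definition pushf :: "'b set \<Rightarrow> ('b \<Rightarrow> 'c) \<Rightarrow> ('b \<Rightarrow> int) \<Rightarrow> 'c \<Rightarrow> int" where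
  "pushf S \<pi> f y = (\<Sum>x\<in>{x \<in> S. \<pi> x = y \<and> f x \<noteq> 0}. f x)"

definition delta1 :: "'a groupoid \<Rightarrow> ('a \<Rightarrow> int) \<Rightarrow> 'a \<Rightarrow> int" where
  "delta1 G f = (\<lambda>y. pushf (arrows G) (src G) f y - pushf (arrows G) (rng G) f y)"

definition delta2 :: "'a groupoid \<Rightarrow> ('a \<times> 'a \<Rightarrow> int) \<Rightarrow> 'a \<Rightarrow> int" where
  "delta2 G F = (\<lambda>g. pushf (composable G) snd F g
                    - pushf (composable G) (\<lambda>(g1,g2). mul G g1 g2) F g
                    + pushf (composable G) fst F g)"

text \<open>tau_V lies in the kernel of the index map I(tau_V) = [1_V] in H_1(G)
iff 1_V lies in the image of delta2.\<close>
definition in_index_kernel :: "'a groupoid \<Rightarrow> ('a \<Rightarrow> 'a) \<Rightarrow> bool" where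
  "in_index_kernel G \<gamma> \<longleftrightarrow> (\<exists>V. full_bisection G V \<and> \<gamma> = tau G V \<and>
     (\<exists>F \<in> Cc_int (prod_topology (top G) (top G)) (composable G).
         delta2 G F = (indicator V :: 'a \<Rightarrow> int)))"

definition finite_order_on :: "'a set \<Rightarrow> ('a \<Rightarrow> 'a) \<Rightarrow> bool" where
  "finite_order_on X \<gamma> \<longleftrightarrow> (\<exists>n>0. \<forall>x\<in>X. (\<gamma> ^^ n) x = x)"

definition elementary :: "'a groupoid \<Rightarrow> ('a \<Rightarrow> 'a) \<Rightarrow> bool" where
  "elementary G \<gamma> \<longleftrightarrow> finite_order_on (units G) \<gamma> \<and>
     (\<forall>k::nat. closedin (unit_top G) {x \<in> units G. (\<gamma> ^^ k) x = x} \<and>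
               openin (unit_top G) {x \<in> units G. (\<gamma> ^^ k) x = x})"

definition elementary_subgroupoid :: "'a groupoid \<Rightarrow> 'a set \<Rightarrow> bool" where
  "elementary_subgroupoid G K \<longleftrightarrow>
     K \<subseteq> arrows G \<and> compactin (top G) K \<and> openin (top G) K \<and>
     units G \<subseteq> K \<and>
     (\<forall>g\<in>K. \<forall>h\<in>K. src G g = rng G h \<longrightarrow> mul G g h \<in> K) \<and>
     (\<forall>g\<in>K. inv G g \<in> K) \<and>
     (\<forall>k\<in>K. rng G k = src G k \<longrightarrow> k \<in> units G)"

definition almost_finite :: "'a groupoid \<Rightarrow> bool" where
  "almost_finite G \<longleftrightarrow>
     (\<forall>C \<epsilon>. compactin (top G) C \<and> (\<epsilon>::real) > 0 \<longrightarrow>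
        (\<exists>K. elementary_subgroupoid G K \<and>
           (\<forall>x\<in>units G.
              let Kx = {k \<in> K. src G k = x};
                  CKx = {mul G c k | c k. c \<in> C \<and> k \<in> Kx \<and> src G c = rng G k}
              in real (card (CKx - Kx)) / real (card (rng G ` Kx)) < \<epsilon>)))"

end

theory Submission
  imports Defs
begin

text \<open>
  Let \<open>\<gamma> = \<tau>\<^sub>V\<close>. If \<open>1\<^sub>V\<close> is a boundary, then \<open>1\<^sub>V + \<Sum>(1\<^sub>E + 1\<^bsub>E\<^sup>-\<^sup>1\<^esub>) = \<Sum>(1\<^sub>A + 1\<^sub>B + 1\<^bsub>(AB)\<^sup>-\<^sup>1\<^esub>)\<close>
  for finitely many compact open bisections \<open>E\<close>, \<open>A\<close>, \<open>B\<close> with \<open>s(A) = r(B)\<close>. Almost finiteness yields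
  an elementary subgroupoid \<open>K\<close> such that outside \<open>K\<close> all these bisections touch only a small
  proportion of every \<open>K\<close>-orbit. Hence there is room to move the parts outside \<open>K\<close> by elements of
  \<open>K\<close> to pairwise disjoint places, where every triangle \<open>(A, B)\<close> becomes a 3-cycle and every \<open>E\<close> a
  2-cycle; this gives \<open>\<beta>\<close> of order 3 and an involution \<open>\<iota>\<close>. By the identity of chains, \<open>\<gamma>\<iota>\<close> and \<open>\<beta>\<close>
  have equally many arrows in every double coset \<open>KgK\<close>, and matching these arrows up gives
  \<open>\<gamma>\<iota> = a\<beta>b\<close> with \<open>a\<close>, \<open>b\<close> in the full group of \<open>K\<close>. Thus \<open>\<gamma> = a\<beta>b\<iota>\<close>.
\<close>

section \<open>Groupoid algebra\<close>

text \<open>The bisections in the identity of chains overlap, so they cannot simply be united into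
  one bisection. Multiplying an arrow by elements of \<open>K\<close> on both sides keeps it in its
  double coset, and within one double coset any arrow can be carried to any other. Hence the number
  of arrows in each double coset is all that has to be preserved while the pieces are separated, and
  equality of these numbers is all that matching needs; the work lies in matching by compact open
  sets instead of pointwise. Double cosets inside \<open>K\<close> need no placing: a full bisection
  has one arrow over each point of an orbit, so its counts outside \<open>K\<close> determine those
  inside. Room: each of the three slots of a triangle is covered by two sets of sources of arrows
  outside \<open>K\<close>, each of the two slots of an edge by one. With every such set at most 1/N
  of an orbit, the 3-cycles use 6/N per triangle and the 2-cycles 2/N per edge. The involution must
  moreover avoid the sources of V - K, which costs 1/N; then multiplying V by it on the right simply
  adds its counts outside \<open>K\<close>. The choice of \<open>N\<close> in
  \<open>factorisation\<close> covers both budgets.\<close>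

locale algebraic_groupoid =
  fixes G :: "'a groupoid"
  assumes groupoid_axioms: "groupoid_axioms G"
begin

abbreviation A0 :: "'a set" where "A0 \<equiv> arrows G"
abbreviation U0 :: "'a set" where "U0 \<equiv> units G"
abbreviation r :: "'a \<Rightarrow> 'a" where "r \<equiv> rng G"
abbreviation s :: "'a \<Rightarrow> 'a" where "s \<equiv> src G"
abbreviation iv :: "'a \<Rightarrow> 'a" where "iv \<equiv> inv G"
abbreviation gmul :: "'a \<Rightarrow> 'a \<Rightarrow> 'a" (infixl "\<odot>" 70) where "g \<odot> h \<equiv> mul G g h"

lemma units_arrows: "U0 \<subseteq> A0"
  using groupoid_axioms unfolding groupoid_axioms_def by blast

lemma unit_arrow [simp]: "u \<in> U0 \<Longrightarrow> u \<in> A0"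
  using units_arrows by blast

lemma r_unit [simp]: "g \<in> A0 \<Longrightarrow> r g \<in> U0" and s_unit [simp]: "g \<in> A0 \<Longrightarrow> s g \<in> U0"
  using groupoid_axioms unfolding groupoid_axioms_def by blast+

lemma unit_r [simp]: "u \<in> U0 \<Longrightarrow> r u = u" and unit_s [simp]: "u \<in> U0 \<Longrightarrow> s u = u"
  using groupoid_axioms unfolding groupoid_axioms_def by blast+

lemma
  assumes "g \<in> A0" "h \<in> A0" "s g = r h"
  shows mul_arrow [simp]: "g \<odot> h \<in> A0"
    and r_mul [simp]: "r (g \<odot> h) = r g"
    and s_mul [simp]: "s (g \<odot> h) = s h"
proof -
  have "(g, h) \<in> composable G" using assms by (simp add: composable_def)
  then have "g \<odot> h \<in> A0 \<and> r (g \<odot> h) = r g \<and> s (g \<odot> h) = s h"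
    using groupoid_axioms unfolding groupoid_axioms_def by blast
  then show "g \<odot> h \<in> A0" "r (g \<odot> h) = r g" "s (g \<odot> h) = s h" by auto
qed

lemma mul_assoc:
  "\<lbrakk>g \<in> A0; h \<in> A0; k \<in> A0; s g = r h; s h = r k\<rbrakk> \<Longrightarrow> g \<odot> h \<odot> k = g \<odot> (h \<odot> k)"
  using groupoid_axioms unfolding groupoid_axioms_def by blast

lemma mul_unit_left [simp]: "g \<in> A0 \<Longrightarrow> r g \<odot> g = g"
  and mul_unit_right [simp]: "g \<in> A0 \<Longrightarrow> g \<odot> s g = g"
  using groupoid_axioms unfolding groupoid_axioms_def by blast+

lemma mul_unit_eq [simp]: "g \<in> A0 \<Longrightarrow> u = r g \<Longrightarrow> u \<odot> g = g" "g \<in> A0 \<Longrightarrow> u = s g \<Longrightarrow> g \<odot> u = g"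
  by simp_all

lemma inv_arrow [simp]: "g \<in> A0 \<Longrightarrow> iv g \<in> A0"
  and r_inv [simp]: "g \<in> A0 \<Longrightarrow> r (iv g) = s g"
  and s_inv [simp]: "g \<in> A0 \<Longrightarrow> s (iv g) = r g"
  and mul_inv_right [simp]: "g \<in> A0 \<Longrightarrow> g \<odot> iv g = r g"
  and mul_inv_left [simp]: "g \<in> A0 \<Longrightarrow> iv g \<odot> g = s g"
  using groupoid_axioms unfolding groupoid_axioms_def by blast+

lemma inv_mul_cancel [simp]: "\<lbrakk>g \<in> A0; h \<in> A0; s g = r h\<rbrakk> \<Longrightarrow> iv g \<odot> (g \<odot> h) = h"
  by (subst mul_assoc [symmetric]) auto

lemma mul_inv_cancel [simp]: "\<lbrakk>g \<in> A0; h \<in> A0; r g = r h\<rbrakk> \<Longrightarrow> g \<odot> (iv g \<odot> h) = h"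
  by (subst mul_assoc [symmetric]) auto

lemma mul_inv_cancel_right [simp]: "\<lbrakk>g \<in> A0; h \<in> A0; s g = r h\<rbrakk> \<Longrightarrow> g \<odot> h \<odot> iv h = g"
  by (subst mul_assoc) auto

lemma inv_mul_cancel_right [simp]: "\<lbrakk>g \<in> A0; h \<in> A0; s g = s h\<rbrakk> \<Longrightarrow> g \<odot> iv h \<odot> h = g"
  by (subst mul_assoc) auto

lemma inv_unique: "\<lbrakk>g \<in> A0; h \<in> A0; s g = r h; g \<odot> h = r g\<rbrakk> \<Longrightarrow> h = iv g"
  by (metis inv_mul_cancel inv_arrow mul_unit_right s_inv)

lemma inv_inv [simp]: "g \<in> A0 \<Longrightarrow> iv (iv g) = g"
  by (metis inv_unique inv_arrow mul_inv_left r_inv s_inv)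

section \<open>Products and inverses of bisections\<close>

definition prd :: "'a set \<Rightarrow> 'a set \<Rightarrow> 'a set" (infixl "\<otimes>" 70) where
  "A \<otimes> B = {g \<odot> h |g h. g \<in> A \<and> h \<in> B \<and> s g = r h}"

lemma prdI: "\<lbrakk>g \<in> A; h \<in> B; s g = r h\<rbrakk> \<Longrightarrow> g \<odot> h \<in> A \<otimes> B"
  by (auto simp: prd_def)

lemma prdE:
  assumes "x \<in> A \<otimes> B"
  obtains g h where "x = g \<odot> h" "g \<in> A" "h \<in> B" "s g = r h"
  using assms by (auto simp: prd_def)

lemma Gset_arrow: "Gset G A \<Longrightarrow> g \<in> A \<Longrightarrow> g \<in> A0"
  by (auto simp: Gset_def)

lemma Gset_r_eq: "\<lbrakk>Gset G A; g \<in> A; h \<in> A; r g = r h\<rbrakk> \<Longrightarrow> g = h"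
  and Gset_s_eq: "\<lbrakk>Gset G A; g \<in> A; h \<in> A; s g = s h\<rbrakk> \<Longrightarrow> g = h"
  by (auto simp: Gset_def dest: inj_onD)

lemma Gset_subset: "Gset G A \<Longrightarrow> B \<subseteq> A \<Longrightarrow> Gset G B"
  by (auto simp: Gset_def intro: inj_on_subset)

text \<open>The range of a product determines its left factor, hence the unit in the middle, hence
  the right factor; sources work dually.\<close>

lemma Gset_prd:
  assumes A: "Gset G A" and B: "Gset G B" shows "Gset G (A \<otimes> B)"
  unfolding Gset_def
proof (intro conjI inj_onI)
  show "A \<otimes> B \<subseteq> A0"
    using A B by (auto elim!: prdE simp: Gset_arrow)
next
  fix x y assume x: "x \<in> A \<otimes> B" and y: "y \<in> A \<otimes> B" and "r x = r y"
  from x obtain g h where 1: "x = g \<odot> h" "g \<in> A" "h \<in> B" "s g = r h" by (rule prdE)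
  from y obtain g' h' where 2: "y = g' \<odot> h'" "g' \<in> A" "h' \<in> B" "s g' = r h'" by (rule prdE)
  have "g = g'" by (rule Gset_r_eq [OF A]) (use 1 2 \<open>r x = r y\<close> A B Gset_arrow in auto)
  moreover have "h = h'" by (rule Gset_r_eq [OF B]) (use 1 2 \<open>g = g'\<close> in auto)
  ultimately show "x = y" using 1 2 by simp
next
  fix x y assume x: "x \<in> A \<otimes> B" and y: "y \<in> A \<otimes> B" and "s x = s y"
  from x obtain g h where 1: "x = g \<odot> h" "g \<in> A" "h \<in> B" "s g = r h" by (rule prdE)
  from y obtain g' h' where 2: "y = g' \<odot> h'" "g' \<in> A" "h' \<in> B" "s g' = r h'" by (rule prdE)
  have "h = h'" by (rule Gset_s_eq [OF B]) (use 1 2 \<open>s x = s y\<close> A B Gset_arrow in auto)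
  moreover have "g = g'" by (rule Gset_s_eq [OF A]) (use 1 2 \<open>h = h'\<close> in auto)
  ultimately show "x = y" using 1 2 by simp
qed

lemma Gset_inv: "Gset G A \<Longrightarrow> Gset G (iv ` A)"
  unfolding Gset_def by (auto simp: inj_on_def subset_iff)

lemma Gset_Un:
  assumes "Gset G A" "Gset G B" "r ` A \<inter> r ` B = {}" "s ` A \<inter> s ` B = {}"
  shows "Gset G (A \<union> B)"
  using assms unfolding Gset_def by (auto simp: inj_on_Un)

lemma Gset_units: "W \<subseteq> U0 \<Longrightarrow> Gset G W"
  by (auto simp: Gset_def inj_on_def subset_iff)

end

section \<open>Compact open bisections\<close>

text \<open>In a compact Hausdorff space quasi-components are components, here single points. A
  point is thus separated by clopen sets from each point outside V, and by compactness from the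
  whole complement at once.\<close>

lemma compact_Hausdorff_clopen_basis:
  assumes "compact_space X" "Hausdorff_space X" "totally_disconnected_space X"
    and "openin X V" "x \<in> V"
  obtains Z where "openin X Z" "closedin X Z" "x \<in> Z" "Z \<subseteq> V"
proof -
  have x: "x \<in> topspace X" using assms by (meson openin_subset subsetD)
  define C where "C = quasi_component_of_set X x"
  have C: "C \<in> quasi_components_of X"
    using x by (simp add: C_def quasi_components_of_def)
  then have "connectedin X C"
    using quasi_eq_connected_components_of assms connectedin_connected_components_of by blast
  then obtain a where "C \<subseteq> {a}"
    using assms(3) unfolding totally_disconnected_space_def by blast
  moreover have "x \<in> C" using x by (simp add: C_def)
  ultimately have Cx: "C = {x}" by blast
  have "compactin X (topspace X - V)"
    using assms by (meson closedin_compact_space closedin_diff closedin_topspace openin_closedin_eq)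
  then have "separated_between X C (topspace X - V)"
    using separated_between_quasi_component_compact [OF C] Cx \<open>x \<in> V\<close> by (auto simp: disjnt_def)
  then obtain Z where "closedin X Z" "openin X Z" "C \<subseteq> Z" "topspace X - V \<subseteq> topspace X - Z"
    unfolding separated_between by blast
  moreover from this have "Z \<subseteq> V"
    using openin_subset by blast
  ultimately show ?thesis using that Cx by blast
qed

text \<open>Openness of the unit space is supplied by essential principality, which presents it as
  an interior.\<close>

locale ample_groupoid = algebraic_groupoid +
  assumes etale: "etale_groupoid G"
    and open_units: "openin (top G) (units G)"
    and compact_units: "compactin (top G) (units G)"
    and totally_disconnected_units: "totally_disconnected_space (unit_top G)"
begin

abbreviation X0 :: "'a topology" where "X0 \<equiv> top G"

lemma Hausdorff: "Hausdorff_space X0"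
  using etale by (simp add: etale_groupoid_def)

lemma topspace_X0 [simp]: "topspace X0 = A0"
  by (simp add: arrows_def)

lemma continuous_s: "continuous_map X0 X0 s" and continuous_r: "continuous_map X0 X0 r"
  and continuous_inv: "continuous_map X0 X0 iv"
  and continuous_mul:
    "continuous_map (subtopology (prod_topology X0 X0) (composable G)) X0 (\<lambda>(g,h). g \<odot> h)"
  using etale unfolding etale_groupoid_def topological_groupoid_def unit_top_def
  by (auto simp: continuous_map_in_subtopology)

lemma openin_unit_top: "openin (unit_top G) W \<longleftrightarrow> openin X0 W \<and> W \<subseteq> U0"
  unfolding unit_top_def using open_units by (simp add: openin_open_subtopology)

text \<open>Openness of the unit space turns sets open in it into sets open among the arrows, so the
  local homeomorphisms can be read as open maps of the arrow space into itself.\<close>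

lemma r_local_homeo:
  assumes "g \<in> A0"
  obtains V where "openin X0 V" "g \<in> V" "inj_on r V"
    "\<And>W. openin X0 W \<Longrightarrow> W \<subseteq> V \<Longrightarrow> openin X0 (r ` W)"
proof -
  obtain V where V: "openin X0 V" "g \<in> V" "openin (unit_top G) (r ` V)"
    "homeomorphic_map (subtopology X0 V) (subtopology (unit_top G) (r ` V)) r"
    using etale assms unfolding etale_groupoid_def by blast
  have "topspace (subtopology X0 V) = V"
    using V(1) openin_subset by fastforce
  then have "inj_on r V"
    using homeomorphic_imp_injective_map [OF V(4)] by simp
  moreover have "openin X0 (r ` W)" if "openin X0 W" "W \<subseteq> V" for W
  proof -
    have "openin (subtopology X0 V) W"
      using that V(1) by (simp add: openin_open_subtopology)
    then have "openin (subtopology (unit_top G) (r ` V)) (r ` W)"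
      using homeomorphic_imp_open_map [OF V(4)] by (simp add: open_map_def)
    then have "openin (unit_top G) (r ` W)"
      using V(3) openin_trans_full by blast
    then show ?thesis by (simp add: openin_unit_top)
  qed
  ultimately show ?thesis using that V(1,2) by blast
qed

lemma open_r: assumes "openin X0 W" shows "openin X0 (r ` W)"
proof (subst openin_subopen, intro ballI)
  fix y assume "y \<in> r ` W"
  then obtain g where g: "g \<in> W" "y = r g" by blast
  then have "g \<in> A0" using assms openin_subset by fastforce
  then obtain V where V: "openin X0 V" "g \<in> V"
      "\<And>W. openin X0 W \<Longrightarrow> W \<subseteq> V \<Longrightarrow> openin X0 (r ` W)"
    using r_local_homeo by metis
  have "openin X0 (r ` (W \<inter> V))"
    using assms V by auto
  then show "\<exists>T. openin X0 T \<and> y \<in> T \<and> T \<subseteq> r ` W"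
    using g V by blast
qed

lemma inv_image_eq: "W \<subseteq> A0 \<Longrightarrow> iv ` W = {g \<in> A0. iv g \<in> W}"
  by (auto simp: image_iff) (metis inv_inv)

lemma open_inv: "openin X0 W \<Longrightarrow> openin X0 (iv ` W)"
  using inv_image_eq [of W] openin_subset [of X0 W]
    openin_continuous_map_preimage [OF continuous_inv, of W] by simp

lemma open_s: assumes "openin X0 W" shows "openin X0 (s ` W)"
proof -
  have "W \<subseteq> A0" using assms openin_subset by fastforce
  then have "s ` W = r ` (iv ` W)"
    by (auto simp: image_image intro!: image_cong)
  then show ?thesis using open_r open_inv assms by simp
qed

section \<open>The ring of compact open sets\<close>

definition KO :: "'a set set" where "KO = {A. compactin X0 A \<and> openin X0 A}"

lemma KO_arrows: "A \<in> KO \<Longrightarrow> A \<subseteq> A0"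
  unfolding KO_def using openin_subset by fastforce

lemma KO_closed: "A \<in> KO \<Longrightarrow> closedin X0 A"
  using Hausdorff compactin_imp_closedin unfolding KO_def by blast

lemma KO_empty [simp]: "{} \<in> KO" and KO_units [simp]: "U0 \<in> KO"
  unfolding KO_def using open_units compact_units by auto

lemma KO_Un [simp]: "A \<in> KO \<Longrightarrow> B \<in> KO \<Longrightarrow> A \<union> B \<in> KO"
  unfolding KO_def by (auto simp: compactin_Un)

lemma KO_Union: "finite F \<Longrightarrow> F \<subseteq> KO \<Longrightarrow> \<Union>F \<in> KO"
  by (induction F rule: finite_induct) auto

text \<open>Compact sets are closed because the space is Hausdorff: removing B leaves an open set,
  and it leaves a closed part of the compact set A.\<close>

lemma KO_Diff [simp]: assumes "A \<in> KO" "B \<in> KO" shows "A - B \<in> KO"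
proof -
  have "A - B = A \<inter> (A0 - B)" using KO_arrows assms by auto
  moreover have "closedin X0 (A0 - B)"
    using assms unfolding KO_def by (metis (lifting) CollectD closedin_def double_diff
      openin_subset order_refl topspace_X0 Diff_subset)
  ultimately have "compactin X0 (A - B)"
    using assms unfolding KO_def by (auto intro: compact_Int_closedin)
  moreover have "openin X0 (A - B)"
    using assms KO_closed unfolding KO_def by (blast intro: openin_diff)
  ultimately show ?thesis by (simp add: KO_def)
qed

lemma KO_Int [simp]: "A \<in> KO \<Longrightarrow> B \<in> KO \<Longrightarrow> A \<inter> B \<in> KO"
  by (metis Diff_Diff_Int KO_Diff)

lemma KO_r [simp]: "A \<in> KO \<Longrightarrow> r ` A \<in> KO" and KO_s [simp]: "A \<in> KO \<Longrightarrow> s ` A \<in> KO"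
  and KO_inv [simp]: "A \<in> KO \<Longrightarrow> iv ` A \<in> KO"
  unfolding KO_def
  using image_compactin continuous_r continuous_s continuous_inv open_r open_s open_inv by blast+

lemma KO_preimage_s: assumes "A \<in> KO" "W \<in> KO" shows "{g \<in> A. s g \<in> W} \<in> KO"
proof -
  have eq: "{g \<in> A. s g \<in> W} = A \<inter> {g \<in> topspace X0. s g \<in> W}"
    using KO_arrows [OF assms(1)] by auto
  have "closedin X0 {g \<in> topspace X0. s g \<in> W}"
    using continuous_s KO_closed [OF assms(2)] closedin_continuous_map_preimage by blast
  moreover have "openin X0 {g \<in> topspace X0. s g \<in> W}"
    using continuous_s assms(2) openin_continuous_map_preimage unfolding KO_def by blast
  ultimately show ?thesis
    using assms(1) unfolding eq unfolding KO_def by (auto intro: compact_Int_closedin)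
qed

lemma KO_preimage_r: assumes "A \<in> KO" "W \<in> KO" shows "{g \<in> A. r g \<in> W} \<in> KO"
proof -
  have eq: "{g \<in> A. r g \<in> W} = A \<inter> {g \<in> topspace X0. r g \<in> W}"
    using KO_arrows [OF assms(1)] by auto
  have "closedin X0 {g \<in> topspace X0. r g \<in> W}"
    using continuous_r KO_closed [OF assms(2)] closedin_continuous_map_preimage by blast
  moreover have "openin X0 {g \<in> topspace X0. r g \<in> W}"
    using continuous_r assms(2) openin_continuous_map_preimage unfolding KO_def by blast
  ultimately show ?thesis
    using assms(1) unfolding eq unfolding KO_def by (auto intro: compact_Int_closedin)
qed

definition bis :: "'a set \<Rightarrow> bool" where "bis A \<longleftrightarrow> A \<in> KO \<and> Gset G A"

lemma bis_KO: "bis A \<Longrightarrow> A \<in> KO" and bis_Gset: "bis A \<Longrightarrow> Gset G A"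
  by (auto simp: bis_def)

text \<open>The preimage of an open W under the section is the range of A intersected with W, and
  \<open>r\<close> is open.\<close>

lemma r_section_continuous:
  assumes "bis A"
  shows "continuous_map (subtopology X0 (r ` A)) X0 (the_inv_into A r)"
proof -
  have inj: "inj_on r A" using assms by (simp add: bis_def Gset_def)
  have sub: "A \<subseteq> A0" using assms bis_KO KO_arrows by blast
  have opA: "openin X0 A" "openin X0 (r ` A)"
    using assms bis_KO KO_r unfolding KO_def by blast+
  have top: "topspace (subtopology X0 (r ` A)) = r ` A"
    using opA(2) openin_subset by fastforce
  show ?thesis
    unfolding continuous_map top
  proof (intro conjI allI impI)
    show "the_inv_into A r ` r ` A \<subseteq> topspace X0"
      using the_inv_into_f_f [OF inj] sub by auto
  next
    fix W assume W: "openin X0 W"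
    have "{x \<in> r ` A. the_inv_into A r x \<in> W} = r ` (A \<inter> W)"
      using the_inv_into_f_f [OF inj] by auto
    moreover have "openin X0 (r ` (A \<inter> W))"
      using open_r opA W by blast
    ultimately show "openin (subtopology X0 (r ` A)) {x \<in> r ` A. the_inv_into A r x \<in> W}"
      using opA(2) by (auto simp: openin_open_subtopology)
  qed
qed

text \<open>The composable pairs form the equaliser of two continuous maps into a Hausdorff space,
  so those in A x B form a compact set; the product is its image under multiplication.\<close>

lemma compactin_prd:
  assumes A: "A \<in> KO" and B: "B \<in> KO" shows "compactin X0 (A \<otimes> B)"
proof -
  let ?P = "prod_topology X0 X0"
  have "compactin ?P (A \<times> B)"
    using assms by (simp add: compactin_Times KO_def)
  moreover have "closedin ?P {p \<in> topspace ?P. (s \<circ> fst) p = (r \<circ> snd) p}"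
    by (rule closedin_continuous_maps_eq [OF Hausdorff])
      (intro continuous_map_compose [of _ X0] continuous_s continuous_r
        continuous_map_fst continuous_map_snd)+
  moreover have comp: "{p \<in> topspace ?P. (s \<circ> fst) p = (r \<circ> snd) p} = composable G"
    by (auto simp: composable_def)
  ultimately have "compactin ?P (A \<times> B \<inter> composable G)"
    by (auto intro: compact_Int_closedin)
  then have "compactin (subtopology ?P (composable G)) (A \<times> B \<inter> composable G)"
    by (simp add: compactin_subtopology)
  then have "compactin X0 ((\<lambda>(g,h). g \<odot> h) ` (A \<times> B \<inter> composable G))"
    using image_compactin continuous_mul by blast
  moreover have "(\<lambda>(g,h). g \<odot> h) ` (A \<times> B \<inter> composable G) = A \<otimes> B"
    using KO_arrows [OF A] KO_arrows [OF B]
    unfolding prd_def composable_def by (fastforce simp: image_iff)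
  ultimately show ?thesis by simp
qed

text \<open>Membership in A B can be tested continuously: if a is the arrow of A with the range of
  g, then g lies in A B exactly when the inverse of a times g lies in B. Here a depends continuously
  on g through the section of A.\<close>

lemma open_prd:
  assumes A: "bis A" and B: "openin X0 B" shows "openin X0 (A \<otimes> B)"
proof -
  let ?sec = "the_inv_into A r"
  let ?D = "{g \<in> topspace X0. r g \<in> r ` A}"
  have inj: "inj_on r A" using assms by (simp add: bis_def Gset_def)
  have sub: "A \<subseteq> A0" "B \<subseteq> A0"
    using KO_arrows [OF bis_KO [OF A]] openin_subset [OF B] by simp_all
  have opD: "openin X0 ?D"
    using continuous_r A bis_KO KO_r unfolding KO_def by (blast intro: openin_continuous_map_preimage)
  have topD: "topspace (subtopology X0 ?D) = ?D" by auto
  have 1: "continuous_map (subtopology X0 ?D) (subtopology X0 (r ` A)) r"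
    by (auto simp: continuous_map_in_subtopology continuous_map_from_subtopology continuous_r)
  have 2: "continuous_map (subtopology X0 ?D) X0 (iv \<circ> ?sec \<circ> r)"
    using continuous_map_compose [OF continuous_map_compose [OF 1 r_section_continuous [OF A]] continuous_inv]
    by (simp add: comp_assoc)
  have sec: "?sec (r g) \<in> A0" "r (?sec (r g)) = r g" if "g \<in> ?D" for g
    using that sub f_the_inv_into_f [OF inj] the_inv_into_into [OF inj, of "r g" A] by auto
  have 3: "continuous_map (subtopology X0 ?D) (subtopology (prod_topology X0 X0) (composable G))
      (\<lambda>g. ((iv \<circ> ?sec \<circ> r) g, g))"
    unfolding continuous_map_in_subtopology
  proof
    show "continuous_map (subtopology X0 ?D) (prod_topology X0 X0) (\<lambda>g. ((iv \<circ> ?sec \<circ> r) g, g))"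
      by (intro continuous_map_pairedI 2 continuous_map_from_subtopology continuous_map_id [unfolded id_def])
    show "(\<lambda>g. ((iv \<circ> ?sec \<circ> r) g, g)) \<in> topspace (subtopology X0 ?D) \<rightarrow> composable G"
      using sec by (auto simp: composable_def)
  qed
  let ?f = "(\<lambda>(g,h). g \<odot> h) \<circ> (\<lambda>g. ((iv \<circ> ?sec \<circ> r) g, g))"
  have 4: "continuous_map (subtopology X0 ?D) X0 ?f"
    by (rule continuous_map_compose [OF 3 continuous_mul])
  have "openin (subtopology X0 ?D) {g \<in> topspace (subtopology X0 ?D). ?f g \<in> B}"
    by (rule openin_continuous_map_preimage [OF 4 B])
  then have "openin X0 {g \<in> ?D. ?f g \<in> B}"
    unfolding topD using opD openin_trans_full by blast
  moreover have "{g \<in> ?D. ?f g \<in> B} = A \<otimes> B"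
  proof safe
    fix g a assume g: "g \<in> topspace X0" "a \<in> A" "r g = r a" "?f g \<in> B"
    have a: "?sec (r g) = a" using g inj by (simp add: the_inv_into_f_f)
    then have "iv a \<odot> g \<in> B" using g by simp
    moreover have "g = a \<odot> (iv a \<odot> g)" using g sub by auto
    ultimately show "g \<in> A \<otimes> B"
      using prdI [of a A "iv a \<odot> g" B] g sub by auto
  next
    fix g assume "g \<in> A \<otimes> B"
    then obtain a b where g: "g = a \<odot> b" "a \<in> A" "b \<in> B" "s a = r b" by (rule prdE)
    then have ab: "a \<in> A0" "b \<in> A0" using sub by auto
    then show "g \<in> topspace X0" "r g \<in> r ` A" using g by auto
    show "?f g \<in> B" using g ab inj by (simp add: the_inv_into_f_f)
  qed
  ultimately show ?thesis by simp
qed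

lemma bis_prd [simp]: "bis A \<Longrightarrow> bis B \<Longrightarrow> bis (A \<otimes> B)"
  using compactin_prd open_prd Gset_prd unfolding bis_def KO_def by blast

lemma bis_inv [simp]: "bis A \<Longrightarrow> bis (iv ` A)"
  unfolding bis_def using Gset_inv by simp

lemma bis_subset: "bis A \<Longrightarrow> B \<in> KO \<Longrightarrow> B \<subseteq> A \<Longrightarrow> bis B"
  unfolding bis_def using Gset_subset by blast

lemma bis_Int_left: "bis A \<Longrightarrow> B \<in> KO \<Longrightarrow> bis (A \<inter> B)"
  and bis_Diff: "bis A \<Longrightarrow> B \<in> KO \<Longrightarrow> bis (A - B)"
  by (auto intro: bis_subset simp: bis_KO)

lemma bis_units: "W \<in> KO \<Longrightarrow> W \<subseteq> U0 \<Longrightarrow> bis W"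
  by (simp add: bis_def Gset_units)

lemma bis_Un:
  "\<lbrakk>bis A; bis B; r ` A \<inter> r ` B = {}; s ` A \<inter> s ` B = {}\<rbrakk> \<Longrightarrow> bis (A \<union> B)"
  by (simp add: bis_def Gset_Un)

text \<open>Shrink W until \<open>r\<close> is injective and, by way of inversion, \<open>s\<close>
  is injective too; then keep only the arrows over a clopen set Z of units. Over the compact set Z
  the map \<open>r\<close> has a continuous inverse, which makes the remaining set compact.\<close>

lemma bis_basis:
  assumes W: "openin X0 W" and g: "g \<in> W"
  obtains A where "bis A" "g \<in> A" "A \<subseteq> W"
proof -
  have gA: "g \<in> A0" using assms openin_subset by fastforce
  obtain V1 where V1: "openin X0 V1" "g \<in> V1" "inj_on r V1"
    using r_local_homeo [OF gA] by metis
  obtain V2 where V2: "openin X0 V2" "iv g \<in> V2" "inj_on r V2"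
    using r_local_homeo [of "iv g"] gA by (metis inv_arrow)
  have V2': "V2 \<subseteq> A0" using V2(1) openin_subset by fastforce
  define V where "V = W \<inter> V1 \<inter> iv ` V2"
  have V: "openin X0 V" "g \<in> V"
    using W V1 V2 open_inv g gA unfolding V_def by (auto simp: image_iff intro: bexI [of _ "iv g"])
  have injs: "inj_on s V"
  proof (rule inj_onI)
    fix a b assume "a \<in> V" "b \<in> V" "s a = s b"
    then obtain a' b' where "a = iv a'" "b = iv b'" "a' \<in> V2" "b' \<in> V2"
      unfolding V_def by blast
    moreover from this have "r a' = r b'" using \<open>s a = s b\<close> V2' by (simp add: subset_iff)
    ultimately show "a = b" using inj_onD [OF V2(3), of a' b'] by simp
  qed
  have injr: "inj_on r V" using V1(3) by (auto simp: V_def inj_on_def)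
  have VA: "V \<subseteq> A0" using V(1) openin_subset by fastforce
  have cpt: "compact_space (unit_top G)"
    unfolding unit_top_def using compact_units by (simp add: compactin_subspace)
  have hd: "Hausdorff_space (unit_top G)"
    unfolding unit_top_def using Hausdorff by (simp add: Hausdorff_space_subtopology)
  have "openin (unit_top G) (r ` V)"
    using open_r V VA by (auto simp: openin_unit_top)
  then obtain Z where Z: "openin (unit_top G) Z" "closedin (unit_top G) Z" "r g \<in> Z" "Z \<subseteq> r ` V"
    using compact_Hausdorff_clopen_basis [OF cpt hd totally_disconnected_units] V(2) by blast
  have Zc: "compactin X0 Z"
    using closedin_compact_space [OF cpt Z(2)] by (simp add: unit_top_def compactin_subtopology)
  have Zo: "openin X0 Z" using Z(1) openin_unit_top by blast
  define A where "A = {a \<in> V. r a \<in> Z}"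
  have "openin X0 {a \<in> topspace X0. r a \<in> Z}"
    using continuous_r Zo openin_continuous_map_preimage by blast
  moreover have "A = V \<inter> {a \<in> topspace X0. r a \<in> Z}"
    using VA by (auto simp: A_def)
  ultimately have opA: "openin X0 A" using V(1) by auto
  have rA: "r ` A = Z" using Z(4) by (auto simp: A_def)
  have injA: "inj_on r A" using injr by (auto simp: A_def inj_on_def)
  \<comment> \<open>The argument of \<open>r_section_continuous\<close> is repeated because
    compactness of A, part of \<open>bis\<close>, is what is being proved.\<close>
  have "continuous_map (subtopology X0 Z) X0 (the_inv_into A r)"
    unfolding continuous_map
  proof (intro conjI allI impI)
    have top: "topspace (subtopology X0 Z) = Z" using Zo openin_subset by fastforce
    show "the_inv_into A r ` topspace (subtopology X0 Z) \<subseteq> topspace X0"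
      using the_inv_into_f_f [OF injA] VA unfolding top rA [symmetric] by (auto simp: A_def)
    fix O' assume O: "openin X0 O'"
    have "{x \<in> topspace (subtopology X0 Z). the_inv_into A r x \<in> O'} = r ` (A \<inter> O')"
      unfolding top unfolding rA [symmetric] using the_inv_into_f_f [OF injA] by auto
    moreover have "openin X0 (r ` (A \<inter> O'))" using open_r opA O by blast
    ultimately show "openin (subtopology X0 Z) {x \<in> topspace (subtopology X0 Z). the_inv_into A r x \<in> O'}"
      using Zo rA by (auto simp: openin_open_subtopology)
  qed
  then have "compactin X0 (the_inv_into A r ` Z)"
    by (rule image_compactin [rotated]) (simp add: compactin_subtopology Zc)
  moreover have "the_inv_into A r ` Z = A"
    unfolding rA [symmetric] using the_inv_into_f_f [OF injA] by (force simp: image_iff)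
  ultimately have "A \<in> KO" using opA by (simp add: KO_def)
  moreover have "Gset G A"
    using injA injs VA by (auto simp: Gset_def A_def inj_on_def)
  moreover have "g \<in> A" "A \<subseteq> W" using V(2) Z(3) by (auto simp: A_def V_def)
  ultimately show ?thesis using that by (auto simp: bis_def)
qed

lemma KO_finite_bis_cover:
  assumes A: "A \<in> KO"
  obtains F where "finite F" "\<And>B. B \<in> F \<Longrightarrow> bis B \<and> B \<subseteq> A" "\<Union>F = A"
proof -
  define F where "F = {B. bis B \<and> B \<subseteq> A}"
  have op: "openin X0 B" if "B \<in> F" for B
    using that bis_KO unfolding F_def KO_def by blast
  have "A \<subseteq> \<Union>F"
  proof
    fix g assume "g \<in> A"
    then obtain B where "bis B" "g \<in> B" "B \<subseteq> A"
      using bis_basis A unfolding KO_def by blast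
    then show "g \<in> \<Union>F" by (auto simp: F_def)
  qed
  moreover have "compactin X0 A" using A by (simp add: KO_def)
  ultimately obtain F' where "finite F'" "F' \<subseteq> F" "A \<subseteq> \<Union>F'"
    using compactinD [of X0 A F] op by blast
  moreover from this have "\<Union>F' = A" by (auto simp: F_def)
  ultimately show ?thesis using that [of F'] by (auto simp: F_def)
qed

end

section \<open>Boundaries as sums of triangles\<close>

lemma pushf_eq_sum:
  assumes "finite T" "{x \<in> S. \<pi> x = y \<and> f x \<noteq> 0} \<subseteq> T" "T \<subseteq> {x \<in> S. \<pi> x = y}"
  shows "pushf S \<pi> f y = sum f T"
  unfolding pushf_def by (rule sum.mono_neutral_left) (use assms in auto)

text \<open>The finiteness assumptions carry weight: a sum over an infinite set is 0 by convention,
  which would break additivity. The index set of \<open>pushf\<close> depends on the function, so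
  both sums are first extended to a common finite set.\<close>

lemma pushf_add:
  assumes f: "finite {x \<in> S. \<pi> x = y \<and> f x \<noteq> 0}" and g: "finite {x \<in> S. \<pi> x = y \<and> g x \<noteq> 0}"
  shows "pushf S \<pi> (\<lambda>x. f x + g x) y = pushf S \<pi> f y + pushf S \<pi> g y"
proof -
  define T where "T = {x \<in> S. \<pi> x = y \<and> f x \<noteq> 0} \<union> {x \<in> S. \<pi> x = y \<and> g x \<noteq> 0}"
  have "finite T" "T \<subseteq> {x \<in> S. \<pi> x = y}" using f g by (auto simp: T_def)
  then have "pushf S \<pi> f y = sum f T" "pushf S \<pi> g y = sum g T"
    "pushf S \<pi> (\<lambda>x. f x + g x) y = sum (\<lambda>x. f x + g x) T"
    by (auto intro!: pushf_eq_sum simp: T_def)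
  then show ?thesis by (simp add: sum.distrib)
qed

lemma finite_fibre_inj: "inj_on \<pi> B \<Longrightarrow> finite {x \<in> B. \<pi> x = y}"
proof -
  assume inj: "inj_on \<pi> B"
  have "\<pi> ` {x \<in> B. \<pi> x = y} \<subseteq> {y}" by auto
  then show ?thesis
    by (rule inj_on_finite [rotated]) (use inj in \<open>auto simp: inj_on_def\<close>)
qed

lemma pushf_indicator:
  assumes "inj_on \<pi> B" "B \<subseteq> S"
  shows "pushf S \<pi> (indicator B) y = indicator (\<pi> ` B) y"
proof -
  have "pushf S \<pi> (indicator B) y = sum (indicator B) {x \<in> B. \<pi> x = y}"
    by (rule pushf_eq_sum) (use assms finite_fibre_inj in \<open>auto simp: indicator_def\<close>)
  also have "\<dots> = indicator (\<pi> ` B) y"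
  proof (cases "y \<in> \<pi> ` B")
    case True
    then obtain x where "x \<in> B" "y = \<pi> x" by blast
    then have "{x \<in> B. \<pi> x = y} = {x}" using assms(1) by (auto simp: inj_on_def)
    then show ?thesis using True \<open>x \<in> B\<close> by simp
  next
    case False
    then have "{x \<in> B. \<pi> x = y} = {}" by auto
    then show ?thesis using False by (simp only: sum.empty indicator_simps simp_thms if_False)
  qed
  finally show ?thesis .
qed

lemma pushf_uminus: "pushf S \<pi> (\<lambda>x. - f x) y = - pushf S \<pi> f y"
  by (simp add: pushf_def sum_negf)

context ample_groupoid
begin

section \<open>Integer combinations of boxes of composable pairs\<close>

definition pairs :: "'a set \<Rightarrow> 'a set \<Rightarrow> ('a \<times> 'a) set" where
  "pairs A B = (A \<times> B) \<inter> composable G"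

text \<open>The additive group generated by indicators of boxes, built one signed box at a time so
  that \<open>boxfun_triangles\<close> can treat a chain box by box.\<close>

inductive_set boxfun :: "('a \<times> 'a \<Rightarrow> int) set" where
  zero: "(\<lambda>p. 0) \<in> boxfun"
| plus: "\<lbrakk>f \<in> boxfun; bis A; bis B\<rbrakk> \<Longrightarrow> (\<lambda>p. f p + indicator (pairs A B) p) \<in> boxfun"
| minus: "\<lbrakk>f \<in> boxfun; bis A; bis B\<rbrakk> \<Longrightarrow> (\<lambda>p. f p - indicator (pairs A B) p) \<in> boxfun"

lemma boxfun_add: "g \<in> boxfun \<Longrightarrow> f \<in> boxfun \<Longrightarrow> (\<lambda>p. f p + g p) \<in> boxfun"
proof (induction rule: boxfun.induct)
  case (plus g A B)
  then show ?case using boxfun.plus [of "\<lambda>p. f p + g p" A B] by (simp add: add.assoc)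
next
  case (minus g A B)
  then show ?case using boxfun.minus [of "\<lambda>p. f p + g p" A B] by (simp add: algebra_simps)
qed simp

lemma boxfun_uminus: "f \<in> boxfun \<Longrightarrow> (\<lambda>p. - f p) \<in> boxfun"
proof (induction rule: boxfun.induct)
  case zero
  then show ?case using boxfun.zero by simp
next
  case (plus g A B)
  then show ?case using boxfun.minus [of "\<lambda>p. - g p" A B] by simp
next
  case (minus g A B)
  then show ?case using boxfun.plus [of "\<lambda>p. - g p" A B] by (simp add: algebra_simps)
qed

lemma boxfun_diff: "f \<in> boxfun \<Longrightarrow> g \<in> boxfun \<Longrightarrow> (\<lambda>p. f p - g p) \<in> boxfun"
  using boxfun_add [OF boxfun_uminus, of g f] by simp

lemma boxfun_scale:
  assumes "f \<in> boxfun" shows "(\<lambda>p. c * f p) \<in> boxfun"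
proof -
  have nat: "(\<lambda>p. int n * f p) \<in> boxfun" for n
  proof (induction n)
    case (Suc n)
    then show ?case using boxfun_add [OF assms Suc] by (simp add: algebra_simps)
  qed (simp add: boxfun.zero)
  show ?thesis
  proof (cases c)
    case (nonneg n)
    then show ?thesis using nat by simp
  next
    case (neg n)
    then show ?thesis using boxfun_uminus [OF nat [of "Suc n"]] by (simp only: mult_minus_left)
  qed
qed

lemma boxfun_box: "bis A \<Longrightarrow> bis B \<Longrightarrow> indicator (pairs A B) \<in> boxfun"
  using boxfun.plus [OF boxfun.zero, of A B] by simp

lemma box_Int: "pairs A B \<inter> pairs A' B' = pairs (A \<inter> A') (B \<inter> B')"
  by (auto simp: pairs_def)

text \<open>Boxes are closed under intersection.\<close>

lemma boxfun_times_box: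
  assumes "f \<in> boxfun" "bis A" "bis B"
  shows "(\<lambda>p. f p * indicator (pairs A B) p) \<in> boxfun"
  using assms(1)
proof (induction rule: boxfun.induct)
  case zero
  then show ?case using boxfun.zero by simp
next
  case (plus g A' B')
  then have "bis (A' \<inter> A)" "bis (B' \<inter> B)" using assms by (auto intro: bis_Int_left bis_KO)
  then show ?case
    using boxfun.plus [OF plus.IH, of "A' \<inter> A" "B' \<inter> B"]
    by (simp add: distrib_right flip: indicator_inter_arith box_Int)
next
  case (minus g A' B')
  then have "bis (A' \<inter> A)" "bis (B' \<inter> B)" using assms by (auto intro: bis_Int_left bis_KO)
  then show ?case
    using boxfun.minus [OF minus.IH, of "A' \<inter> A" "B' \<inter> B"]
    by (simp add: left_diff_distrib flip: indicator_inter_arith box_Int)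
qed

text \<open>The cover need not be made disjoint. When a box S with constant value c joins the union
  T of the earlier boxes, inclusion-exclusion writes the restriction of F to the new union as F on T
  plus c on S minus F on T restricted to S.\<close>

lemma boxfun_locally_constant_on_boxes:
  assumes "finite Q"
    and "\<And>S. S \<in> Q \<Longrightarrow> \<exists>A B c. bis A \<and> bis B \<and> S = pairs A B \<and> (\<forall>p\<in>S. F p = c)"
  shows "(\<lambda>p. F p * indicator (\<Union>Q) p) \<in> boxfun"
  using assms
proof (induction Q rule: finite_induct)
  case empty
  then show ?case using boxfun.zero by simp
next
  case (insert S Q)
  then have IH: "(\<lambda>p. F p * indicator (\<Union>Q) p) \<in> boxfun" by blast
  obtain A B c where S: "bis A" "bis B" "S = pairs A B" "\<forall>p\<in>S. F p = c"
    using insert.prems by blast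
  have "(\<lambda>p. F p * indicator (\<Union>Q) p + c * indicator S p
      - F p * indicator (\<Union>Q) p * indicator S p) \<in> boxfun"
    unfolding S(3) using S(1,2) IH
    by (intro boxfun_add boxfun_diff boxfun_scale boxfun_times_box boxfun_box)
  moreover have "(\<lambda>p. F p * indicator (\<Union>Q) p + c * indicator S p
      - F p * indicator (\<Union>Q) p * indicator S p) = (\<lambda>p. F p * indicator (\<Union>(insert S Q)) p)"
    using S(4) by (auto simp: indicator_def fun_eq_iff)
  ultimately show ?case by simp
qed

text \<open>Boxes on which F is constant are open and cover the compact support of F, since
  bisections form a basis of the topology.\<close>

lemma Cc_int_boxfun:
  assumes F: "F \<in> Cc_int (prod_topology X0 X0) (composable G)"
  shows "F \<in> boxfun"
proof -
  let ?P = "prod_topology X0 X0" and ?S = "composable G"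
  let ?T = "subtopology ?P ?S"
  let ?supp = "{p \<in> ?S. F p \<noteq> 0}"
  define \<U> where "\<U> = {S. \<exists>A B c. bis A \<and> bis B \<and> S = pairs A B \<and> (\<forall>p\<in>S. F p = c)}"
  have op: "openin ?T S" if "S \<in> \<U>" for S
  proof -
    from that obtain A B where "bis A" "bis B" "S = pairs A B" unfolding \<U>_def by blast
    moreover from this have "openin ?P (A \<times> B)"
      using bis_KO unfolding KO_def by (auto simp: openin_prod_Times_iff)
    ultimately show ?thesis
      unfolding pairs_def by (metis inf_commute openin_subtopology_Int2)
  qed
  have cov: "?supp \<subseteq> \<Union>\<U>"
  proof
    fix p assume "p \<in> ?supp"
    then obtain W where W: "openin ?T W" "p \<in> W" "\<forall>q\<in>W. F q = F p"
      using F unfolding Cc_int_def by blast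
    then obtain O' where O: "openin ?P O'" "W = O' \<inter> ?S" by (auto simp: openin_subtopology)
    obtain g h where gh: "p = (g, h)" by (cases p)
    then have "(g, h) \<in> O'" using W O by blast
    then obtain U V where UV: "openin X0 U" "openin X0 V" "g \<in> U" "h \<in> V" "U \<times> V \<subseteq> O'"
      using O(1) [unfolded openin_prod_topology_alt, rule_format, of g h] by blast
    obtain A where A: "bis A" "g \<in> A" "A \<subseteq> U" using bis_basis UV by metis
    obtain B where B: "bis B" "h \<in> B" "B \<subseteq> V" using bis_basis UV by metis
    have "pairs A B \<subseteq> W" using A B UV O by (auto simp: pairs_def)
    then have "pairs A B \<in> \<U>" unfolding \<U>_def using A B W(3) by blast
    moreover have "p \<in> pairs A B" using gh A B W O by (auto simp: pairs_def)
    ultimately show "p \<in> \<Union>\<U>" by blast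
  qed
  have "compactin ?T ?supp" using F unfolding Cc_int_def by blast
  then obtain Q where Q: "finite Q" "Q \<subseteq> \<U>" "?supp \<subseteq> \<Union>Q"
    using compactinD [of ?T ?supp \<U>] op cov by blast
  have "(\<lambda>p. F p * indicator (\<Union>Q) p) \<in> boxfun"
    by (rule boxfun_locally_constant_on_boxes) (use Q in \<open>auto simp: \<U>_def\<close>)
  moreover have "F p = 0" if "p \<notin> ?S" for p using F that unfolding Cc_int_def by blast
  then have "(\<lambda>p. F p * indicator (\<Union>Q) p) = F"
    using Q(3) by (auto simp: fun_eq_iff indicator_def)
  ultimately show ?thesis by simp
qed

section \<open>The boundary of a box\<close>

lemma box_inj:
  assumes A: "bis A" and B: "bis B"
  shows "inj_on fst (pairs A B)" "inj_on snd (pairs A B)" "inj_on (\<lambda>(g, h). g \<odot> h) (pairs A B)"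
proof -
  note A' = Gset_r_eq [OF bis_Gset [OF A]] Gset_s_eq [OF bis_Gset [OF A]]
  note B' = Gset_r_eq [OF bis_Gset [OF B]] Gset_s_eq [OF bis_Gset [OF B]]
  show "inj_on fst (pairs A B)" "inj_on snd (pairs A B)"
    unfolding inj_on_def pairs_def composable_def using A' B' by auto
  show "inj_on (\<lambda>(g, h). g \<odot> h) (pairs A B)"
  proof (rule inj_onI, clarify)
    fix a b a' b' assume 1: "(a, b) \<in> pairs A B" "(a', b') \<in> pairs A B" "a \<odot> b = a' \<odot> b'"
    then have "a \<in> A0" "b \<in> A0" "a' \<in> A0" "b' \<in> A0" "s a = r b" "s a' = r b'"
      by (auto simp: pairs_def composable_def)
    then have "r a = r a'" "s b = s b'"
      using 1(3) r_mul [of a b] r_mul [of a' b'] s_mul [of a b] s_mul [of a' b'] by simp_all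
    then show "a = a' \<and> b = b'"
      using 1 A' B' unfolding pairs_def by blast
  qed
qed

lemma box_composable: "pairs A B \<subseteq> composable G"
  by (simp add: pairs_def)

lemma box_images:
  assumes "A \<subseteq> A0" "B \<subseteq> A0" "s ` A = r ` B"
  shows "fst ` pairs A B = A" "snd ` pairs A B = B" "(\<lambda>(g, h). g \<odot> h) ` pairs A B = A \<otimes> B"
proof -
  show "fst ` pairs A B = A"
  proof
    show "A \<subseteq> fst ` pairs A B"
    proof
      fix a assume "a \<in> A"
      then obtain b where "b \<in> B" "s a = r b" using assms(3) by (metis imageE imageI)
      then have "(a, b) \<in> pairs A B" using \<open>a \<in> A\<close> assms by (auto simp: pairs_def composable_def)
      then show "a \<in> fst ` pairs A B" by force
    qed
  qed (auto simp: pairs_def)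
  show "snd ` pairs A B = B"
  proof
    show "B \<subseteq> snd ` pairs A B"
    proof
      fix b assume "b \<in> B"
      then obtain a where "a \<in> A" "s a = r b" using assms(3) by (metis imageE imageI)
      then have "(a, b) \<in> pairs A B" using \<open>b \<in> B\<close> assms by (auto simp: pairs_def composable_def)
      then show "b \<in> snd ` pairs A B" by force
    qed
  qed (auto simp: pairs_def)
  show "(\<lambda>(g, h). g \<odot> h) ` pairs A B = A \<otimes> B"
    using assms(1,2) unfolding prd_def pairs_def composable_def by (fastforce simp: image_iff)
qed

text \<open>All three face maps are injective on the box, and the condition on s(A) and r(B) makes
  their images exactly B, A B and A; each push-forward is therefore an indicator.\<close>

lemma delta2_box:
  assumes "bis A" "bis B" "s ` A = r ` B"
  shows "delta2 G (indicator (pairs A B)) g = indicator B g - indicator (A \<otimes> B) g + indicator A g"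
proof -
  have "A \<subseteq> A0" "B \<subseteq> A0" using assms bis_KO KO_arrows by blast+
  then show ?thesis
    unfolding delta2_def using assms
    by (simp add: pushf_indicator box_inj box_composable box_images)
qed

text \<open>Arrows without a composable partner contribute no pair, so both factors can be trimmed
  until their inner ends agree.\<close>

lemma box_normalise:
  assumes "bis A" "bis B"
  obtains A' B' where "bis A'" "bis B'" "s ` A' = r ` B'" "pairs A B = pairs A' B'"
proof
  let ?A = "{a \<in> A. s a \<in> r ` B}" and ?B = "{b \<in> B. r b \<in> s ` A}"
  show "bis ?A"
    by (rule bis_subset [OF assms(1)]) (auto simp: KO_preimage_s bis_KO assms)
  show "bis ?B"
    by (rule bis_subset [OF assms(2)]) (auto simp: KO_preimage_r bis_KO assms)
  show "s ` ?A = r ` ?B"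
    by (auto simp: image_iff) metis+
  show "pairs A B = pairs ?A ?B" by (force simp: pairs_def composable_def)
qed

lemma boxfun_finite_fibres:
  assumes "f \<in> boxfun"
  shows "finite {p \<in> composable G. fst p = y \<and> f p \<noteq> 0}"
    "finite {p \<in> composable G. snd p = y \<and> f p \<noteq> 0}"
    "finite {p \<in> composable G. (\<lambda>(g, h). g \<odot> h) p = y \<and> f p \<noteq> 0}"
proof -
  have *: "finite {p \<in> composable G. \<pi> p = y \<and> f p \<noteq> 0}"
    if inj: "\<And>A B. bis A \<Longrightarrow> bis B \<Longrightarrow> inj_on \<pi> (pairs A B)" for \<pi> :: "'a \<times> 'a \<Rightarrow> 'a"
    using assms
  proof (induction rule: boxfun.induct)
    case (plus f A B)
    have "{p \<in> composable G. \<pi> p = y \<and> f p + indicator (pairs A B) p \<noteq> 0}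
      \<subseteq> {p \<in> composable G. \<pi> p = y \<and> f p \<noteq> 0} \<union> {p \<in> pairs A B. \<pi> p = y}"
      by (auto simp: indicator_def split: if_splits)
    then show ?case
      using plus finite_fibre_inj [OF inj] by (meson finite_UnI finite_subset)
  next
    case (minus f A B)
    have "{p \<in> composable G. \<pi> p = y \<and> f p - indicator (pairs A B) p \<noteq> 0}
      \<subseteq> {p \<in> composable G. \<pi> p = y \<and> f p \<noteq> 0} \<union> {p \<in> pairs A B. \<pi> p = y}"
      by (auto simp: indicator_def split: if_splits)
    then show ?case
      using minus finite_fibre_inj [OF inj] by (meson finite_UnI finite_subset)
  qed simp
  show "finite {p \<in> composable G. fst p = y \<and> f p \<noteq> 0}"
    "finite {p \<in> composable G. snd p = y \<and> f p \<noteq> 0}"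
    "finite {p \<in> composable G. (\<lambda>(g, h). g \<odot> h) p = y \<and> f p \<noteq> 0}"
    by (rule *; simp add: box_inj)+
qed

lemma delta2_add:
  assumes "f \<in> boxfun" "g \<in> boxfun"
  shows "delta2 G (\<lambda>p. f p + g p) y = delta2 G f y + delta2 G g y"
  unfolding delta2_def using assms by (simp add: pushf_add boxfun_finite_fibres)

lemma delta2_diff:
  assumes "f \<in> boxfun" "g \<in> boxfun"
  shows "delta2 G (\<lambda>p. f p - g p) y = delta2 G f y - delta2 G g y"
  using delta2_add [OF assms(1) boxfun_uminus [OF assms(2)]]
  by (simp add: delta2_def pushf_uminus)

section \<open>Chains of triangles and edges\<close>

definition triangle_pair :: "'a set \<times> 'a set \<Rightarrow> bool" where
  "triangle_pair = (\<lambda>(A, B). bis A \<and> bis B \<and> s ` A = r ` B)"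

text \<open>Each summand runs once around an oriented triangle: B leads from s(B) to r(B) = s(A), A
  leads on to r(A), and the inverse of A B leads back.\<close>

definition triangle_sum :: "('a set \<times> 'a set) list \<Rightarrow> 'a \<Rightarrow> int" where
  "triangle_sum ts g =
     (\<Sum>(A, B)\<leftarrow>ts. indicator A g + indicator B g + indicator (iv ` (A \<otimes> B)) g)"

definition edge_sum :: "'a set list \<Rightarrow> 'a \<Rightarrow> int" where
  "edge_sum es g = (\<Sum>E\<leftarrow>es. indicator E g + indicator (iv ` E) g)"

lemma r_prd: "\<lbrakk>A \<subseteq> A0; B \<subseteq> A0; s ` A \<subseteq> r ` B\<rbrakk> \<Longrightarrow> r ` (A \<otimes> B) = r ` A"
proof -
  assume sub: "A \<subseteq> A0" "B \<subseteq> A0" "s ` A \<subseteq> r ` B"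
  have "r a \<in> r ` (A \<otimes> B)" if "a \<in> A" for a
  proof -
    obtain b where "b \<in> B" "s a = r b" using sub \<open>a \<in> A\<close> by (metis image_subset_iff imageE)
    then have "a \<odot> b \<in> A \<otimes> B" "r (a \<odot> b) = r a"
      using sub that by (auto intro: prdI simp: subset_iff)
    then show ?thesis by (metis imageI)
  qed
  moreover have "r x \<in> r ` A" if "x \<in> A \<otimes> B" for x
    using that sub by (auto elim!: prdE simp: subset_iff)
  ultimately show ?thesis by blast
qed

lemma s_prd: "\<lbrakk>A \<subseteq> A0; B \<subseteq> A0; r ` B \<subseteq> s ` A\<rbrakk> \<Longrightarrow> s ` (A \<otimes> B) = s ` B"
proof -
  assume sub: "A \<subseteq> A0" "B \<subseteq> A0" "r ` B \<subseteq> s ` A"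
  have "s b \<in> s ` (A \<otimes> B)" if "b \<in> B" for b
  proof -
    obtain a where "a \<in> A" "r b = s a" using sub \<open>b \<in> B\<close> by (metis image_subset_iff imageE)
    then have "a \<odot> b \<in> A \<otimes> B" "s (a \<odot> b) = s b"
      using sub that by (auto intro: prdI simp: subset_iff)
    then show ?thesis by (metis imageI)
  qed
  moreover have "s x \<in> s ` B" if "x \<in> A \<otimes> B" for x
    using that sub by (auto elim!: prdE simp: subset_iff)
  ultimately show ?thesis by blast
qed

lemma r_image_inv: "A \<subseteq> A0 \<Longrightarrow> r ` iv ` A = s ` A"
  and s_image_inv: "A \<subseteq> A0 \<Longrightarrow> s ` iv ` A = r ` A"
  by (auto simp: image_image subset_iff intro!: image_cong)

lemma bis_arrows: "bis A \<Longrightarrow> A \<subseteq> A0"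
  using bis_KO KO_arrows by blast

text \<open>Identifies the third side of the triangle on the inverse of A and A B: it is the inverse
  of B.\<close>

lemma inv_prd_cancel:
  assumes "bis A" "bis B" "s ` A = r ` B"
  shows "iv ` A \<otimes> (A \<otimes> B) = B"
proof
  note sub = bis_arrows [OF assms(1)] bis_arrows [OF assms(2)]
  show "iv ` A \<otimes> (A \<otimes> B) \<subseteq> B"
  proof
    fix x assume "x \<in> iv ` A \<otimes> (A \<otimes> B)"
    then obtain a a' b where x: "x = iv a \<odot> (a' \<odot> b)" "a \<in> A" "a' \<in> A" "b \<in> B" "s a' = r b"
      "s (iv a) = r (a' \<odot> b)" by (auto elim!: prdE)
    then have "a \<in> A0" "a' \<in> A0" "b \<in> A0" using sub by auto
    moreover from this have "a = a'" using x Gset_r_eq [OF bis_Gset [OF assms(1)]] by auto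
    ultimately show "x \<in> B" using x by simp
  qed
  show "B \<subseteq> iv ` A \<otimes> (A \<otimes> B)"
  proof
    fix b assume b: "b \<in> B"
    then obtain a where a: "a \<in> A" "s a = r b" using assms(3) by (metis imageE imageI)
    then have ab: "a \<in> A0" "b \<in> A0" using sub b by auto
    then have "iv a \<odot> (a \<odot> b) \<in> iv ` A \<otimes> (A \<otimes> B)"
      using a b by (intro prdI) auto
    then show "b \<in> iv ` A \<otimes> (A \<otimes> B)" using a ab by simp
  qed
qed

text \<open>A triangle with coefficient \<open>-1\<close> is replaced by the triangle on \<open>A\<^sup>-\<^sup>1, AB\<close>, at the cost of
  chains of the form \<open>1\<^sub>E + 1\<^bsub>E\<^sup>-\<^sup>1\<^esub>\<close>; hence only positive coefficients occur below.\<close>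

lemma boxfun_triangles:
  assumes "f \<in> boxfun"
  shows "\<exists>ts es. (\<forall>t\<in>set ts. triangle_pair t) \<and> (\<forall>E\<in>set es. bis E) \<and>
    (\<forall>g. delta2 G f g + edge_sum es g = triangle_sum ts g)"
  using assms
proof (induction rule: boxfun.induct)
  case zero
  have "delta2 G (\<lambda>p. 0) g = 0" for g by (simp add: delta2_def pushf_def)
  then show ?case
    by (intro exI [of _ "[]"]) (simp add: edge_sum_def triangle_sum_def)
next
  case (plus f A B)
  then obtain ts es where IH: "\<forall>t\<in>set ts. triangle_pair t" "\<forall>E\<in>set es. bis E"
    "\<forall>g. delta2 G f g + edge_sum es g = triangle_sum ts g" by blast
  obtain A' B' where AB: "bis A'" "bis B'" "s ` A' = r ` B'" "pairs A B = pairs A' B'"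
    using box_normalise plus.hyps by metis
  have "delta2 G (\<lambda>p. f p + indicator (pairs A B) p) g =
      delta2 G f g + (indicator B' g - indicator (A' \<otimes> B') g + indicator A' g)" for g
    using AB plus.hyps by (simp add: delta2_add boxfun_box delta2_box)
  \<comment> \<open>The edge on A B cancels the term - 1 of A B in the boundary and leaves the
    inverse of A B, the third side of the triangle.\<close>
  then show ?case
    using IH AB
    by (intro exI [of _ "(A', B') # ts"] exI [of _ "(A' \<otimes> B') # es"])
       (simp add: triangle_pair_def triangle_sum_def edge_sum_def)
next
  case (minus f A B)
  then obtain ts es where IH: "\<forall>t\<in>set ts. triangle_pair t" "\<forall>E\<in>set es. bis E"
    "\<forall>g. delta2 G f g + edge_sum es g = triangle_sum ts g" by blast
  obtain A' B' where AB: "bis A'" "bis B'" "s ` A' = r ` B'" "pairs A B = pairs A' B'"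
    using box_normalise minus.hyps by metis
  have "delta2 G (\<lambda>p. f p - indicator (pairs A B) p) g =
      delta2 G f g - (indicator B' g - indicator (A' \<otimes> B') g + indicator A' g)" for g
    using AB minus.hyps by (simp add: delta2_diff boxfun_box delta2_box)
  moreover have "triangle_pair (iv ` A', A' \<otimes> B')"
    using AB by (simp add: triangle_pair_def s_image_inv bis_arrows r_prd)
  \<comment> \<open>Adding the edges on A and B to the negated boundary leaves the indicators of A B
    and of the inverses of A and B, the three sides of the replacement triangle.\<close>
  ultimately show ?case
    using IH AB
    by (intro exI [of _ "(iv ` A', A' \<otimes> B') # ts"] exI [of _ "A' # B' # es"])
       (simp add: triangle_sum_def edge_sum_def inv_prd_cancel)
qed

end

section \<open>Matching over an elementary subgroupoid\<close>

locale elementary_pair = ample_groupoid +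
  fixes K :: "'a set"
  assumes elementary_K: "elementary_subgroupoid G K"
begin

lemma K_KO: "K \<in> KO"
  using elementary_K unfolding elementary_subgroupoid_def KO_def by blast

lemma K_arrow [simp]: "k \<in> K \<Longrightarrow> k \<in> A0"
  using KO_arrows [OF K_KO] by blast

lemma unit_K [simp]: "u \<in> U0 \<Longrightarrow> u \<in> K"
  using elementary_K unfolding elementary_subgroupoid_def by blast

lemma mul_K [simp]: "\<lbrakk>g \<in> K; h \<in> K; s g = r h\<rbrakk> \<Longrightarrow> g \<odot> h \<in> K"
  using elementary_K unfolding elementary_subgroupoid_def by blast

lemma inv_K [simp]: "g \<in> K \<Longrightarrow> iv g \<in> K"
  using elementary_K unfolding elementary_subgroupoid_def by blast

lemma inv_K_iff: "g \<in> A0 \<Longrightarrow> iv g \<in> K \<longleftrightarrow> g \<in> K"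
  using inv_K [of "iv g"] by auto

lemma K_principal: "k \<in> K \<Longrightarrow> r k = s k \<Longrightarrow> k \<in> U0"
  using elementary_K unfolding elementary_subgroupoid_def by blast

section \<open>Orbits and double cosets of \<open>K\<close>\<close>

definition orb :: "'a \<Rightarrow> 'a set" where "orb x = r ` {k \<in> K. s k = x}"

text \<open>These are the unions of double cosets K g K. Counts are stated for them because the set
  of all arrows outside \<open>K\<close> over one orbit, which consists of many double cosets in
  general, is needed too.\<close>

definition biinv :: "'a set \<Rightarrow> bool" where
  "biinv S \<longleftrightarrow> S \<subseteq> A0 \<and>
     (\<forall>g\<in>S. \<forall>k\<in>K. (s k = r g \<longrightarrow> k \<odot> g \<in> S) \<and> (s g = r k \<longrightarrow> g \<odot> k \<in> S))"

definition dcoset :: "'a \<Rightarrow> 'a set" where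
  "dcoset g = {k \<odot> g \<odot> k' |k k'. k \<in> K \<and> k' \<in> K \<and> s k = r g \<and> s g = r k'}"

lemma orb_units: "orb x \<subseteq> U0"
  by (auto simp: orb_def)

lemma orb_self: "x \<in> U0 \<Longrightarrow> x \<in> orb x"
  unfolding orb_def by (rule image_eqI [of _ _ x]) auto

lemma orbI: "k \<in> K \<Longrightarrow> s k = x \<Longrightarrow> r k = y \<Longrightarrow> y \<in> orb x"
  by (auto simp: orb_def)

lemma orb_mono: "y \<in> orb x \<Longrightarrow> orb y \<subseteq> orb x"
proof
  fix z assume "y \<in> orb x" "z \<in> orb y"
  then obtain k k' where "k \<in> K" "s k = x" "y = r k" "k' \<in> K" "s k' = y" "z = r k'"
    by (auto simp: orb_def)
  then show "z \<in> orb x" by (intro orbI [of "k' \<odot> k"]) auto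
qed

lemma orb_sym: "y \<in> orb x \<Longrightarrow> x \<in> orb y"
proof -
  assume "y \<in> orb x"
  then obtain k where "k \<in> K" "s k = x" "y = r k" by (auto simp: orb_def)
  then show ?thesis by (intro orbI [of "iv k"]) auto
qed

lemma orb_eq: "y \<in> orb x \<Longrightarrow> orb y = orb x"
  using orb_mono orb_sym by blast

lemma orb_K: "k \<in> K \<Longrightarrow> r k \<in> orb (s k)"
  by (auto simp: orb_def)

lemma orb_K_iff: "k \<in> K \<Longrightarrow> r k \<in> orb x \<longleftrightarrow> s k \<in> orb x"
  by (metis orb_K orb_eq orb_sym)

text \<open>A finite cover by bisections meets every source fibre at most once per member. The bound
  is uniform in x, which later gives one exponent for all orbits.\<close>

lemma KO_bounded_fibres:
  assumes "A \<in> KO"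
  obtains N where "\<And>x. finite {g \<in> A. s g = x} \<and> card {g \<in> A. s g = x} \<le> N"
proof -
  obtain F where F: "finite F" "\<And>B. B \<in> F \<Longrightarrow> bis B \<and> B \<subseteq> A" "\<Union>F = A"
    using KO_finite_bis_cover [OF assms] by blast
  have "finite {g \<in> A. s g = x} \<and> card {g \<in> A. s g = x} \<le> card F" for x
  proof -
    have eq: "{g \<in> A. s g = x} = (\<Union>B\<in>F. {g \<in> B. s g = x})" using F(3) by auto
    have 1: "finite {g \<in> B. s g = x} \<and> card {g \<in> B. s g = x} \<le> 1" if "B \<in> F" for B
    proof -
      have "\<exists>y. {g \<in> B. s g = x} \<subseteq> {y}"
        using Gset_s_eq [OF bis_Gset, of B] F(2) [OF that] by blast
      then obtain y where y: "{g \<in> B. s g = x} \<subseteq> {y}" ..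
      show ?thesis using finite_subset [OF y] card_mono [OF _ y] by simp
    qed
    have "card (\<Union>B\<in>F. {g \<in> B. s g = x}) \<le> (\<Sum>B\<in>F. card {g \<in> B. s g = x})"
      by (rule card_UN_le [OF F(1)])
    also have "\<dots> \<le> (\<Sum>B\<in>F. 1)" by (rule sum_mono) (use 1 in auto)
    finally show ?thesis unfolding eq using F(1) 1 by auto
  qed
  then show ?thesis using that by blast
qed

lemma finite_orb [simp]: "finite (orb x)"
  unfolding orb_def using KO_bounded_fibres [OF K_KO] by blast

lemma orb_bounded: obtains N where "\<And>x. card (orb x) \<le> N"
proof -
  obtain N where "\<And>x. finite {g \<in> K. s g = x} \<and> card {g \<in> K. s g = x} \<le> N"
    using KO_bounded_fibres [OF K_KO] by blast
  then show ?thesis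
    using that unfolding orb_def by (meson card_image_le le_trans)
qed

lemma biinv_mul_iff:
  assumes "biinv S" "g \<in> A0" "k \<in> K" "k' \<in> K" "s k = r g" "s g = r k'"
  shows "k \<odot> g \<odot> k' \<in> S \<longleftrightarrow> g \<in> S"
proof
  assume "g \<in> S"
  then have "k \<odot> g \<in> S" using assms by (auto simp: biinv_def)
  then show "k \<odot> g \<odot> k' \<in> S" using assms by (auto simp: biinv_def)
next
  assume "k \<odot> g \<odot> k' \<in> S"
  moreover have "s (k \<odot> g \<odot> k') = r (iv k')" "iv k' \<in> K" using assms by simp_all
  ultimately have "k \<odot> g \<odot> k' \<odot> iv k' \<in> S" using assms(1) unfolding biinv_def by blast
  then have "k \<odot> g \<in> S" using assms by simp
  moreover have "s (iv k) = r (k \<odot> g)" "iv k \<in> K" using assms by simp_all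
  ultimately have "iv k \<odot> (k \<odot> g) \<in> S" using assms(1) unfolding biinv_def by blast
  then show "g \<in> S" using assms by simp
qed

lemma biinv_left_iff:
  assumes "biinv S" "g \<in> A0" "k \<in> K" "s k = r g"
  shows "k \<odot> g \<in> S \<longleftrightarrow> g \<in> S"
  using biinv_mul_iff [of S g k "s g"] assms mul_unit_right [of "k \<odot> g"] by simp

lemma biinv_dcoset:
  assumes "g \<in> A0" shows "biinv (dcoset g)"
  unfolding biinv_def
proof (intro conjI ballI impI)
  show "dcoset g \<subseteq> A0" using assms by (auto simp: dcoset_def)
next
  fix h k assume h: "h \<in> dcoset g" and k: "k \<in> K" "s k = r h"
  from h obtain a b where ab: "h = a \<odot> g \<odot> b" "a \<in> K" "b \<in> K" "s a = r g" "s g = r b"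
    by (auto simp: dcoset_def)
  have "k \<odot> h = (k \<odot> a) \<odot> g \<odot> b" using ab k assms by (simp add: mul_assoc)
  moreover have "s k = r a" using ab k assms by simp
  then have "k \<odot> a \<in> K" "s (k \<odot> a) = r g" using ab k by simp_all
  ultimately show "k \<odot> h \<in> dcoset g" unfolding dcoset_def using ab by blast
next
  fix h k assume h: "h \<in> dcoset g" and k: "k \<in> K" "s h = r k"
  from h obtain a b where ab: "h = a \<odot> g \<odot> b" "a \<in> K" "b \<in> K" "s a = r g" "s g = r b"
    by (auto simp: dcoset_def)
  have bk: "s b = r k" using ab k assms by simp
  then have "h \<odot> k = a \<odot> g \<odot> (b \<odot> k)" using ab k assms by (simp add: mul_assoc)
  moreover have "b \<odot> k \<in> K" "s g = r (b \<odot> k)" using ab k bk by simp_all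
  ultimately show "h \<odot> k \<in> dcoset g" unfolding dcoset_def using ab by blast
qed

lemma dcoset_self: assumes "g \<in> A0" shows "g \<in> dcoset g"
proof -
  have "g = r g \<odot> g \<odot> s g" using assms by simp
  moreover have "r g \<in> K" "s g \<in> K" "s (r g) = r g" "s g = r (s g)" using assms by simp_all
  ultimately show ?thesis unfolding dcoset_def by blast
qed

lemma dcoset_src: assumes "g \<in> A0" shows "s ` dcoset g \<subseteq> orb (s g)"
proof clarify
  fix h assume "h \<in> dcoset g"
  then obtain k k' where "h = k \<odot> g \<odot> k'" "k \<in> K" "k' \<in> K" "s k = r g" "s g = r k'"
    by (auto simp: dcoset_def)
  then show "s h \<in> orb (s g)" using assms by (intro orbI [of "iv k'"]) auto
qed

text \<open>Orbits are finite and \<open>s\<close> is injective on A. Since a double coset lies over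
  one orbit, the cardinalities compared below are genuine and not the default value 0 of an infinite
  set.\<close>

lemma finite_bis_Int: assumes "bis A" "s ` S \<subseteq> orb x" shows "finite (A \<inter> S)"
proof (rule inj_on_finite [of s _ "orb x"])
  show "inj_on s (A \<inter> S)" using bis_Gset [OF assms(1)] by (auto simp: Gset_def inj_on_def)
qed (use assms in auto)

section \<open>Moving bisections by elements of \<open>K\<close>\<close>

lemma prd_mono: "A \<subseteq> A' \<Longrightarrow> B \<subseteq> B' \<Longrightarrow> A \<otimes> B \<subseteq> A' \<otimes> B'"
  unfolding prd_def by blast

lemma prd3_iff:
  assumes "A \<subseteq> A0" "B \<subseteq> A0"
  shows "x \<in> A \<otimes> B \<otimes> C \<longleftrightarrow>
    (\<exists>a\<in>A. \<exists>b\<in>B. \<exists>c\<in>C. x = a \<odot> b \<odot> c \<and> s a = r b \<and> s b = r c)"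
proof
  assume "x \<in> A \<otimes> B \<otimes> C"
  then obtain y c where 1: "y \<in> A \<otimes> B" "c \<in> C" "x = y \<odot> c" "s y = r c" by (auto elim: prdE)
  then obtain a b where 2: "a \<in> A" "b \<in> B" "y = a \<odot> b" "s a = r b" by (auto elim: prdE)
  then have "s b = r c" using 1 assms by (auto simp: subset_iff)
  then show "\<exists>a\<in>A. \<exists>b\<in>B. \<exists>c\<in>C. x = a \<odot> b \<odot> c \<and> s a = r b \<and> s b = r c"
    using 1 2 by blast
next
  assume "\<exists>a\<in>A. \<exists>b\<in>B. \<exists>c\<in>C. x = a \<odot> b \<odot> c \<and> s a = r b \<and> s b = r c"
  then show "x \<in> A \<otimes> B \<otimes> C" using assms by (auto intro!: prdI simp: subset_iff)
qed

text \<open>Each w has a unique partner in a and in b, and multiplying by them keeps w in its double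
  coset. The assignment is injective: the range of the result determines the partner in a, and its
  source determines w.\<close>

lemma transport_card:
  assumes a: "bis a" "a \<subseteq> K" "s ` a = r ` W" and b: "bis b" "b \<subseteq> K" "r ` b = s ` W"
    and W: "bis W" and S: "biinv S"
  shows "card ((a \<otimes> W \<otimes> b) \<inter> S) = card (W \<inter> S)"
proof -
  note Wsub = bis_arrows [OF W]
  have "\<forall>w\<in>W. \<exists>k\<in>a. s k = r w" using a(3) by (metis imageE imageI)
  then obtain \<alpha> where \<alpha>: "\<And>w. w \<in> W \<Longrightarrow> \<alpha> w \<in> a \<and> s (\<alpha> w) = r w" by metis
  have "\<forall>w\<in>W. \<exists>k\<in>b. r k = s w" using b(3) by (metis imageE imageI)
  then obtain \<beta> where \<beta>: "\<And>w. w \<in> W \<Longrightarrow> \<beta> w \<in> b \<and> r (\<beta> w) = s w" by metis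
  define f where "f w = \<alpha> w \<odot> w \<odot> \<beta> w" for w
  have arr: "w \<in> A0" "\<alpha> w \<in> K" "\<beta> w \<in> K" if "w \<in> W" for w
    using that \<alpha> \<beta> a b Wsub by blast+
  have rf: "r (f w) = r (\<alpha> w)" if "w \<in> W" for w
    unfolding f_def using arr [OF that] \<alpha> [OF that] \<beta> [OF that] by simp
  have inj: "inj_on f W"
  proof (rule inj_onI)
    fix w w' assume w: "w \<in> W" "w' \<in> W" "f w = f w'"
    then have "r (\<alpha> w) = r (\<alpha> w')" using rf by metis
    then have "\<alpha> w = \<alpha> w'" using Gset_r_eq [OF bis_Gset [OF a(1)]] \<alpha> w by blast
    then have "r w = r w'" using \<alpha> w by metis
    then show "w = w'" using Gset_r_eq [OF bis_Gset [OF W]] w by blast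
  qed
  have mem: "f w \<in> S \<longleftrightarrow> w \<in> S" if "w \<in> W" for w
    unfolding f_def using arr [OF that] \<alpha> [OF that] \<beta> [OF that] S by (intro biinv_mul_iff) auto
  have "a \<otimes> W \<otimes> b = f ` W"
  proof (rule set_eqI)
    fix x
    have asub: "a \<subseteq> A0" using a by (auto simp: bis_arrows)
    show "x \<in> a \<otimes> W \<otimes> b \<longleftrightarrow> x \<in> f ` W"
    proof
      assume "x \<in> a \<otimes> W \<otimes> b"
      then obtain k w k' where kw: "k \<in> a" "w \<in> W" "k' \<in> b" "x = k \<odot> w \<odot> k'" "s k = r w" "s w = r k'"
        unfolding prd3_iff [OF asub Wsub] by blast
      then have "k = \<alpha> w" "k' = \<beta> w"
        using Gset_s_eq [OF bis_Gset [OF a(1)]] Gset_r_eq [OF bis_Gset [OF b(1)]] \<alpha> \<beta> by metis+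
      then show "x \<in> f ` W" using kw by (auto simp: f_def)
    next
      assume "x \<in> f ` W"
      then show "x \<in> a \<otimes> W \<otimes> b"
        unfolding prd3_iff [OF asub Wsub] f_def using \<alpha> \<beta> by force
    qed
  qed
  then have "(a \<otimes> W \<otimes> b) \<inter> S = f ` (W \<inter> S)" using mem by auto
  then show ?thesis using inj by (simp add: card_image inj_on_subset)
qed

text \<open>Greedy matching: the pairs of bisections in \<open>L\<close> are processed one after the other, each time
  moving as much as possible of the unmatched part of \<open>W\<close> into the unmatched part of \<open>E\<close>.\<close>

lemma greedy_matching:
  assumes W: "bis W" and E: "bis E" and L: "finite L"
    and "\<And>k k'. (k, k') \<in> L \<Longrightarrow> bis k \<and> bis k' \<and> k \<subseteq> K \<and> k' \<subseteq> K"
  shows "\<exists>a b W'. bis a \<and> bis b \<and> a \<subseteq> K \<and> b \<subseteq> K \<and> W' \<in> KO \<and> W' \<subseteq> W \<and>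
    s ` a = r ` W' \<and> r ` b = s ` W' \<and> a \<otimes> W' \<otimes> b \<subseteq> E \<and>
    (\<forall>(k, k')\<in>L. \<forall>x\<in>k. \<forall>y\<in>k'. \<forall>w\<in>W - W'.
       s x = r w \<longrightarrow> s w = r y \<longrightarrow> x \<odot> w \<odot> y \<notin> E - a \<otimes> W' \<otimes> b)"
  using L assms(4)
proof (induction L rule: finite_induct)
  case empty
  then show ?case
    by (intro exI [of _ "{}"]) (auto simp: bis_def Gset_def prd_def)
next
  case (insert kk L)
  obtain k k' where kk: "kk = (k, k')" by (cases kk)
  have k: "bis k" "bis k'" "k \<subseteq> K" "k' \<subseteq> K" using insert.prems kk by auto
  obtain a b W' where IH: "bis a" "bis b" "a \<subseteq> K" "b \<subseteq> K" "W' \<in> KO" "W' \<subseteq> W"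
    "s ` a = r ` W'" "r ` b = s ` W'" "a \<otimes> W' \<otimes> b \<subseteq> E"
    and left: "\<And>k k' x y w. \<lbrakk>(k, k') \<in> L; x \<in> k; y \<in> k'; w \<in> W - W'; s x = r w; s w = r y\<rbrakk>
       \<Longrightarrow> x \<odot> w \<odot> y \<notin> E - a \<otimes> W' \<otimes> b"
    using insert.IH insert.prems by (fastforce simp: case_prod_beta)
  define E' where "E' = a \<otimes> W' \<otimes> b"
  have W': "bis W'" using bis_subset [OF W] IH by blast
  have E': "bis E'" unfolding E'_def using IH W' by simp
  \<comment> \<open>The arrows still unmatched that the present pair carries into the unmatched part
    of E.\<close>
  define M where "M = {w \<in> W - W'. \<exists>x\<in>k. \<exists>y\<in>k'. s x = r w \<and> s w = r y \<and> x \<odot> w \<odot> y \<in> E - E'}"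
  note arr = bis_arrows [OF W] bis_arrows [OF E] bis_arrows [OF k(1)] bis_arrows [OF k(2)]
    bis_arrows [OF IH(1)] bis_arrows [OF IH(2)] bis_arrows [OF W']
  \<comment> \<open>Rewriting M as part of a product of bisections shows that it is compact and
    open.\<close>
  have M_eq: "M = (W - W') \<inter> (iv ` k \<otimes> (E - E') \<otimes> iv ` k')"
  proof (rule set_eqI)
    fix w
    have sub: "iv ` k \<subseteq> A0" "E - E' \<subseteq> A0" using arr by auto
    show "w \<in> M \<longleftrightarrow> w \<in> (W - W') \<inter> (iv ` k \<otimes> (E - E') \<otimes> iv ` k')"
    proof
      assume "w \<in> M"
      then obtain x y where xy: "w \<in> W - W'" "x \<in> k" "y \<in> k'" "s x = r w" "s w = r y"
        "x \<odot> w \<odot> y \<in> E - E'" by (auto simp: M_def)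
      then have A: "x \<in> A0" "y \<in> A0" "w \<in> A0" using arr by auto
      then have "w = iv x \<odot> (x \<odot> w \<odot> y) \<odot> iv y" using xy by (simp add: mul_assoc)
      moreover have "s (iv x) = r (x \<odot> w \<odot> y)" "s (x \<odot> w \<odot> y) = r (iv y)"
        using xy A by simp_all
      ultimately show "w \<in> (W - W') \<inter> (iv ` k \<otimes> (E - E') \<otimes> iv ` k')"
        unfolding Int_iff prd3_iff [OF sub] using xy(1,2,3,6) by blast
    next
      assume "w \<in> (W - W') \<inter> (iv ` k \<otimes> (E - E') \<otimes> iv ` k')"
      then obtain x y e where xy: "w \<in> W - W'" "x \<in> k" "y \<in> k'" "e \<in> E - E'" "w = iv x \<odot> e \<odot> iv y"
        "s (iv x) = r e" "s e = r (iv y)" unfolding Int_iff prd3_iff [OF sub] by blast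
      then have A: "x \<in> A0" "y \<in> A0" "e \<in> A0" using arr by auto
      then have "x \<odot> w \<odot> y = e" using xy by (simp add: mul_assoc)
      moreover have "s x = r w" "s w = r y" using xy A by simp_all
      ultimately show "w \<in> M" unfolding M_def using xy by blast
    qed
  qed
  have "bis (iv ` k \<otimes> (E - E') \<otimes> iv ` k')"
    using k bis_Diff [OF E] bis_KO [OF E'] by simp
  then have M: "M \<in> KO"
    unfolding M_eq using W W' bis_KO by (intro KO_Int KO_Diff) auto
  define a' where "a' = {x \<in> k. s x \<in> r ` M}"
  define b' where "b' = {y \<in> k'. r y \<in> s ` M}"
  have bis': "bis a'" "bis b'"
    using bis_subset [OF k(1), of a'] bis_subset [OF k(2), of b'] KO_preimage_s KO_preimage_r
      bis_KO k M unfolding a'_def b'_def by auto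
  have MW: "M \<subseteq> W - W'" by (auto simp: M_def)
  note Wr = Gset_r_eq [OF bis_Gset [OF W]] and Ws = Gset_s_eq [OF bis_Gset [OF W]]
  note Er = Gset_r_eq [OF bis_Gset [OF E]] and Es = Gset_s_eq [OF bis_Gset [OF E]]
  \<comment> \<open>M only asserts that some pair of arrows works; as k and k' are bisections, the
    pair is determined by w.\<close>
  have M_prod: "x \<odot> w \<odot> y \<in> E - E'"
    if "w \<in> M" "x \<in> k" "y \<in> k'" "s x = r w" "s w = r y" for x w y
  proof -
    obtain x' y' where "x' \<in> k" "y' \<in> k'" "s x' = r w" "s w = r y'" "x' \<odot> w \<odot> y' \<in> E - E'"
      using \<open>w \<in> M\<close> by (auto simp: M_def)
    moreover from this have "x' = x" "y' = y"
      using that Gset_s_eq [OF bis_Gset [OF k(1)]] Gset_r_eq [OF bis_Gset [OF k(2)]] by metis+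
    ultimately show ?thesis by simp
  qed
  have a'M: "\<exists>w\<in>M. \<exists>y\<in>k'. s x = r w \<and> s w = r y \<and> x \<odot> w \<odot> y \<in> E - E' \<and> r (x \<odot> w \<odot> y) = r x"
    if "x \<in> a'" for x
  proof -
    from that obtain w where w: "w \<in> M" "s x = r w" "x \<in> k" by (auto simp: a'_def)
    then obtain y where y: "y \<in> k'" "s w = r y" by (auto simp: M_def)
    moreover have "x \<in> A0" "w \<in> A0" "y \<in> A0" using w y arr MW by auto
    ultimately show ?thesis using w M_prod by (intro bexI [of _ w] bexI [of _ y]) auto
  qed
  have b'M: "\<exists>w\<in>M. \<exists>x\<in>k. s x = r w \<and> s w = r y \<and> x \<odot> w \<odot> y \<in> E - E' \<and> s (x \<odot> w \<odot> y) = s y"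
    if "y \<in> b'" for y
  proof -
    from that obtain w where w: "w \<in> M" "s w = r y" "y \<in> k'" by (auto simp: b'_def)
    then obtain x where x: "x \<in> k" "s x = r w" by (auto simp: M_def)
    moreover have "x \<in> A0" "w \<in> A0" "y \<in> A0" using w x arr MW by auto
    ultimately show ?thesis using w M_prod by (intro bexI [of _ w] bexI [of _ x]) auto
  qed
  have rE': "r E0 \<in> r ` a" "s E0 \<in> s ` b" if "E0 \<in> E'" for E0
    using that unfolding E'_def prd3_iff [OF arr(5) arr(7)] using arr by (auto simp: subset_iff)
  have aE': "\<exists>e\<in>E'. r e = r x" if "x \<in> a" for x
  proof -
    from that obtain w where w: "w \<in> W'" "s x = r w" using IH(7) by (metis imageE imageI)
    then obtain y where y: "y \<in> b" "s w = r y" using IH(8) by (metis imageE imageI)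
    have A: "x \<in> A0" "w \<in> A0" "y \<in> A0" using that w y arr by auto
    have "x \<odot> w \<odot> y \<in> E'" unfolding E'_def prd3_iff [OF arr(5) arr(7)] using that w y by blast
    then show ?thesis using A w y by (intro bexI [of _ "x \<odot> w \<odot> y"]) auto
  qed
  have bE': "\<exists>e\<in>E'. s e = s y" if "y \<in> b" for y
  proof -
    from that obtain w where w: "w \<in> W'" "s w = r y" using IH(8) by (metis imageE imageI)
    then obtain x where x: "x \<in> a" "s x = r w" using IH(7) by (metis imageE imageI)
    have A: "x \<in> A0" "w \<in> A0" "y \<in> A0" using that w x arr by auto
    have "x \<odot> w \<odot> y \<in> E'" unfolding E'_def prd3_iff [OF arr(5) arr(7)] using that w x by blast
    then show ?thesis using A w x by (intro bexI [of _ "x \<odot> w \<odot> y"]) auto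
  qed
  have E'E: "E' \<subseteq> E" using IH by (simp add: E'_def)
  \<comment> \<open>A common range would belong to an arrow of E' and to one of E - E', whereas
    \<open>r\<close> is injective on E.\<close>
  have dr: "r ` a \<inter> r ` a' = {}"
  proof -
    have False if x: "x \<in> a" "x' \<in> a'" "r x = r x'" for x x'
    proof -
      obtain e where "e \<in> E'" "r e = r x" using aE' x by blast
      moreover obtain e' where "e' \<in> E - E'" "r e' = r x'" using a'M x by blast
      ultimately show False using Er [of e e'] E'E x by auto
    qed
    then show ?thesis by auto
  qed
  have ds: "s ` b \<inter> s ` b' = {}"
  proof -
    have False if x: "x \<in> b" "x' \<in> b'" "s x = s x'" for x x'
    proof -
      obtain e where "e \<in> E'" "s e = s x" using bE' x by blast
      moreover obtain e' where "e' \<in> E - E'" "s e' = s x'" using b'M x by blast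
      ultimately show False using Es [of e e'] E'E x by auto
    qed
    then show ?thesis by auto
  qed
  have "\<exists>x\<in>k. s x = r w" "\<exists>y\<in>k'. r y = s w" if "w \<in> M" for w
    using that unfolding M_def by force+
  then have sa': "s ` a' = r ` M" and rb': "r ` b' = s ` M"
    unfolding a'_def b'_def by (auto simp: image_iff) metis+
  have rMW: "r ` W' \<inter> r ` M = {}" using Wr MW IH(6) by blast
  have sMW: "s ` W' \<inter> s ` M = {}" using Ws MW IH(6) by blast
  define a2 where "a2 = a \<union> a'"
  define b2 where "b2 = b \<union> b'"
  define W2 where "W2 = W' \<union> M"
  have bis2: "bis a2" "bis b2"
    unfolding a2_def b2_def using dr ds sa' rb' IH bis' rMW sMW by (intro bis_Un; simp)+
  have sub2: "a2 \<subseteq> K" "b2 \<subseteq> K" using IH k by (auto simp: a2_def b2_def a'_def b'_def)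
  have W2: "W2 \<in> KO" "W2 \<subseteq> W" using IH M MW by (auto simp: W2_def)
  have img2: "s ` a2 = r ` W2" "r ` b2 = s ` W2"
    by (simp_all add: a2_def b2_def W2_def image_Un sa' rb' IH)
  have arr2: "a2 \<subseteq> A0" "W2 \<subseteq> A0" using sub2 W2 KO_arrows by auto
  \<comment> \<open>Old and new pieces cannot mix: the sources of a and a' lie over the disjoint
    sets r(W') and r(M), and likewise for the ranges of b and b'.\<close>
  have P2: "a2 \<otimes> W2 \<otimes> b2 \<subseteq> E"
  proof
    fix e assume "e \<in> a2 \<otimes> W2 \<otimes> b2"
    then obtain x w y where e: "x \<in> a2" "w \<in> W2" "y \<in> b2" "e = x \<odot> w \<odot> y" "s x = r w" "s w = r y"
      unfolding prd3_iff [OF arr2] by blast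
    show "e \<in> E"
    proof (cases "w \<in> M")
      case True
      then have "s x \<in> r ` M" "r y \<in> s ` M" using e by (simp_all flip: e(6))
      then have "s x \<notin> s ` a" "r y \<notin> r ` b" using rMW sMW unfolding IH(7,8) by blast+
      then have "x \<in> a'" "y \<in> b'" using e unfolding a2_def b2_def by blast+
      then show ?thesis using True e M_prod by (auto simp: a'_def b'_def)
    next
      case False
      then have w: "w \<in> W'" using e by (simp add: W2_def)
      then have "s x \<in> r ` W'" "r y \<in> s ` W'" using e by (simp_all flip: e(6))
      then have "s x \<notin> s ` a'" "r y \<notin> r ` b'" using rMW sMW unfolding sa' rb' by blast+
      then have "x \<in> a" "y \<in> b" using e unfolding a2_def b2_def by blast+
      then have "e \<in> E'" unfolding E'_def prd3_iff [OF arr(5) arr(7)] using e w by blast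
      then show ?thesis using E'E by blast
    qed
  qed
  have E'2: "E' \<subseteq> a2 \<otimes> W2 \<otimes> b2"
    unfolding E'_def a2_def W2_def b2_def by (intro prd_mono) auto
  have left2: "x \<odot> w \<odot> y \<notin> E - a2 \<otimes> W2 \<otimes> b2"
    if "(l, l') \<in> insert kk L" "x \<in> l" "y \<in> l'" "w \<in> W - W2" "s x = r w" "s w = r y" for l l' x w y
  proof (cases "(l, l') \<in> L")
    case True
    then show ?thesis using left [OF True that(2,3) _ that(5,6)] that(4) E'2
      by (auto simp: W2_def E'_def)
  next
    case False
    then have "x \<in> k" "y \<in> k'" using that kk by auto
    then show ?thesis using that E'2 by (auto simp: W2_def M_def)
  qed
  show ?case
  proof (intro exI conjI)
    show "\<forall>(l, l')\<in>insert kk L. \<forall>x\<in>l. \<forall>y\<in>l'. \<forall>w\<in>W - W2.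
       s x = r w \<longrightarrow> s w = r y \<longrightarrow> x \<odot> w \<odot> y \<notin> E - a2 \<otimes> W2 \<otimes> b2"
    proof (rule ballI)
      fix p assume p: "p \<in> insert kk L"
      show "case p of (l, l') \<Rightarrow> \<forall>x\<in>l. \<forall>y\<in>l'. \<forall>w\<in>W - W2.
         s x = r w \<longrightarrow> s w = r y \<longrightarrow> x \<odot> w \<odot> y \<notin> E - a2 \<otimes> W2 \<otimes> b2"
      proof (cases p)
        case (Pair l l')
        show ?thesis unfolding Pair prod.case
          by (intro ballI impI) (rule left2 [OF p [unfolded Pair]])
      qed
    qed
  qed (fact bis2 sub2 W2 img2 P2)+
qed

text \<open>Run the greedy procedure over all pairs from a finite cover of \<open>K\<close>. If some
  w stays unmatched, every arrow of E in its double coset is reachable from w by one of the pairs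
  and so is already taken. Then W has more arrows in this double coset than E, contrary to the
  assumption; counting replaces Hall's condition because all positions in a double coset are
  interchangeable.\<close>

lemma matching:
  assumes W: "bis W" and E: "bis E"
    and card: "\<And>w. w \<in> W \<Longrightarrow> card (W \<inter> dcoset w) \<le> card (E \<inter> dcoset w)"
  obtains a b where "bis a" "bis b" "a \<subseteq> K" "b \<subseteq> K" "s ` a = r ` W" "r ` b = s ` W"
    "a \<otimes> W \<otimes> b \<subseteq> E"
proof -
  obtain F where F: "finite F" "\<And>B. B \<in> F \<Longrightarrow> bis B \<and> B \<subseteq> K" "\<Union>F = K"
    using KO_finite_bis_cover [OF K_KO] by blast
  obtain a b W' where M: "bis a" "bis b" "a \<subseteq> K" "b \<subseteq> K" "W' \<in> KO" "W' \<subseteq> W"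
    "s ` a = r ` W'" "r ` b = s ` W'" "a \<otimes> W' \<otimes> b \<subseteq> E"
    and left: "\<forall>(k, k')\<in>F \<times> F. \<forall>x\<in>k. \<forall>y\<in>k'. \<forall>w\<in>W - W'.
       s x = r w \<longrightarrow> s w = r y \<longrightarrow> x \<odot> w \<odot> y \<notin> E - a \<otimes> W' \<otimes> b"
    using greedy_matching [OF W E, of "F \<times> F"] F by (auto simp del: Diff_iff)
  have W': "bis W'" using bis_subset W M by blast
  have "W' = W"
  proof (rule ccontr)
    assume "W' \<noteq> W"
    then obtain w where w: "w \<in> W" "w \<notin> W'" using M by blast
    then have wA: "w \<in> A0" using bis_arrows W by blast
    let ?S = "dcoset w"
    have "E \<inter> ?S \<subseteq> (a \<otimes> W' \<otimes> b) \<inter> ?S"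
    proof
      fix e assume e: "e \<in> E \<inter> ?S"
      then obtain x y where xy: "x \<in> K" "y \<in> K" "e = x \<odot> w \<odot> y" "s x = r w" "s w = r y"
        by (auto simp: dcoset_def)
      then obtain k k' where "k \<in> F" "k' \<in> F" "x \<in> k" "y \<in> k'" using F(3) by blast
      then have "e \<notin> E - a \<otimes> W' \<otimes> b" using left xy w by blast
      then show "e \<in> (a \<otimes> W' \<otimes> b) \<inter> ?S" using e by blast
    qed
    moreover have "bis (a \<otimes> W' \<otimes> b)" using M W' by simp
    ultimately have "card (E \<inter> ?S) \<le> card ((a \<otimes> W' \<otimes> b) \<inter> ?S)"
      using finite_bis_Int [OF _ dcoset_src [OF wA]] by (intro card_mono) auto
    also have "\<dots> = card (W' \<inter> ?S)"
      by (rule transport_card) (use M W' wA in \<open>auto simp: biinv_dcoset\<close>)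
    also have "\<dots> < card (W \<inter> ?S)"
      using finite_bis_Int [OF W dcoset_src [OF wA]] w M(6) dcoset_self [OF wA]
      by (intro psubset_card_mono) auto
    finally show False using card [OF w(1)] by simp
  qed
  then show ?thesis using that M by blast
qed

text \<open>Transport preserves counts, so the matched part fills each finite set of arrows of E in
  one double coset.\<close>

lemma matching_eq:
  assumes W: "bis W" and E: "bis E"
    and card: "\<And>g. g \<in> A0 \<Longrightarrow> card (W \<inter> dcoset g) = card (E \<inter> dcoset g)"
  obtains a b where "bis a" "bis b" "a \<subseteq> K" "b \<subseteq> K" "s ` a = r ` W" "r ` b = s ` W"
    "a \<otimes> W \<otimes> b = E"
proof -
  obtain a b where M: "bis a" "bis b" "a \<subseteq> K" "b \<subseteq> K" "s ` a = r ` W" "r ` b = s ` W"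
    "a \<otimes> W \<otimes> b \<subseteq> E"
    using matching [OF W E] card bis_arrows [OF W] by (metis order_refl subsetD)
  have "E \<subseteq> a \<otimes> W \<otimes> b"
  proof
    fix e assume e: "e \<in> E"
    then have eA: "e \<in> A0" using bis_arrows E by blast
    have "card ((a \<otimes> W \<otimes> b) \<inter> dcoset e) = card (E \<inter> dcoset e)"
      using transport_card [OF M(1,3,5,2,4,6) W biinv_dcoset [OF eA]] card [OF eA] by simp
    then have "(a \<otimes> W \<otimes> b) \<inter> dcoset e = E \<inter> dcoset e"
      using finite_bis_Int [OF E dcoset_src [OF eA]] M(7) by (intro card_subset_eq) auto
    then show "e \<in> a \<otimes> W \<otimes> b" using e dcoset_self [OF eA] by blast
  qed
  then show ?thesis using that M by blast
qed

end

section \<open>Bisections of prime order\<close>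

context ample_groupoid
begin

text \<open>The point map of a bisection that need not be full; its value is meaningful on s(V)
  only.\<close>

definition pt :: "'a set \<Rightarrow> 'a \<Rightarrow> 'a" where "pt V x = r (the_inv_into V s x)"

lemma pt_src: "Gset G V \<Longrightarrow> g \<in> V \<Longrightarrow> pt V (s g) = r g"
  by (simp add: pt_def Gset_def the_inv_into_f_f)

lemma tau_eq: "tau G V x = (if x \<in> U0 then pt V x else x)"
  by (simp add: tau_def pt_def)

lemma full_bisection_iff: "full_bisection G V \<longleftrightarrow> bis V \<and> s ` V = U0 \<and> r ` V = U0"
  by (auto simp: full_bisection_def bis_def KO_def)

lemma tau_src: "full_bisection G V \<Longrightarrow> g \<in> V \<Longrightarrow> tau G V (s g) = r g"
  using pt_src [of V g] by (auto simp: full_bisection_iff tau_eq bis_Gset)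

lemma full_bisection_prd:
  assumes A: "full_bisection G A" and B: "full_bisection G B"
  shows "full_bisection G (A \<otimes> B)" and "tau G (A \<otimes> B) = tau G A \<circ> tau G B"
proof -
  have sub: "A \<subseteq> A0" "B \<subseteq> A0" using A B by (auto simp: full_bisection_iff dest: bis_arrows)
  show full: "full_bisection G (A \<otimes> B)"
    using A B sub by (simp add: full_bisection_iff r_prd s_prd)
  show "tau G (A \<otimes> B) = tau G A \<circ> tau G B"
  proof
    fix x show "tau G (A \<otimes> B) x = (tau G A \<circ> tau G B) x"
    proof (cases "x \<in> U0")
      case True
      then obtain b where b: "b \<in> B" "x = s b" using B by (auto simp: full_bisection_iff)
      then have "r b \<in> s ` A" using A sub by (auto simp: full_bisection_iff)
      then obtain a where a: "a \<in> A" "s a = r b" by auto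
      have "a \<in> A0" "b \<in> A0" using a b sub by auto
      then have "tau G (A \<otimes> B) (s (a \<odot> b)) = r a"
        using tau_src [OF full prdI [OF a(1) b(1) a(2)]] a by simp
      moreover have "tau G A (s a) = r a" "tau G B x = r b"
        using tau_src [OF A a(1)] tau_src [OF B b(1)] b by auto
      ultimately show ?thesis using a b \<open>a \<in> A0\<close> \<open>b \<in> A0\<close> by simp
    next
      case False
      then show ?thesis by (simp add: tau_eq)
    qed
  qed
qed

lemma full_bisection_units: "full_bisection G U0" and tau_units: "tau G U0 = id"
proof -
  show full: "full_bisection G U0"
    by (auto simp: full_bisection_iff bis_units)
  show "tau G U0 = id"
  proof
    fix x show "tau G U0 x = id x"
      using tau_src [OF full, of x] by (cases "x \<in> U0") (simp_all add: tau_eq)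
  qed
qed

lemma tau_inj_on: assumes "full_bisection G V" shows "inj_on (tau G V) U0"
proof (rule inj_onI)
  fix x y assume "x \<in> U0" "y \<in> U0" and eq: "tau G V x = tau G V y"
  then obtain g h where "g \<in> V" "h \<in> V" "x = s g" "y = s h"
    using assms by (metis full_bisection_iff imageE)
  then show "x = y"
    using eq tau_src [OF assms] Gset_r_eq [OF bis_Gset, of V g h] assms
    by (simp add: full_bisection_iff)
qed

section \<open>Elements of prime order\<close>

lemma KO_clopen_units:
  assumes "W \<in> KO" "W \<subseteq> U0" shows "closedin (unit_top G) W" "openin (unit_top G) W"
proof -
  show "openin (unit_top G) W" using assms by (simp add: openin_unit_top KO_def)
  show "closedin (unit_top G) W"
    unfolding unit_top_def using assms KO_closed by (simp add: closedin_subset_topspace)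
qed

text \<open>If p does not divide k, some multiple of k is 1 modulo p, so a point fixed by the k-th
  power is fixed by f. Thus the powers have only two possible fixed sets, all units and the fixed
  set of f.\<close>

lemma elementary_prime_order:
  assumes p: "prime p" and id: "\<And>x. x \<in> U0 \<Longrightarrow> (f ^^ p) x = x"
    and fix_KO: "{x \<in> U0. f x = x} \<in> KO"
  shows "elementary G f"
proof -
  have mult: "(f ^^ (p * n)) x = x" if "x \<in> U0" for n x
    using id [OF that] by (induction n) (simp_all add: funpow_add)
  have fixed: "f x = x" if x: "x \<in> U0" "(f ^^ k) x = x" and k: "\<not> p dvd k" for k x
  proof -
    have kn: "(f ^^ (k * n)) x = x" for n
      using x by (induction n) (simp_all add: funpow_add)
    have "coprime k p" using p k by (metis coprime_commute prime_imp_coprime)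
    moreover have "k \<noteq> 0" using k by (metis dvd_0_right)
    ultimately obtain a b where "k * a = p * b + 1"
      using bezout_nat [of k p] by auto
    then have "(f ^^ (k * a)) x = f ((f ^^ (p * b)) x)" by simp
    then show ?thesis using kn mult x by simp
  qed
  have "{x \<in> U0. (f ^^ k) x = x} \<in> KO" for k
  proof (cases "p dvd k")
    case True
    then have "{x \<in> U0. (f ^^ k) x = x} = U0" using mult by (auto elim: dvdE)
    then show ?thesis by simp
  next
    case False
    have "(f ^^ k) x = x" if "f x = x" for x using that by (induction k) simp_all
    then have "{x \<in> U0. (f ^^ k) x = x} = {x \<in> U0. f x = x}" using fixed False by blast
    then show ?thesis using fix_KO by simp
  qed
  moreover have "finite_order_on U0 f"
    unfolding finite_order_on_def using id p prime_gt_0_nat by blast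
  ultimately show ?thesis
    unfolding elementary_def using KO_clopen_units by (metis (no_types, lifting) mem_Collect_eq subsetI)
qed

text \<open>A partial homeomorphism permuting its support, with trivial p-th power and without fixed
  points there. After extension by units the fixed set is then exactly the complement of s(V), hence
  clopen.\<close>

definition rot :: "nat \<Rightarrow> 'a set \<Rightarrow> bool" where
  "rot p V \<longleftrightarrow> bis V \<and> s ` V = r ` V \<and> (\<forall>x\<in>s ` V. (pt V ^^ p) x = x \<and> pt V x \<noteq> x)"

lemma rot_bis: "rot p V \<Longrightarrow> bis V" and rot_src: "rot p V \<Longrightarrow> s ` V = r ` V"
  by (auto simp: rot_def)

lemma rotD: "rot p V \<Longrightarrow> x \<in> s ` V \<Longrightarrow> (pt V ^^ p) x = x"
  and rot_moves: "rot p V \<Longrightarrow> x \<in> s ` V \<Longrightarrow> pt V x \<noteq> x"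
  unfolding rot_def by blast+

lemma funpow_cong_on:
  assumes "\<And>x. x \<in> S \<Longrightarrow> f x = g x" "\<And>x. x \<in> S \<Longrightarrow> f x \<in> S" "x \<in> S"
  shows "(f ^^ n) x = (g ^^ n) x"
proof -
  have "(f ^^ n) x = (g ^^ n) x \<and> (f ^^ n) x \<in> S"
    by (induction n) (use assms in auto)
  then show ?thesis ..
qed

lemma pt_in: "Gset G V \<Longrightarrow> x \<in> s ` V \<Longrightarrow> pt V x \<in> r ` V"
  using pt_src by auto

lemma pt_superset: "\<lbrakk>Gset G V; Gset G W; V \<subseteq> W; x \<in> s ` V\<rbrakk> \<Longrightarrow> pt W x = pt V x"
  by (auto simp: pt_src subset_iff)

lemma rot_Un:
  assumes V: "rot p V" and W: "rot p W" and disj: "s ` V \<inter> s ` W = {}"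
  shows "rot p (V \<union> W)"
proof -
  have b: "bis (V \<union> W)"
    using V W disj by (intro bis_Un) (auto simp: rot_def)
  have *: "(pt (V \<union> W) ^^ p) x = x \<and> pt (V \<union> W) x \<noteq> x"
    if U: "rot p U" "U \<subseteq> V \<union> W" and x: "x \<in> s ` U" for U x
  proof -
    have eq: "pt U y = pt (V \<union> W) y" if "y \<in> s ` U" for y
      using pt_superset [OF bis_Gset bis_Gset, of U "V \<union> W"] U that b by (simp add: rot_bis)
    have "pt U y \<in> s ` U" if "y \<in> s ` U" for y
      using pt_in [OF bis_Gset] that U by (simp add: rot_def)
    then have "(pt U ^^ p) x = (pt (V \<union> W) ^^ p) x"
      using eq x by (intro funpow_cong_on [of "s ` U"]) auto
    then show ?thesis using rotD [OF U(1) x] rot_moves [OF U(1) x] eq [OF x] by simp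
  qed
  then have "\<forall>x\<in>s ` (V \<union> W). (pt (V \<union> W) ^^ p) x = x \<and> pt (V \<union> W) x \<noteq> x"
    using * [OF V] * [OF W] by (auto simp: image_Un)
  moreover have "s ` (V \<union> W) = r ` (V \<union> W)"
    unfolding image_Un using rot_src [OF V] rot_src [OF W] by simp
  ultimately show ?thesis using b by (simp add: rot_def)
qed

lemma bis_src_units: "bis V \<Longrightarrow> s ` V \<subseteq> U0" and bis_rng_units: "bis V \<Longrightarrow> r ` V \<subseteq> U0"
  using bis_arrows by fastforce+

lemma rot_completion:
  assumes p: "prime p" and V: "rot p V"
  defines "W \<equiv> V \<union> (U0 - s ` V)"
  shows "full_bisection G W" and "elementary G (tau G W)"
    and "\<And>x. x \<in> U0 \<Longrightarrow> (tau G W ^^ p) x = x"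
proof -
  have bV: "bis V" using V by (rule rot_bis)
  have sV: "s ` V \<subseteq> U0" using bis_src_units [OF bV] .
  have bC: "bis (U0 - s ` V)" using bis_KO [OF bV] by (intro bis_units) auto
  have im: "s ` (U0 - s ` V) = U0 - s ` V" "r ` (U0 - s ` V) = U0 - s ` V" by force+
  have "bis W"
    unfolding W_def using bV bC im rot_src [OF V] by (intro bis_Un) auto
  then show full: "full_bisection G W"
    unfolding full_bisection_iff W_def image_Un im using rot_src [OF V] sV by auto
  have on: "tau G W x = pt V x" if "x \<in> s ` V" for x
    using that sV pt_superset [OF bis_Gset [OF bV] bis_Gset [OF \<open>bis W\<close>]]
    by (auto simp: tau_eq W_def)
  have off: "tau G W x = x" if "x \<in> U0 - s ` V" for x
    using tau_src [OF full, of x] that by (simp add: W_def)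
  have iter: "(tau G W ^^ p) x = x" if "x \<in> s ` V" for x
  proof -
    have "(tau G W ^^ p) x = (pt V ^^ p) x"
      using on pt_in [OF bis_Gset [OF bV]] rot_src [OF V] that
      by (intro funpow_cong_on [of "s ` V"]) auto
    then show ?thesis using rotD [OF V that] by simp
  qed
  show all: "(tau G W ^^ p) x = x" if "x \<in> U0" for x
  proof (cases "x \<in> s ` V")
    case False
    have "(tau G W ^^ n) x = x" for n
      using off that False by (induction n) simp_all
    then show ?thesis .
  qed (rule iter)
  have "{x \<in> U0. tau G W x = x} = U0 - s ` V"
    using on off rot_moves [OF V] by fastforce
  then show "elementary G (tau G W)"
    using bis_KO [OF bC] by (intro elementary_prime_order [OF p all]) auto
qed

end

context elementary_pair
begin

section \<open>Free room in the orbits of \<open>K\<close>\<close>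

lemma orb_clopen_card_split:
  "W \<subseteq> E \<Longrightarrow> card ((E - W) \<inter> orb x) + card (W \<inter> orb x) = card (E \<inter> orb x)"
  by (subst card_Un_disjoint [symmetric]) (auto intro!: arg_cong [of _ _ card])

text \<open>For sets of units, counting in double cosets becomes counting in orbits; this lets
  \<open>matching\<close> be applied to subsets of the unit space.\<close>

lemma dcoset_unit: assumes "w \<in> U0" shows "dcoset w \<inter> U0 = orb w"
proof
  show "dcoset w \<inter> U0 \<subseteq> orb w"
  proof
    fix u assume "u \<in> dcoset w \<inter> U0"
    then obtain k k' where k: "u = k \<odot> w \<odot> k'" "k \<in> K" "k' \<in> K" "s k = r w" "s w = r k'" "u \<in> U0"
      by (auto simp: dcoset_def)
    have "k \<in> A0" "w \<in> A0" "k' \<in> A0" "s (k \<odot> w) = r k'" using k assms by simp_all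
    then have "r (k \<odot> w \<odot> k') = r k" using k(4) by (metis mul_arrow r_mul)
    then have "u = r k" using k by (metis unit_r)
    then show "u \<in> orb w" using k assms by (intro orbI [of k]) auto
  qed
  show "orb w \<subseteq> dcoset w \<inter> U0"
  proof
    fix u assume "u \<in> orb w"
    then obtain k where k: "k \<in> K" "s k = w" "u = r k" by (auto simp: orb_def)
    then have "u = k \<odot> w \<odot> iv k" "iv k \<in> K" "s k = r w" "s w = r (iv k)" "u \<in> U0"
      using assms by simp_all
    then show "u \<in> dcoset w \<inter> U0" unfolding dcoset_def using k(1) by blast
  qed
qed

text \<open>Match W into E as sets of units; the left mover alone is then a bisection of
  \<open>K\<close> from W into E. It preserves orbit counts because the ends of an arrow of
  \<open>K\<close> lie in one orbit.\<close>

lemma slot: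
  assumes W: "W \<in> KO" "W \<subseteq> U0" and E: "E \<in> KO" "E \<subseteq> U0"
    and card: "\<And>x. x \<in> U0 \<Longrightarrow> card (W \<inter> orb x) \<le> card (E \<inter> orb x)"
  obtains a where "bis a" "a \<subseteq> K" "s ` a = W" "r ` a \<subseteq> E"
    "\<forall>x. card (r ` a \<inter> orb x) = card (W \<inter> orb x)"
proof -
  have "card (W \<inter> dcoset w) \<le> card (E \<inter> dcoset w)" if "w \<in> W" for w
  proof -
    have "W \<inter> dcoset w = W \<inter> orb w" "E \<inter> dcoset w = E \<inter> orb w"
      using dcoset_unit [of w] that W E by blast+
    then show ?thesis using card that W by auto
  qed
  then obtain a b where M: "bis a" "bis b" "a \<subseteq> K" "b \<subseteq> K" "s ` a = r ` W" "r ` b = s ` W"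
    "a \<otimes> W \<otimes> b \<subseteq> E"
    using matching bis_units W E by metis
  have rW: "r ` W = W" using W by force
  have sub: "a \<subseteq> A0" "b \<subseteq> A0" "W \<subseteq> A0" "a \<otimes> W \<subseteq> A0"
    using M W bis_arrows bis_units by auto
  have "r ` a = r ` (a \<otimes> W \<otimes> b)"
    using sub M by (simp add: r_prd s_prd)
  then have "r ` a \<subseteq> r ` E" using M(7) by auto
  then have rE: "r ` a \<subseteq> E" using E by force
  have "card (r ` a \<inter> orb x) = card (W \<inter> orb x)" for x
  proof -
    let ?a = "{k \<in> a. s k \<in> orb x}"
    have "r ` a \<inter> orb x = r ` ?a" using orb_K_iff M(3) by blast
    moreover have "W \<inter> orb x = s ` ?a" using M(5) rW by auto
    moreover have "inj_on r ?a" "inj_on s ?a"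
      using bis_Gset [OF M(1)] by (auto simp: Gset_def inj_on_def)
    ultimately show ?thesis by (simp add: card_image)
  qed
  then show ?thesis using that [of a] M rW rE by simp
qed

text \<open>Moves the two ends of D independently to the slots r(a) and r(b) without changing any
  double coset. The description by \<open>pt\<close> lets the cycles below be computed on
  points.\<close>

lemma conjugate_edge:
  assumes D: "bis D" and a: "bis a" "a \<subseteq> K" "s ` a = r ` D" and b: "bis b" "b \<subseteq> K" "s ` b = s ` D"
  defines "V \<equiv> a \<otimes> D \<otimes> iv ` b"
  shows "bis V" "s ` V = r ` b" "r ` V = r ` a"
    "\<And>S. biinv S \<Longrightarrow> card (V \<inter> S) = card (D \<inter> S)"
    "\<And>g. g \<in> V \<Longrightarrow> \<exists>d\<in>D. s g = pt b (s d) \<and> r g = pt a (r d)"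
    "\<And>d. d \<in> D \<Longrightarrow> \<exists>g\<in>V. s g = pt b (s d) \<and> r g = pt a (r d)"
proof -
  have sub: "D \<subseteq> A0" "a \<subseteq> A0" "b \<subseteq> A0" "iv ` b \<subseteq> A0" "a \<otimes> D \<subseteq> A0"
    using D a b bis_arrows by auto
  have rb: "r ` iv ` b = s ` D" "s ` iv ` b = r ` b" using sub b by (simp_all add: r_image_inv s_image_inv)
  show "bis V" using D a b by (simp add: V_def)
  show "s ` V = r ` b" "r ` V = r ` a"
    using sub a rb by (simp_all add: V_def r_prd s_prd)
  show "card (V \<inter> S) = card (D \<inter> S)" if "biinv S" for S
    unfolding V_def by (rule transport_card) (use D a b rb that in auto)
  have pt: "\<exists>g\<in>V. s g = pt b (s d) \<and> r g = pt a (r d)" if d: "d \<in> D" for d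
  proof -
    obtain x where x: "x \<in> a" "s x = r d" using a(3) d by (metis imageE imageI)
    obtain y where y: "y \<in> b" "s y = s d" using b(3) d by (metis imageE imageI)
    have A: "x \<in> A0" "d \<in> A0" "y \<in> A0" using sub x y d by auto
    have "x \<odot> d \<odot> iv y \<in> V"
      unfolding V_def prd3_iff [OF sub(2,1)] using x y d A by (metis imageI r_inv)
    moreover have "s (x \<odot> d \<odot> iv y) = r y" "r (x \<odot> d \<odot> iv y) = r x" using x y A by simp_all
    moreover have "pt a (r d) = r x" "pt b (s d) = r y"
      using pt_src [OF bis_Gset [OF a(1)] x(1)] pt_src [OF bis_Gset [OF b(1)] y(1)] x y by simp_all
    ultimately show ?thesis by metis
  qed
  then show "\<exists>g\<in>V. s g = pt b (s d) \<and> r g = pt a (r d)" if "d \<in> D" for d using that .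
  fix g assume "g \<in> V"
  then obtain x d y where g: "x \<in> a" "d \<in> D" "y \<in> b" "g = x \<odot> d \<odot> iv y" "s x = r d" "s d = r (iv y)"
    unfolding V_def prd3_iff [OF sub(2,1)] by blast
  then have A: "x \<in> A0" "d \<in> A0" "y \<in> A0" using sub by auto
  then have "s g = r y" "r g = r x" "s d = s y" using g by simp_all
  moreover have "pt a (s x) = r x" "pt b (s y) = r y"
    using pt_src [OF bis_Gset [OF a(1)] g(1)] pt_src [OF bis_Gset [OF b(1)] g(3)] .
  ultimately show "\<exists>d\<in>D. s g = pt b (s d) \<and> r g = pt a (r d)" using g by metis
qed

text \<open>\<open>w x\<close> is the room needed in the orbit of \<open>x\<close>, and \<open>c S\<close> the number of arrows contributed to \<open>S\<close>.\<close>

definition placeable :: "nat \<Rightarrow> ('a \<Rightarrow> nat) \<Rightarrow> ('a set \<Rightarrow> nat) \<Rightarrow> bool" where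
  "placeable p w c \<longleftrightarrow> (\<forall>E. E \<in> KO \<longrightarrow> E \<subseteq> U0 \<longrightarrow> (\<forall>x\<in>U0. w x \<le> card (E \<inter> orb x)) \<longrightarrow>
     (\<exists>V. rot p V \<and> s ` V \<subseteq> E \<and> (\<forall>x\<in>U0. card (s ` V \<inter> orb x) = w x) \<and>
       (\<forall>S x. biinv S \<longrightarrow> s ` S \<subseteq> orb x \<longrightarrow> card (V \<inter> S) = c S)))"

lemma placeableI:
  assumes "\<And>E. \<lbrakk>E \<in> KO; E \<subseteq> U0; \<And>x. x \<in> U0 \<Longrightarrow> w x \<le> card (E \<inter> orb x)\<rbrakk> \<Longrightarrow>
     \<exists>V. rot p V \<and> s ` V \<subseteq> E \<and> (\<forall>x\<in>U0. card (s ` V \<inter> orb x) = w x) \<and>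
       (\<forall>S x. biinv S \<longrightarrow> s ` S \<subseteq> orb x \<longrightarrow> card (V \<inter> S) = c S)"
  shows "placeable p w c"
  using assms unfolding placeable_def by simp

lemma placeableE:
  assumes "placeable p w c" "E \<in> KO" "E \<subseteq> U0" "\<And>x. x \<in> U0 \<Longrightarrow> w x \<le> card (E \<inter> orb x)"
  obtains V where "rot p V" "s ` V \<subseteq> E" "\<forall>x\<in>U0. card (s ` V \<inter> orb x) = w x"
    "\<forall>S x. biinv S \<longrightarrow> s ` S \<subseteq> orb x \<longrightarrow> card (V \<inter> S) = c S"
proof -
  have "\<exists>V. rot p V \<and> s ` V \<subseteq> E \<and> (\<forall>x\<in>U0. card (s ` V \<inter> orb x) = w x) \<and>
       (\<forall>S x. biinv S \<longrightarrow> s ` S \<subseteq> orb x \<longrightarrow> card (V \<inter> S) = c S)"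
    using assms unfolding placeable_def by simp
  then obtain V where V: "rot p V" "s ` V \<subseteq> E" "\<forall>x\<in>U0. card (s ` V \<inter> orb x) = w x"
    "\<forall>S x. biinv S \<longrightarrow> s ` S \<subseteq> orb x \<longrightarrow> card (V \<inter> S) = c S" by blast
  show ?thesis by (rule that [OF V(1,2)]) (use V(3,4) in blast)+
qed

lemma placeable_zero: "placeable p (\<lambda>x. 0) (\<lambda>S. 0)"
  by (rule placeableI, rule exI [of _ "{}"]) (simp add: rot_def bis_def Gset_def)

text \<open>Placeability concerns every compact open E with enough room, so the second piece can be
  put into what the first leaves free; disjoint supports make the counts add.\<close>

lemma placeable_add:
  assumes 1: "placeable p w c" and 2: "placeable p w' c'"
  shows "placeable p (\<lambda>x. w x + w' x) (\<lambda>S. c S + c' S)"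
proof (rule placeableI)
  fix E assume E: "E \<in> KO" "E \<subseteq> U0" "\<And>x. x \<in> U0 \<Longrightarrow> w x + w' x \<le> card (E \<inter> orb x)"
  have le1: "w x \<le> card (E \<inter> orb x)" if "x \<in> U0" for x using E(3) [OF that] by simp
  obtain V where V: "rot p V" "s ` V \<subseteq> E" "\<forall>x\<in>U0. card (s ` V \<inter> orb x) = w x"
    "\<forall>S x. biinv S \<longrightarrow> s ` S \<subseteq> orb x \<longrightarrow> card (V \<inter> S) = c S"
    by (rule placeableE [OF 1 E(1,2) le1])
  let ?E = "E - s ` V"
  have E': "?E \<in> KO" "?E \<subseteq> U0" using E V bis_KO [OF rot_bis [OF V(1)]] by auto
  have le: "w' x \<le> card (?E \<inter> orb x)" if x: "x \<in> U0" for x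
    using E(3) [OF x] V(3) [rule_format, OF x] orb_clopen_card_split [OF V(2), of x] by linarith
  obtain V' where V': "rot p V'" "s ` V' \<subseteq> ?E" "\<forall>x\<in>U0. card (s ` V' \<inter> orb x) = w' x"
    "\<forall>S x. biinv S \<longrightarrow> s ` S \<subseteq> orb x \<longrightarrow> card (V' \<inter> S) = c' S"
    by (rule placeableE [OF 2 E' le])
  have disj: "s ` V \<inter> s ` V' = {}" using V'(2) by auto
  show "\<exists>V. rot p V \<and> s ` V \<subseteq> E \<and> (\<forall>x\<in>U0. card (s ` V \<inter> orb x) = w x + w' x) \<and>
       (\<forall>S x. biinv S \<longrightarrow> s ` S \<subseteq> orb x \<longrightarrow> card (V \<inter> S) = c S + c' S)"
  proof (intro exI [of _ "V \<union> V'"] conjI ballI allI impI)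
    show "rot p (V \<union> V')" using rot_Un V(1) V'(1) disj by blast
    show "s ` (V \<union> V') \<subseteq> E" using V(2) V'(2) by auto
    show "card (s ` (V \<union> V') \<inter> orb x) = w x + w' x" if "x \<in> U0" for x
    proof -
      have "card (s ` (V \<union> V') \<inter> orb x) = card (s ` V \<inter> orb x) + card (s ` V' \<inter> orb x)"
        unfolding image_Un Int_Un_distrib2 using disj by (intro card_Un_disjoint) auto
      then show ?thesis using V(3) V'(3) that by simp
    qed
    show "card ((V \<union> V') \<inter> S) = c S + c' S" if S: "biinv S" "s ` S \<subseteq> orb x" for S x
    proof -
      have "finite (V \<inter> S)" "finite (V' \<inter> S)"
        using finite_bis_Int [OF rot_bis S(2)] V(1) V'(1) by blast+
      moreover have "(V \<inter> S) \<inter> (V' \<inter> S) = {}" using disj by auto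
      ultimately have "card ((V \<union> V') \<inter> S) = card (V \<inter> S) + card (V' \<inter> S)"
        by (simp add: Int_Un_distrib2 card_Un_disjoint)
      then show ?thesis using V(4) [rule_format, OF S] V'(4) [rule_format, OF S] by simp
    qed
  qed
qed

lemma placeable_sum_list:
  assumes "\<And>t. t \<in> set ts \<Longrightarrow> placeable p (w t) (c t)"
  shows "placeable p (\<lambda>x. \<Sum>t\<leftarrow>ts. w t x) (\<lambda>S. \<Sum>t\<leftarrow>ts. c t S)"
  using assms
proof (induction ts)
  case Nil
  then show ?case using placeable_zero by simp
next
  case (Cons t ts)
  then show ?case using placeable_add [of p "w t" "c t"] by simp
qed

section \<open>Realising edges and triangles as cycles\<close>

lemma disjoint_src: "s ` P \<inter> s ` Q = {} \<Longrightarrow> P \<inter> Q = {}"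
  by auto

text \<open>Reserve disjoint slots for s(D) and r(D), even though these sets may overlap. The moved
  copy of D leads from the first slot to the second and the copy of its inverse leads back, which
  swaps the points \<open>?p d\<close> and \<open>?q d\<close>.\<close>

lemma placeable_edge:
  assumes D: "bis D"
  shows "placeable 2 (\<lambda>x. card (s ` D \<inter> orb x) + card (r ` D \<inter> orb x))
    (\<lambda>S. card (D \<inter> S) + card (iv ` D \<inter> S))"
proof (rule placeableI)
  fix E assume E: "E \<in> KO" "E \<subseteq> U0"
    and le: "\<And>x. x \<in> U0 \<Longrightarrow> card (s ` D \<inter> orb x) + card (r ` D \<inter> orb x) \<le> card (E \<inter> orb x)"
  have KO: "s ` D \<in> KO" "s ` D \<subseteq> U0" "r ` D \<in> KO" "r ` D \<subseteq> U0"
    using D bis_KO bis_src_units bis_rng_units by auto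
  have le1: "card (s ` D \<inter> orb x) \<le> card (E \<inter> orb x)" if "x \<in> U0" for x
    using le [OF that] by simp
  obtain a where a0: "bis a" "a \<subseteq> K" "s ` a = s ` D" "r ` a \<subseteq> E"
    "\<forall>x. card (r ` a \<inter> orb x) = card (s ` D \<inter> orb x)"
    by (rule slot [OF KO(1,2) E le1])
  note a = a0(1-4) a0(5) [rule_format]
  have E': "E - r ` a \<in> KO" "E - r ` a \<subseteq> U0" using E a bis_KO by auto
  have le': "card (r ` D \<inter> orb x) \<le> card ((E - r ` a) \<inter> orb x)" if "x \<in> U0" for x
    using le [OF that] orb_clopen_card_split [OF a(4), of x] a(5) [of x] by linarith
  obtain b where b0: "bis b" "b \<subseteq> K" "s ` b = r ` D" "r ` b \<subseteq> E - r ` a"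
    "\<forall>x. card (r ` b \<inter> orb x) = card (r ` D \<inter> orb x)"
    by (rule slot [OF KO(3,4) E' le'])
  note b = b0(1-4) b0(5) [rule_format]
  have D': "bis (iv ` D)" "s ` iv ` D = r ` D" "r ` iv ` D = s ` D"
    using D bis_arrows by (auto simp: s_image_inv r_image_inv)
  define V where "V = b \<otimes> D \<otimes> iv ` a"
  define V' where "V' = a \<otimes> iv ` D \<otimes> iv ` b"
  have "s ` a = r ` iv ` D" "s ` b = s ` iv ` D" using a b D' by auto
  note e = conjugate_edge [OF D b(1-3) a(1-3), folded V_def]
    and e' = conjugate_edge [OF D'(1) a(1,2) this(1) b(1,2) this(2), folded V'_def]
  have disj: "r ` a \<inter> r ` b = {}" using b by auto
  have bU: "bis (V \<union> V')" using e(1-3) e'(1-3) disj by (intro bis_Un) auto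
  have img: "s ` (V \<union> V') = r ` a \<union> r ` b" "r ` (V \<union> V') = r ` a \<union> r ` b"
    unfolding image_Un e(2,3) e'(2,3) by auto
  let ?p = "\<lambda>d. pt a (s d)" and ?q = "\<lambda>d. pt b (r d)"
  let ?t = "pt (V \<union> V')"
  have iv: "r (iv d) = s d" "s (iv d) = r d" if "d \<in> D" for d
    using that bis_arrows [OF D] by auto
  have step1: "?t (?p d) = ?q d" if d: "d \<in> D" for d
    using e(6) [OF d] pt_src [OF bis_Gset [OF bU]] by (metis UnI1)
  have step2: "?t (?q d) = ?p d" if d: "d \<in> D" for d
    using e'(6) [of "iv d"] iv [OF d] d pt_src [OF bis_Gset [OF bU]] by (metis UnI2 imageI)
  have pq: "?p d \<in> r ` a" "?q d \<in> r ` b" if "d \<in> D" for d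
    using pt_in [OF bis_Gset [OF a(1)]] pt_in [OF bis_Gset [OF b(1)]] a(3) b(3) that by auto
  have cov: "\<exists>d\<in>D. x = ?p d \<or> x = ?q d" if "x \<in> s ` (V \<union> V')" for x
  proof -
    from that obtain g where "g \<in> V \<union> V'" "x = s g" by blast
    then show ?thesis using e(5) [of g] e'(5) [of g] iv by auto
  qed
  have ne: "?p d \<noteq> ?q d" if "d \<in> D" for d using pq [OF that] disj by (metis disjoint_iff)
  have "(?t ^^ 2) x = x \<and> ?t x \<noteq> x" if x: "x \<in> s ` (V \<union> V')" for x
  proof -
    obtain d where d: "d \<in> D" "x = ?p d \<or> x = ?q d" using cov [OF x] by blast
    then show ?thesis
      using step1 [OF d(1)] step2 [OF d(1)] ne [OF d(1)] by (auto simp: numeral_2_eq_2)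
  qed
  then have rot: "rot 2 (V \<union> V')" using bU img by (simp add: rot_def)
  show "\<exists>V. rot 2 V \<and> s ` V \<subseteq> E \<and>
      (\<forall>x\<in>U0. card (s ` V \<inter> orb x) = card (s ` D \<inter> orb x) + card (r ` D \<inter> orb x)) \<and>
      (\<forall>S x. biinv S \<longrightarrow> s ` S \<subseteq> orb x \<longrightarrow> card (V \<inter> S) = card (D \<inter> S) + card (iv ` D \<inter> S))"
  proof (intro exI [of _ "V \<union> V'"] conjI ballI allI impI)
    show "rot 2 (V \<union> V')" by (rule rot)
    show "s ` (V \<union> V') \<subseteq> E" using img a b by auto
    show "card (s ` (V \<union> V') \<inter> orb x) = card (s ` D \<inter> orb x) + card (r ` D \<inter> orb x)" for x
    proof -
      have "card (s ` (V \<union> V') \<inter> orb x) = card (r ` a \<inter> orb x) + card (r ` b \<inter> orb x)"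
        unfolding img Int_Un_distrib2 using disj by (intro card_Un_disjoint) auto
      then show ?thesis using a(5) b(5) by simp
    qed
    show "card ((V \<union> V') \<inter> S) = card (D \<inter> S) + card (iv ` D \<inter> S)"
      if S: "biinv S" "s ` S \<subseteq> orb x" for S x
    proof -
      have "V \<inter> V' = {}" by (rule disjoint_src) (use disj e(2) e'(2) in auto)
      then have "(V \<inter> S) \<inter> (V' \<inter> S) = {}" by auto
      then have "card ((V \<union> V') \<inter> S) = card (V \<inter> S) + card (V' \<inter> S)"
        using finite_bis_Int [OF e(1) S(2)] finite_bis_Int [OF e'(1) S(2)]
        by (simp add: Int_Un_distrib2 card_Un_disjoint)
      then show ?thesis using e(4) [OF S(1)] e'(4) [OF S(1)] by simp
    qed
  qed
qed

text \<open>Three disjoint slots for the vertices s(B), s(A) = r(B) and r(A) turn the three sides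
  into a cyclic permutation of the slots. It has order 3 because the third side is the inverse of
  the product of the other two.\<close>

lemma placeable_triangle:
  assumes AB: "bis A" "bis B" "s ` A = r ` B"
  shows "placeable 3
    (\<lambda>x. card (s ` B \<inter> orb x) + card (s ` A \<inter> orb x) + card (r ` A \<inter> orb x))
    (\<lambda>S. card (A \<inter> S) + card (B \<inter> S) + card (iv ` (A \<otimes> B) \<inter> S))"
proof (rule placeableI)
  fix E assume E: "E \<in> KO" "E \<subseteq> U0"
    and le: "\<And>x. x \<in> U0 \<Longrightarrow> card (s ` B \<inter> orb x) + card (s ` A \<inter> orb x) + card (r ` A \<inter> orb x)
        \<le> card (E \<inter> orb x)"
  have KO: "s ` B \<in> KO" "s ` B \<subseteq> U0" "s ` A \<in> KO" "s ` A \<subseteq> U0" "r ` A \<in> KO" "r ` A \<subseteq> U0"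
    using AB bis_KO bis_src_units bis_rng_units by auto
  have le1: "card (s ` B \<inter> orb x) \<le> card (E \<inter> orb x)" if "x \<in> U0" for x
    using le [OF that] by simp
  obtain a where a0: "bis a" "a \<subseteq> K" "s ` a = s ` B" "r ` a \<subseteq> E"
    "\<forall>x. card (r ` a \<inter> orb x) = card (s ` B \<inter> orb x)"
    by (rule slot [OF KO(1,2) E le1])
  note a = a0(1-4) a0(5) [rule_format]
  have E': "E - r ` a \<in> KO" "E - r ` a \<subseteq> U0" using E a bis_KO by auto
  have le': "card (s ` A \<inter> orb x) + card (r ` A \<inter> orb x) \<le> card ((E - r ` a) \<inter> orb x)"
    if "x \<in> U0" for x
    using le [OF that] orb_clopen_card_split [OF a(4), of x] a(5) [of x] by linarith
  have le1': "card (s ` A \<inter> orb x) \<le> card ((E - r ` a) \<inter> orb x)" if "x \<in> U0" for x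
    using le' [OF that] by simp
  obtain b where b0: "bis b" "b \<subseteq> K" "s ` b = s ` A" "r ` b \<subseteq> E - r ` a"
    "\<forall>x. card (r ` b \<inter> orb x) = card (s ` A \<inter> orb x)"
    by (rule slot [OF KO(3,4) E' le1'])
  note b = b0(1-4) b0(5) [rule_format]
  have E'': "E - r ` a - r ` b \<in> KO" "E - r ` a - r ` b \<subseteq> U0" using E' b bis_KO by auto
  have le'': "card (r ` A \<inter> orb x) \<le> card ((E - r ` a - r ` b) \<inter> orb x)" if "x \<in> U0" for x
    using le' [OF that] orb_clopen_card_split [OF b(4), of x] b(5) [of x] by linarith
  obtain c where c0: "bis c" "c \<subseteq> K" "s ` c = r ` A" "r ` c \<subseteq> E - r ` a - r ` b"
    "\<forall>x. card (r ` c \<inter> orb x) = card (r ` A \<inter> orb x)"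
    by (rule slot [OF KO(5,6) E'' le''])
  note c = c0(1-4) c0(5) [rule_format]
  have sub: "A \<subseteq> A0" "B \<subseteq> A0" "A \<otimes> B \<subseteq> A0" using AB bis_arrows by auto
  have AB': "bis (iv ` (A \<otimes> B))" "s ` iv ` (A \<otimes> B) = r ` A" "r ` iv ` (A \<otimes> B) = s ` B"
    using AB sub by (simp_all add: s_image_inv r_image_inv r_prd s_prd)
  \<comment> \<open>\<open>V1\<close>, \<open>V2\<close> and \<open>V3\<close> lead from slot r(a)
    to r(b), from r(b) to r(c) and from r(c) back to r(a).\<close>
  define V1 where "V1 = b \<otimes> B \<otimes> iv ` a"
  define V2 where "V2 = c \<otimes> A \<otimes> iv ` b"
  define V3 where "V3 = a \<otimes> iv ` (A \<otimes> B) \<otimes> iv ` c"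
  have "s ` b = r ` B" "s ` a = r ` iv ` (A \<otimes> B)" "s ` c = s ` iv ` (A \<otimes> B)"
    using a b c AB AB' by auto
  note e1 = conjugate_edge [OF AB(2) b(1,2) this(1) a(1-3), folded V1_def]
    and e2 = conjugate_edge [OF AB(1) c(1-3) b(1-3), folded V2_def]
    and e3 = conjugate_edge [OF AB'(1) a(1,2) this(2) c(1,2) this(3), folded V3_def]
  have disj: "r ` a \<inter> r ` b = {}" "r ` a \<inter> r ` c = {}" "r ` b \<inter> r ` c = {}" using b c by auto
  let ?V = "V1 \<union> V2 \<union> V3"
  have b12: "bis (V1 \<union> V2)" using e1(1-3) e2(1-3) disj by (intro bis_Un) auto
  have bU: "bis ?V"
    by (rule bis_Un [OF b12 e3(1)]) (use e1(2,3) e2(2,3) e3(2,3) disj in \<open>auto simp: image_Un\<close>)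
  have img: "s ` ?V = r ` a \<union> r ` b \<union> r ` c" "r ` ?V = r ` a \<union> r ` b \<union> r ` c"
    unfolding image_Un e1(2,3) e2(2,3) e3(2,3) by auto
  \<comment> \<open>Each 3-cycle is indexed by an arrow y of B; its partner
    \<open>\<alpha> y\<close> is the only arrow of A composable with it.\<close>
  have "\<forall>y\<in>B. \<exists>x\<in>A. s x = r y" using AB(3) by (metis imageE imageI)
  then obtain \<alpha> where \<alpha>: "\<And>y. y \<in> B \<Longrightarrow> \<alpha> y \<in> A \<and> s (\<alpha> y) = r y" by metis
  let ?p = "\<lambda>y. pt a (s y)" and ?q = "\<lambda>y. pt b (r y)" and ?u = "\<lambda>y. pt c (r (\<alpha> y))"
  let ?t = "pt ?V"
  have step1: "?t (?p y) = ?q y" if y: "y \<in> B" for y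
    using e1(6) [OF y] pt_src [OF bis_Gset [OF bU]] by (metis UnI1)
  have step2: "?t (?q y) = ?u y" if y: "y \<in> B" for y
    using e2(6) [of "\<alpha> y"] \<alpha> [OF y] pt_src [OF bis_Gset [OF bU]] by (metis UnI1 UnI2)
  have iv: "iv (\<alpha> y \<odot> y) \<in> iv ` (A \<otimes> B)" "s (iv (\<alpha> y \<odot> y)) = r (\<alpha> y)" "r (iv (\<alpha> y \<odot> y)) = s y"
    if y: "y \<in> B" for y
  proof -
    have "\<alpha> y \<in> A0" "y \<in> A0" using \<alpha> [OF y] y sub by auto
    then show "iv (\<alpha> y \<odot> y) \<in> iv ` (A \<otimes> B)" "s (iv (\<alpha> y \<odot> y)) = r (\<alpha> y)" "r (iv (\<alpha> y \<odot> y)) = s y"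
      using \<alpha> [OF y] y by (auto intro!: imageI prdI)
  qed
  have step3: "?t (?u y) = ?p y" if y: "y \<in> B" for y
    using e3(6) [OF iv(1) [OF y]] iv(2,3) [OF y] pt_src [OF bis_Gset [OF bU]] by (metis UnI2)
  have pq: "?p y \<in> r ` a" "?q y \<in> r ` b" "?u y \<in> r ` c" if "y \<in> B" for y
    using pt_in [OF bis_Gset [OF a(1)]] pt_in [OF bis_Gset [OF b(1)]] pt_in [OF bis_Gset [OF c(1)]]
      a(3) b(3) c(3) AB(3) \<alpha> [OF that] that by auto
  have A\<alpha>: "\<exists>y\<in>B. x = \<alpha> y" if "x \<in> A" for x
  proof -
    from that obtain y where y: "y \<in> B" "s x = r y" using AB(3) by (metis imageE imageI)
    then have "x = \<alpha> y" using \<alpha> [OF y(1)] Gset_s_eq [OF bis_Gset [OF AB(1)] that] by simp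
    then show ?thesis using y by blast
  qed
  have cov: "\<exists>y\<in>B. x = ?p y \<or> x = ?q y \<or> x = ?u y" if x: "x \<in> s ` ?V" for x
  proof -
    consider (1) g where "g \<in> V1" "x = s g" | (2) g where "g \<in> V2" "x = s g"
      | (3) g where "g \<in> V3" "x = s g" using x by blast
    then show ?thesis
    proof cases
      case 1
      then show ?thesis using e1(5) by blast
    next
      case 2
      then obtain d where d: "d \<in> A" "x = pt b (s d)" using e2(5) by blast
      then obtain y where "y \<in> B" "d = \<alpha> y" using A\<alpha> by blast
      then show ?thesis using d \<alpha> by auto
    next
      case 3
      then obtain d where d: "d \<in> iv ` (A \<otimes> B)" "x = pt c (s d)" using e3(5) by blast
      then have "s d \<in> r ` A" using AB'(2) by (metis imageI)
      then obtain y where "y \<in> B" "s d = r (\<alpha> y)" using A\<alpha> by blast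
      then show ?thesis using d by auto
    qed
  qed
  have "(?t ^^ 3) x = x \<and> ?t x \<noteq> x" if x: "x \<in> s ` ?V" for x
  proof -
    obtain y where y: "y \<in> B" "x = ?p y \<or> x = ?q y \<or> x = ?u y" using cov [OF x] by blast
    have "?p y \<noteq> ?q y" "?q y \<noteq> ?u y" "?u y \<noteq> ?p y"
      using pq [OF y(1)] disj by (metis disjoint_iff)+
    then show ?thesis
      using y(2) step1 [OF y(1)] step2 [OF y(1)] step3 [OF y(1)] by (auto simp: numeral_3_eq_3)
  qed
  then have rot: "rot 3 ?V" using bU img by (simp add: rot_def)
  show "\<exists>V. rot 3 V \<and> s ` V \<subseteq> E \<and>
      (\<forall>x\<in>U0. card (s ` V \<inter> orb x) =
        card (s ` B \<inter> orb x) + card (s ` A \<inter> orb x) + card (r ` A \<inter> orb x)) \<and>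
      (\<forall>S x. biinv S \<longrightarrow> s ` S \<subseteq> orb x \<longrightarrow>
        card (V \<inter> S) = card (A \<inter> S) + card (B \<inter> S) + card (iv ` (A \<otimes> B) \<inter> S))"
  proof (intro exI [of _ ?V] conjI ballI allI impI)
    show "rot 3 ?V" by (rule rot)
    show "s ` ?V \<subseteq> E" unfolding img using a(4) b(4) c(4) by auto
    show "card (s ` ?V \<inter> orb x) =
        card (s ` B \<inter> orb x) + card (s ` A \<inter> orb x) + card (r ` A \<inter> orb x)" for x
    proof -
      have "card (s ` ?V \<inter> orb x) = card ((r ` a \<union> r ` b) \<inter> orb x) + card (r ` c \<inter> orb x)"
        unfolding img Int_Un_distrib2 using disj
        by (subst card_Un_disjoint [symmetric]) (auto simp: Int_Un_distrib2)
      moreover have "card ((r ` a \<union> r ` b) \<inter> orb x) = card (r ` a \<inter> orb x) + card (r ` b \<inter> orb x)"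
        unfolding Int_Un_distrib2 using disj by (intro card_Un_disjoint) auto
      ultimately show ?thesis using a(5) b(5) c(5) by simp
    qed
    show "card (?V \<inter> S) = card (A \<inter> S) + card (B \<inter> S) + card (iv ` (A \<otimes> B) \<inter> S)"
      if S: "biinv S" "s ` S \<subseteq> orb x" for S x
    proof -
      have "V1 \<inter> V2 = {}" "V1 \<inter> V3 = {}" "V2 \<inter> V3 = {}"
        by (rule disjoint_src; use disj e1(2) e2(2) e3(2) in auto)+
      then have d: "(V1 \<inter> S) \<inter> (V2 \<inter> S) = {}" "((V1 \<union> V2) \<inter> S) \<inter> (V3 \<inter> S) = {}" by auto
      have f: "finite (V1 \<inter> S)" "finite (V2 \<inter> S)" "finite ((V1 \<union> V2) \<inter> S)" "finite (V3 \<inter> S)"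
        using finite_bis_Int [OF _ S(2)] e1(1) e2(1) e3(1) b12 by blast+
      have "card (?V \<inter> S) = card ((V1 \<union> V2) \<inter> S) + card (V3 \<inter> S)"
        using card_Un_disjoint [OF f(3,4) d(2)] by (simp add: Int_Un_distrib2)
      moreover have "card ((V1 \<union> V2) \<inter> S) = card (V1 \<inter> S) + card (V2 \<inter> S)"
        using card_Un_disjoint [OF f(1,2) d(1)] by (simp add: Int_Un_distrib2)
      ultimately show ?thesis using e1(4) [OF S(1)] e2(4) [OF S(1)] e3(4) [OF S(1)] by simp
    qed
  qed
qed

end

section \<open>The factorisation\<close>

text \<open>The factor of order 3 is itself elementary, while the theorem speaks of the square of
  the second factor.\<close>

lemma elementary_square: assumes "elementary G f" shows "elementary G (f \<circ> f)"
proof -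
  have pow: "(f \<circ> f) ^^ k = f ^^ (2 * k)" for k
    by (induction k) (simp_all add: fun_eq_iff)
  obtain n where n: "n > 0" "\<forall>x\<in>units G. (f ^^ n) x = x"
    using assms unfolding elementary_def finite_order_on_def by blast
  then have "\<forall>x\<in>units G. ((f \<circ> f) ^^ n) x = x" by (simp add: pow mult_2 funpow_add)
  then have "finite_order_on (units G) (f \<circ> f)"
    unfolding finite_order_on_def using n(1) by blast
  then show ?thesis using assms unfolding elementary_def pow by blast
qed

lemma sum_sum_list_swap:
  "(\<Sum>g\<in>Q. \<Sum>t\<leftarrow>ts. f t g) = (\<Sum>t\<leftarrow>ts. \<Sum>g\<in>Q. f t g :: 'b :: comm_monoid_add)"
  by (induction ts) (simp_all add: sum.distrib)

context elementary_pair
begin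

section \<open>The full group of \<open>K\<close>\<close>

lemma K_cancel_right:
  assumes "g \<in> A0" "k \<in> K" "s g = r k" "g \<odot> k \<in> K" shows "g \<in> K"
proof -
  have "g \<odot> k \<odot> iv k \<in> K" by (rule mul_K) (use assms in simp_all)
  then show ?thesis unfolding mul_inv_cancel_right [OF assms(1) K_arrow [OF assms(2)] assms(3)] .
qed

lemma K_cancel_left:
  assumes "g \<in> A0" "k \<in> K" "s k = r g" "k \<odot> g \<in> K" shows "g \<in> K"
proof -
  have "iv k \<odot> (k \<odot> g) \<in> K" by (rule mul_K) (use assms in simp_all)
  then show ?thesis unfolding inv_mul_cancel [OF K_arrow [OF assms(2)] assms(1,3)] .
qed

lemma full_bisection_K_power:
  assumes "full_bisection G V" "V \<subseteq> K"
  shows "\<exists>W. full_bisection G W \<and> W \<subseteq> K \<and> tau G W = tau G V ^^ n"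
proof (induction n)
  case 0
  then show ?case using full_bisection_units tau_units unit_K by (auto simp: id_def)
next
  case (Suc n)
  then obtain W where W: "full_bisection G W" "W \<subseteq> K" "tau G W = tau G V ^^ n" by blast
  have "V \<otimes> W \<subseteq> K" using assms(2) W(2) by (auto elim!: prdE simp: subset_iff)
  then show ?case
    using full_bisection_prd [OF assms(1) W(1)] W(3) by (intro exI [of _ "V \<otimes> W"]) simp
qed

text \<open>Every power is again given by a full bisection W inside \<open>K\<close>. As
  \<open>K\<close> is principal, the points fixed by it are just the units in W, a compact open set.
  Finite order comes from the uniform bound on orbits.\<close>

lemma elementary_tau_K:
  assumes V: "full_bisection G V" and VK: "V \<subseteq> K"
  shows "elementary G (tau G V)"
proof -
  let ?f = "tau G V"
  have fix_KO: "{x \<in> U0. (?f ^^ k) x = x} \<in> KO" for k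
  proof -
    obtain W where W: "full_bisection G W" "W \<subseteq> K" "tau G W = ?f ^^ k"
      using full_bisection_K_power [OF assms] by blast
    have "{x \<in> U0. tau G W x = x} = W \<inter> U0"
    proof (intro set_eqI iffI)
      fix x assume "x \<in> {x \<in> U0. tau G W x = x}"
      then have x: "x \<in> U0" "tau G W x = x" by auto
      then obtain g where g: "g \<in> W" "x = s g" using W(1) by (auto simp: full_bisection_iff)
      then have "r g = s g" using x tau_src [OF W(1)] by simp
      then have "g \<in> U0" using K_principal g W(2) by blast
      then show "x \<in> W \<inter> U0" using g by simp
    next
      fix x assume "x \<in> W \<inter> U0"
      then show "x \<in> {x \<in> U0. tau G W x = x}" using tau_src [OF W(1), of x] by simp
    qed
    then show ?thesis using W by (simp add: full_bisection_iff bis_KO)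
  qed
  obtain N where N: "\<And>x. card (orb x) \<le> N" using orb_bounded by blast
  have in_orb: "(?f ^^ k) x \<in> orb x" if x: "x \<in> U0" for k x
  proof -
    obtain W where W: "full_bisection G W" "W \<subseteq> K" "tau G W = ?f ^^ k"
      using full_bisection_K_power [OF assms] by blast
    obtain g where "g \<in> W" "x = s g" using W(1) x by (auto simp: full_bisection_iff)
    then show ?thesis using tau_src [OF W(1)] W orb_K by (metis subsetD)
  qed
  have unit: "(?f ^^ k) x \<in> U0" if "x \<in> U0" for k x
    using in_orb [OF that] orb_units by blast
  \<comment> \<open>The exponents 0 to \<open>N\<close> are one more than an orbit can hold, so two
    powers agree at x. Their difference is a period of x between 1 and \<open>N\<close> and divides
    the factorial.\<close>
  have "(?f ^^ fact N) x = x" if x: "x \<in> U0" for x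
  proof -
    have "\<not> inj_on (\<lambda>i. (?f ^^ i) x) {..N}"
    proof
      assume "inj_on (\<lambda>i. (?f ^^ i) x) {..N}"
      then have "card {..N} \<le> card (orb x)"
        using in_orb [OF x] by (intro card_inj_on_le [of "\<lambda>i. (?f ^^ i) x"]) auto
      then show False using N [of x] by simp
    qed
    then obtain i j where ij: "i < j" "j \<le> N" "(?f ^^ i) x = (?f ^^ j) x"
      unfolding inj_on_def by (metis atMost_iff linorder_neqE_nat)
    have inj: "(?f ^^ n) y = (?f ^^ n) z \<Longrightarrow> y \<in> U0 \<Longrightarrow> z \<in> U0 \<Longrightarrow> y = z" for n y z
    proof (induction n)
      case (Suc n)
      then show ?case using inj_onD [OF tau_inj_on [OF V], of "(?f ^^ n) y" "(?f ^^ n) z"] unit by simp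
    qed simp
    define d where "d = j - i"
    have "(?f ^^ i) ((?f ^^ d) x) = (?f ^^ i) x"
      using ij by (simp add: d_def flip: funpow_add [THEN fun_cong, unfolded comp_def])
    then have d: "(?f ^^ d) x = x" using inj unit x by blast
    have "d dvd fact N" using ij by (intro dvd_fact) (auto simp: d_def)
    then obtain e where e: "fact N = d * e" by (auto elim: dvdE)
    have "(?f ^^ (d * e)) x = x" for e
      using d by (induction e) (simp_all add: funpow_add)
    then show ?thesis using e by simp
  qed
  then have "finite_order_on U0 ?f"
    unfolding finite_order_on_def by (intro exI [of _ "fact N"]) simp
  then show ?thesis
    unfolding elementary_def using KO_clopen_units [OF fix_KO] by simp
qed

text \<open>Links almost finiteness to the sources of D - K. A source y in the orbit of x is sent to
  the product of the arrow of D - K at y with an arrow of \<open>K\<close> from x to y. The product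
  lies outside \<open>K\<close>, since \<open>K\<close> is a subgroupoid, and its range recovers the
  arrow of D, hence y.\<close>

lemma offK_card_bound:
  assumes C: "C \<in> KO" and D: "bis D" "D \<subseteq> C" and x: "x \<in> U0"
  shows "card (s ` (D - K) \<inter> orb x) \<le>
    card ({mul G c k |c k. c \<in> C \<and> k \<in> {k \<in> K. s k = x} \<and> s c = r k} - {k \<in> K. s k = x})"
    (is "_ \<le> card (?CK - ?Kx)")
proof -
  have "finite ?Kx" using KO_bounded_fibres [OF K_KO] by blast
  moreover have "finite {c \<in> C. s c = y}" for y using KO_bounded_fibres [OF C] by blast
  ultimately have "finite (\<Union>k\<in>?Kx. (\<lambda>c. c \<odot> k) ` {c \<in> C. s c = r k})" by blast
  moreover have "?CK \<subseteq> (\<Union>k\<in>?Kx. (\<lambda>c. c \<odot> k) ` {c \<in> C. s c = r k})" by blast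
  ultimately have fin: "finite (?CK - ?Kx)" by (meson finite_Diff finite_subset)
  let ?Y = "s ` (D - K) \<inter> orb x"
  have "\<forall>y\<in>?Y. \<exists>d k. d \<in> D - K \<and> s d = y \<and> k \<in> K \<and> s k = x \<and> r k = y"
    by (auto simp: orb_def) metis
  then obtain d k where dk: "\<And>y. y \<in> ?Y \<Longrightarrow> d y \<in> D - K \<and> s (d y) = y \<and> k y \<in> K \<and> s (k y) = x \<and> r (k y) = y"
    by metis
  have arr: "d y \<in> A0" "k y \<in> A0" "s (d y) = r (k y)" if "y \<in> ?Y" for y
    using dk [OF that] bis_arrows [OF D(1)] by auto
  show ?thesis
  proof (rule card_inj_on_le [of "\<lambda>y. d y \<odot> k y"])
    show "inj_on (\<lambda>y. d y \<odot> k y) ?Y"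
    proof (rule inj_onI)
      fix y z assume y: "y \<in> ?Y" and z: "z \<in> ?Y" and eq: "d y \<odot> k y = d z \<odot> k z"
      have "r (d y) = r (d z)" using eq arr [OF y] arr [OF z] r_mul by metis
      then have "d y = d z"
        using dk [OF y] dk [OF z] Gset_r_eq [OF bis_Gset [OF D(1)]] by blast
      then show "y = z" using dk [OF y] dk [OF z] by metis
    qed
    show "(\<lambda>y. d y \<odot> k y) ` ?Y \<subseteq> ?CK - ?Kx"
    proof (rule image_subsetI)
      fix y assume y: "y \<in> ?Y"
      have "d y \<odot> k y \<notin> K"
        using K_cancel_right [OF arr(1) [OF y] _ arr(3) [OF y]] dk [OF y] by blast
      moreover have "d y \<odot> k y \<in> ?CK" using dk [OF y] arr [OF y] D(2) by blast
      ultimately show "d y \<odot> k y \<in> ?CK - ?Kx" by blast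
    qed
  qed (rule fin)
qed

section \<open>Placing the parts outside \<open>K\<close>\<close>

lemma card_Int_Un_le:
  assumes "W \<subseteq> P \<union> Q" shows "card (W \<inter> orb x) \<le> card (P \<inter> orb x) + card (Q \<inter> orb x)"
proof -
  have "card (W \<inter> orb x) \<le> card ((P \<inter> orb x) \<union> (Q \<inter> orb x))"
    using assms by (intro card_mono) auto
  also have "\<dots> \<le> card (P \<inter> orb x) + card (Q \<inter> orb x)" by (rule card_Un_le)
  finally show ?thesis .
qed

text \<open>Outside \<open>K\<close>, the sources of D fill at most 1/N of every orbit; ranges are
  controlled by applying this to the inverse of D.\<close>

definition small :: "nat \<Rightarrow> 'a set \<Rightarrow> bool" where
  "small N D \<longleftrightarrow> (\<forall>x\<in>U0. N * card (s ` (D - K) \<inter> orb x) \<le> card (orb x))"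

text \<open>The part of D inside \<open>K\<close> does not affect counts in sets disjoint from
  \<open>K\<close> and is dropped. The factor 2 accounts for the two ends of an edge.\<close>

lemma placeable_edge_offK:
  assumes D: "bis D" and small: "small N D" "small N (iv ` D)"
  shows "\<exists>w c. placeable 2 w c \<and> (\<forall>x\<in>U0. N * w x \<le> 2 * card (orb x)) \<and>
    (\<forall>S. S \<inter> K = {} \<longrightarrow> c S = card (D \<inter> S) + card (iv ` D \<inter> S))"
proof (intro exI conjI ballI allI impI)
  have D': "bis (D - K)" using bis_Diff [OF D K_KO] .
  show "placeable 2 (\<lambda>x. card (s ` (D - K) \<inter> orb x) + card (r ` (D - K) \<inter> orb x))
    (\<lambda>S. card ((D - K) \<inter> S) + card (iv ` (D - K) \<inter> S))"
    by (rule placeable_edge [OF D'])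
  have sub: "D \<subseteq> A0" using bis_arrows [OF D] .
  have iv: "iv ` (D - K) = iv ` D - K" using sub by (auto simp: inv_K_iff subset_iff)
  have r: "r ` (D - K) = s ` (iv ` D - K)"
    using s_image_inv [of "D - K"] sub iv by auto
  show "N * (card (s ` (D - K) \<inter> orb x) + card (r ` (D - K) \<inter> orb x)) \<le> 2 * card (orb x)"
    if "x \<in> U0" for x
    using small that unfolding small_def r by (fastforce simp: algebra_simps)
  show "card ((D - K) \<inter> S) + card (iv ` (D - K) \<inter> S) = card (D \<inter> S) + card (iv ` D \<inter> S)"
    if "S \<inter> K = {}" for S
  proof -
    have "(D - K) \<inter> S = D \<inter> S" "(iv ` D - K) \<inter> S = iv ` D \<inter> S" using that by auto
    then show ?thesis by (simp add: iv)
  qed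
qed

text \<open>A triangle may be discarded only if all its sides lie in \<open>K\<close>. Any two sides
  in \<open>K\<close> force the third into \<open>K\<close>, so a retained triangle has at most one
  side there, and each of its vertices is an end of a side outside \<open>K\<close>. Two sides meet
  at each of the three vertices, whence the factor 6.\<close>

lemma placeable_triangle_offK:
  assumes AB: "bis A" "bis B" "s ` A = r ` B"
    and small: "small N A" "small N B" "small N (A \<otimes> B)"
      "small N (iv ` A)" "small N (iv ` B)" "small N (iv ` (A \<otimes> B))"
  shows "\<exists>w c. placeable 3 w c \<and> (\<forall>x\<in>U0. N * w x \<le> 6 * card (orb x)) \<and>
    (\<forall>S. biinv S \<longrightarrow> S \<inter> K = {} \<longrightarrow> c S = card (A \<inter> S) + card (B \<inter> S) + card (iv ` (A \<otimes> B) \<inter> S))"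
proof -
  \<comment> \<open>The middle vertices of the triangles to retain: those where the arrows of A and
    B are not both in \<open>K\<close>.\<close>
  define Z where "Z = r ` B - r ` (B \<inter> K) \<inter> s ` (A \<inter> K)"
  define A' where "A' = {a \<in> A. s a \<in> Z}"
  define B' where "B' = {b \<in> B. r b \<in> Z}"
  have sub: "A \<subseteq> A0" "B \<subseteq> A0" "A \<otimes> B \<subseteq> A0" using AB bis_arrows by auto
  have Z: "Z \<in> KO" using AB bis_KO K_KO by (simp add: Z_def)
  have bis': "bis A'" "bis B'"
    unfolding A'_def B'_def using bis_subset [OF AB(1) KO_preimage_s [OF bis_KO [OF AB(1)] Z]]
      bis_subset [OF AB(2) KO_preimage_r [OF bis_KO [OF AB(2)] Z]] by auto
  have sA': "s ` A' = Z" and rB': "r ` B' = Z"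
  proof -
    have "Z \<subseteq> r ` B" "Z \<subseteq> s ` A" using AB(3) by (auto simp: Z_def)
    then show "s ` A' = Z" "r ` B' = Z" unfolding A'_def B'_def by blast+
  qed
  have sub': "A' \<subseteq> A" "B' \<subseteq> B"
    by (auto simp: A'_def B'_def)
  then have sub'': "A' \<otimes> B' \<subseteq> A \<otimes> B" by (rule prd_mono)
  have notK: "a \<notin> K \<or> b \<notin> K" if "a \<in> A" "b \<in> B" "s a = r b" "s a \<in> Z" for a b
    using that unfolding Z_def by blast
  have inZ: "s a \<in> Z" if ab: "a \<in> A" "b \<in> B" "s a = r b" "a \<notin> K \<or> b \<notin> K" for a b
  proof -
    have "\<not> (r b \<in> r ` (B \<inter> K) \<and> s a \<in> s ` (A \<inter> K))"
    proof
      assume "r b \<in> r ` (B \<inter> K) \<and> s a \<in> s ` (A \<inter> K)"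
      then obtain b' a' where "b' \<in> B \<inter> K" "r b = r b'" "a' \<in> A \<inter> K" "s a = s a'" by blast
      then have "b = b'" "a = a'"
        using ab Gset_r_eq [OF bis_Gset [OF AB(2)]] Gset_s_eq [OF bis_Gset [OF AB(1)]] by blast+
      then show False using ab \<open>b' \<in> B \<inter> K\<close> \<open>a' \<in> A \<inter> K\<close> by blast
    qed
    then show ?thesis unfolding Z_def using ab by auto
  qed
  have prodK: "a \<odot> b \<notin> K" if "a \<in> A0" "b \<in> K" "s a = r b" "a \<notin> K" for a b
    using K_cancel_right that by blast
  have prodK': "a \<odot> b \<notin> K" if "a \<in> K" "b \<in> A0" "s a = r b" "b \<notin> K" for a b
    using K_cancel_left that by blast
  have partner_B: "\<exists>a\<in>A. s a = r b" if "b \<in> B" for b using AB(3) that by (metis imageE imageI)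
  have partner_A: "\<exists>b\<in>B. s a = r b" if "a \<in> A" for a using AB(3) that by (metis imageE imageI)
  have ivK: "iv g \<in> iv ` D - K" if "g \<in> D" "g \<notin> K" "D \<subseteq> A0" for g D
    using that inv_K_iff [of g] by auto
  \<comment> \<open>At each vertex, if one of the two sides meeting there lies in \<open>K\<close>,
    then the other does not; a range is written as the source of an inverse.\<close>
  have w1: "s ` B' \<subseteq> s ` (B - K) \<union> s ` (A \<otimes> B - K)"
  proof
    fix x assume "x \<in> s ` B'"
    then obtain b where b: "b \<in> B" "r b \<in> Z" "x = s b" by (auto simp: B'_def)
    then obtain a where a: "a \<in> A" "s a = r b" using partner_B by blast
    show "x \<in> s ` (B - K) \<union> s ` (A \<otimes> B - K)"
    proof (cases "b \<in> K")
      case True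
      then have "a \<odot> b \<in> A \<otimes> B - K" using notK [OF a(1) b(1) a(2)] a b sub prodK by (auto intro: prdI)
      moreover have "s (a \<odot> b) = x" using a b sub by (auto simp: subset_iff)
      ultimately show ?thesis by (metis UnI2 imageI)
    qed (use b in auto)
  qed
  have w2: "s ` A' \<subseteq> s ` (A - K) \<union> s ` (iv ` B - K)"
  proof
    fix x assume "x \<in> s ` A'"
    then obtain a where a: "a \<in> A" "s a \<in> Z" "x = s a" by (auto simp: A'_def)
    then obtain b where b: "b \<in> B" "s a = r b" using partner_A by blast
    show "x \<in> s ` (A - K) \<union> s ` (iv ` B - K)"
    proof (cases "a \<in> K")
      case True
      then have "iv b \<in> iv ` B - K" using notK [OF a(1) b(1,2) a(2)] ivK b sub by blast
      moreover have "s (iv b) = x" using a b sub by (auto simp: subset_iff)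
      ultimately show ?thesis by (metis UnI2 imageI)
    qed (use a in auto)
  qed
  have w3: "r ` A' \<subseteq> s ` (iv ` A - K) \<union> s ` (iv ` (A \<otimes> B) - K)"
  proof
    fix x assume "x \<in> r ` A'"
    then obtain a where a: "a \<in> A" "s a \<in> Z" "x = r a" by (auto simp: A'_def)
    then obtain b where b: "b \<in> B" "s a = r b" using partner_A by blast
    have ab: "a \<in> A0" "b \<in> A0" using a b sub by auto
    show "x \<in> s ` (iv ` A - K) \<union> s ` (iv ` (A \<otimes> B) - K)"
    proof (cases "a \<in> K")
      case True
      then have "a \<odot> b \<notin> K" using notK [OF a(1) b(1,2) a(2)] prodK' [of a b] b ab by blast
      then have "iv (a \<odot> b) \<in> iv ` (A \<otimes> B) - K"
        using ivK [of "a \<odot> b" "A \<otimes> B"] prdI [OF a(1) b(1,2)] sub by blast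
      moreover have "s (iv (a \<odot> b)) = x" using a b ab by simp
      ultimately show ?thesis by (metis UnI2 imageI)
    next
      case False
      then have "iv a \<in> iv ` A - K" using ivK a sub by blast
      moreover have "s (iv a) = x" using a ab by simp
      ultimately show ?thesis by (metis UnI1 imageI)
    qed
  qed
  let ?w = "\<lambda>x. card (s ` B' \<inter> orb x) + card (s ` A' \<inter> orb x) + card (r ` A' \<inter> orb x)"
  let ?c = "\<lambda>S. card (A' \<inter> S) + card (B' \<inter> S) + card (iv ` (A' \<otimes> B') \<inter> S)"
  have "placeable 3 ?w ?c"
    by (rule placeable_triangle) (use bis' sA' rB' in auto)
  moreover have "\<forall>x\<in>U0. N * ?w x \<le> 6 * card (orb x)"
  proof
    fix x assume x: "x \<in> U0"
    note b = small [unfolded small_def, THEN bspec, OF x]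
    have "N * card (s ` B' \<inter> orb x) \<le> N * card (s ` (B - K) \<inter> orb x) + N * card (s ` (A \<otimes> B - K) \<inter> orb x)"
      using mult_le_mono2 [OF card_Int_Un_le [OF w1], of N x] by (simp add: distrib_left)
    moreover have "N * card (s ` A' \<inter> orb x) \<le> N * card (s ` (A - K) \<inter> orb x) + N * card (s ` (iv ` B - K) \<inter> orb x)"
      using mult_le_mono2 [OF card_Int_Un_le [OF w2], of N x] by (simp add: distrib_left)
    moreover have "N * card (r ` A' \<inter> orb x) \<le> N * card (s ` (iv ` A - K) \<inter> orb x) + N * card (s ` (iv ` (A \<otimes> B) - K) \<inter> orb x)"
      using mult_le_mono2 [OF card_Int_Un_le [OF w3], of N x] by (simp add: distrib_left)
    ultimately show "N * ?w x \<le> 6 * card (orb x)"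
      using b unfolding distrib_left by linarith
  qed
  moreover have "?c S = card (A \<inter> S) + card (B \<inter> S) + card (iv ` (A \<otimes> B) \<inter> S)"
    if S: "biinv S" "S \<inter> K = {}" for S
  proof -
    have "A' \<inter> S = A \<inter> S"
      using sub' S(2) partner_A inZ unfolding A'_def by blast
    moreover have "b \<in> B'" if b: "b \<in> B \<inter> S" for b
    proof -
      obtain a where a: "a \<in> A" "s a = r b" using partner_B b by blast
      then have "s a \<in> Z" using inZ [OF a(1) _ a(2)] b S(2) by blast
      then show ?thesis using a b by (simp add: B'_def)
    qed
    then have "B' \<inter> S = B \<inter> S" using sub' by blast
    moreover have "g \<in> iv ` (A' \<otimes> B')" if g: "g \<in> iv ` (A \<otimes> B) \<inter> S" for g
    proof -
      obtain a b where ab: "a \<in> A" "b \<in> B" "s a = r b" "g = iv (a \<odot> b)" using g by (auto elim!: prdE)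
      then have "a \<notin> K \<or> b \<notin> K"
        using g S(2) inv_K [OF mul_K, of a b] by blast
      then have "s a \<in> Z" using inZ ab by blast
      then have "a \<odot> b \<in> A' \<otimes> B'" using ab by (auto simp: A'_def B'_def intro!: prdI)
      then show ?thesis using ab by blast
    qed
    then have "iv ` (A' \<otimes> B') \<inter> S = iv ` (A \<otimes> B) \<inter> S" using sub'' by blast
    ultimately show ?thesis by simp
  qed
  ultimately show ?thesis by blast
qed

section \<open>Counting arrows in double cosets\<close>

lemma dcoset_disjoint_K: assumes "g \<in> A0" "g \<notin> K" shows "dcoset g \<inter> K = {}"
proof -
  have "biinv K" by (auto simp: biinv_def)
  then show ?thesis
    using biinv_mul_iff [of K g] assms by (auto simp: dcoset_def)
qed

text \<open>Over one orbit the arrows of \<open>K\<close> form a single double coset, so only one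
  count inside \<open>K\<close> has to be controlled per orbit.\<close>

lemma dcoset_K: assumes "g \<in> K" shows "dcoset g = {h \<in> K. s h \<in> orb (s g)}"
proof
  show "dcoset g \<subseteq> {h \<in> K. s h \<in> orb (s g)}"
    using dcoset_src [of g] assms by (auto simp: dcoset_def)
  show "{h \<in> K. s h \<in> orb (s g)} \<subseteq> dcoset g"
  proof clarify
    fix h assume h: "h \<in> K" "s h \<in> orb (s g)"
    then obtain k where k: "k \<in> K" "s k = s g" "r k = s h" by (auto simp: orb_def)
    have "h = (h \<odot> k \<odot> iv g) \<odot> g \<odot> iv k" using h k assms by simp
    moreover have "h \<odot> k \<odot> iv g \<in> K" "s (h \<odot> k \<odot> iv g) = r g" "iv k \<in> K" "s g = r (iv k)"
      using h k assms by simp_all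
    ultimately show "h \<in> dcoset g" unfolding dcoset_def by blast
  qed
qed

definition offK :: "'a \<Rightarrow> 'a set" where "offK x = {h \<in> A0 - K. s h \<in> orb x}"

lemma biinv_offK: "biinv (offK x)"
  unfolding biinv_def
proof (intro conjI ballI impI)
  have K: "biinv K" by (auto simp: biinv_def)
  show "offK x \<subseteq> A0" by (auto simp: offK_def)
  fix g k assume g: "g \<in> offK x" and k: "k \<in> K"
  then have gA: "g \<in> A0" "g \<notin> K" "s g \<in> orb x" by (auto simp: offK_def)
  show "k \<odot> g \<in> offK x" if "s k = r g"
    using biinv_left_iff [OF K gA(1) k that] gA k that by (simp add: offK_def)
  show "g \<odot> k \<in> offK x" if eq: "s g = r k"
  proof -
    have "g \<odot> k \<notin> K" using K_cancel_right [OF gA(1) k eq] gA by blast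
    moreover have "s k \<in> orb x" using orb_K_iff [OF k] gA eq by simp
    ultimately show ?thesis using gA k eq by (simp add: offK_def)
  qed
qed

text \<open>W has exactly one arrow over each point of the orbit; each of them lies either in the
  double coset inside \<open>K\<close> or outside \<open>K\<close>.\<close>

lemma full_bisection_card_dcoset_K:
  assumes W: "full_bisection G W" and g: "g \<in> K"
  shows "card (W \<inter> dcoset g) + card (W \<inter> offK (s g)) = card (orb (s g))"
proof -
  have bW: "bis W" using W by (simp add: full_bisection_iff)
  have WA: "W \<subseteq> A0" using bis_arrows [OF bW] .
  have "s ` dcoset g \<subseteq> orb (s g)" using dcoset_src g by simp
  then have f: "finite (W \<inter> dcoset g)" "finite (W \<inter> offK (s g))"
    using finite_bis_Int [OF bW, of _ "s g"] by (auto simp: offK_def image_subset_iff)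
  let ?T = "{h \<in> W. s h \<in> orb (s g)}"
  have "card (W \<inter> dcoset g) + card (W \<inter> offK (s g)) = card ((W \<inter> dcoset g) \<union> (W \<inter> offK (s g)))"
    by (rule card_Un_disjoint [OF f, symmetric]) (auto simp: dcoset_K [OF g] offK_def)
  also have "(W \<inter> dcoset g) \<union> (W \<inter> offK (s g)) = ?T"
    unfolding dcoset_K [OF g] offK_def using WA by auto
  also have "card ?T = card (s ` ?T)"
    using bis_Gset [OF bW] by (intro card_image [symmetric]) (auto simp: Gset_def inj_on_def)
  also have "s ` ?T = orb (s g)"
    using W orb_units [of "s g"] by (auto simp: full_bisection_iff)
  finally show ?thesis .
qed

text \<open>For g in \<open>K\<close> the count is the orbit size minus the count on
  \<open>offK\<close>, and \<open>offK\<close> is itself one of the sets S in the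
  assumption.\<close>

lemma card_eq_dcoset:
  assumes V: "full_bisection G V" and W: "full_bisection G W"
    and eq: "\<And>S x. \<lbrakk>biinv S; S \<inter> K = {}; s ` S \<subseteq> orb x\<rbrakk> \<Longrightarrow> card (V \<inter> S) = card (W \<inter> S)"
    and g: "g \<in> A0"
  shows "card (V \<inter> dcoset g) = card (W \<inter> dcoset g)"
proof (cases "g \<in> K")
  case True
  have "card (V \<inter> offK (s g)) = card (W \<inter> offK (s g))"
    by (rule eq [OF biinv_offK]) (auto simp: offK_def)
  then show ?thesis
    using full_bisection_card_dcoset_K [OF V True] full_bisection_card_dcoset_K [OF W True] by linarith
next
  case False
  then show ?thesis using eq [OF biinv_dcoset dcoset_disjoint_K dcoset_src] g by blast
qed

lemma card_eq_sum_indicator: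
  assumes "finite Q" "D \<inter> S \<subseteq> Q" "Q \<subseteq> S"
  shows "(\<Sum>g\<in>Q. indicator D g :: int) = int (card (D \<inter> S))"
proof -
  have "(\<Sum>g\<in>Q. indicator D g :: int) = int (card (Q \<inter> D))"
    using assms(1) by (simp add: indicator_def sum.If_cases)
  moreover have "Q \<inter> D = D \<inter> S" using assms by blast
  ultimately show ?thesis by simp
qed

text \<open>Sum the identity of chains over S.\<close>

lemma triangle_edge_count:
  assumes V: "bis V" and ts: "\<And>A B. (A, B) \<in> set ts \<Longrightarrow> bis A \<and> bis B" and es: "\<And>D. D \<in> set es \<Longrightarrow> bis D"
    and eq: "\<And>g. indicator V g + edge_sum es g = triangle_sum ts g"
    and S: "s ` S \<subseteq> orb x"
  shows "card (V \<inter> S) + (\<Sum>D\<leftarrow>es. card (D \<inter> S) + card (iv ` D \<inter> S)) =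
    (\<Sum>(A, B)\<leftarrow>ts. card (A \<inter> S) + card (B \<inter> S) + card (iv ` (A \<otimes> B) \<inter> S))"
proof -
  define \<D> where "\<D> = {V} \<union> (\<Union>D\<in>set es. {D, iv ` D}) \<union> (\<Union>(A, B)\<in>set ts. {A, B, iv ` (A \<otimes> B)})"
  have bis: "bis D" if "D \<in> \<D>" for D
    using that V ts es unfolding \<D>_def by fastforce
  \<comment> \<open>S may be infinite, so the summation runs over the finite part that meets some
    bisection of the identity.\<close>
  define Q where "Q = (\<Union>D\<in>\<D>. D \<inter> S)"
  have "finite \<D>" unfolding \<D>_def by auto
  then have Q: "finite Q" "Q \<subseteq> S"
    unfolding Q_def using finite_bis_Int [OF bis S] by (blast intro: finite_UN_I)+
  have c: "(\<Sum>g\<in>Q. indicator D g :: int) = int (card (D \<inter> S))" if "D \<in> \<D>" for D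
    by (rule card_eq_sum_indicator) (use Q that in \<open>auto simp: Q_def\<close>)
  have D_mem: "V \<in> \<D>" "\<And>D. D \<in> set es \<Longrightarrow> D \<in> \<D> \<and> iv ` D \<in> \<D>"
    "\<And>A B. (A, B) \<in> set ts \<Longrightarrow> A \<in> \<D> \<and> B \<in> \<D> \<and> iv ` (A \<otimes> B) \<in> \<D>"
    unfolding \<D>_def by auto
  have "(\<Sum>g\<in>Q. indicator V g + edge_sum es g) = (\<Sum>g\<in>Q. triangle_sum ts g)"
    using eq by simp
  moreover have "(\<Sum>g\<in>Q. edge_sum es g) = (\<Sum>D\<leftarrow>es. int (card (D \<inter> S) + card (iv ` D \<inter> S)))"
    unfolding edge_sum_def sum_sum_list_swap
    by (intro arg_cong [of _ _ sum_list] map_cong refl) (use D_mem(2) in \<open>simp add: sum.distrib c\<close>)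
  moreover have "(\<Sum>g\<in>Q. triangle_sum ts g) =
      (\<Sum>(A, B)\<leftarrow>ts. int (card (A \<inter> S) + card (B \<inter> S) + card (iv ` (A \<otimes> B) \<inter> S)))"
    unfolding triangle_sum_def sum_sum_list_swap
    by (intro arg_cong [of _ _ sum_list] map_cong refl) (use D_mem(3) in \<open>auto simp: sum.distrib c\<close>)
  ultimately have "int (card (V \<inter> S)) + (\<Sum>D\<leftarrow>es. int (card (D \<inter> S) + card (iv ` D \<inter> S))) =
      (\<Sum>(A, B)\<leftarrow>ts. int (card (A \<inter> S) + card (B \<inter> S) + card (iv ` (A \<otimes> B) \<inter> S)))"
    using c [OF D_mem(1)] by (simp add: sum.distrib)
  also have "(\<Sum>D\<leftarrow>es. int (card (D \<inter> S) + card (iv ` D \<inter> S))) =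
      int (\<Sum>D\<leftarrow>es. card (D \<inter> S) + card (iv ` D \<inter> S))"
    by (induction es) simp_all
  also have "(\<Sum>(A, B)\<leftarrow>ts. int (card (A \<inter> S) + card (B \<inter> S) + card (iv ` (A \<otimes> B) \<inter> S))) =
      int (\<Sum>(A, B)\<leftarrow>ts. card (A \<inter> S) + card (B \<inter> S) + card (iv ` (A \<otimes> B) \<inter> S))"
    by (induction ts) auto
  finally show ?thesis by linarith
qed

text \<open>Since the support of I avoids the sources of V - K, an arrow i of I is multiplied by an
  arrow of V inside \<open>K\<close> and stays in its double coset. The arrows of V outside
  \<open>K\<close> sit over units, which leave them unchanged. So both counts survive, and sources
  show that nothing is counted twice.\<close>

lemma card_prd_completion:
  assumes V: "full_bisection G V" and I: "rot p I" and sI: "s ` I \<subseteq> U0 - s ` (V - K)"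
    and S: "biinv S" "S \<inter> K = {}" "s ` S \<subseteq> orb x"
  shows "card ((V \<otimes> (I \<union> (U0 - s ` I))) \<inter> S) = card (V \<inter> S) + card (I \<inter> S)"
proof -
  have bV: "bis V" "s ` V = U0" using V by (simp_all add: full_bisection_iff)
  have bI: "bis I" using rot_bis [OF I] .
  have VA: "V \<subseteq> A0" and IA: "I \<subseteq> A0" using bis_arrows bV bI by auto
  have "\<forall>i\<in>I. \<exists>v\<in>V. s v = r i"
    using bV(2) IA r_unit by (metis imageE subsetD)
  then obtain \<phi> where \<phi>: "\<And>i. i \<in> I \<Longrightarrow> \<phi> i \<in> V \<and> s (\<phi> i) = r i" by metis
  have \<phi>K: "\<phi> i \<in> K" if "i \<in> I" for i
  proof (rule ccontr)
    assume "\<phi> i \<notin> K"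
    then have "r i \<in> s ` (V - K)" using \<phi> [OF that] by (metis DiffI imageI)
    moreover have "r i \<in> s ` I" using rot_src [OF I] that by blast
    ultimately show False using sI by blast
  qed
  have \<phi>arr: "i \<in> A0" "\<phi> i \<in> A0" if "i \<in> I" for i using that \<phi>K IA by auto
  let ?J = "(\<lambda>i. \<phi> i \<odot> i) ` (I \<inter> S)"
  have src: "s (\<phi> i \<odot> i) = s i" if "i \<in> I" for i
    using \<phi> [OF that] \<phi>arr [OF that] by simp
  have mem: "\<phi> i \<odot> i \<in> S \<longleftrightarrow> i \<in> S" if "i \<in> I" for i
    using biinv_left_iff [OF S(1) \<phi>arr(1) [OF that] \<phi>K [OF that]] \<phi> [OF that] by simp
  have eq: "(V \<otimes> (I \<union> (U0 - s ` I))) \<inter> S = (V \<inter> S) \<union> ?J"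
  proof (intro set_eqI iffI)
    fix g assume g: "g \<in> (V \<otimes> (I \<union> (U0 - s ` I))) \<inter> S"
    then obtain v i where vi: "g = v \<odot> i" "v \<in> V" "i \<in> I \<union> (U0 - s ` I)" "s v = r i"
      by (auto elim: prdE)
    show "g \<in> (V \<inter> S) \<union> ?J"
    proof (cases "i \<in> I")
      case True
      then have "v = \<phi> i" using \<phi> [OF True] vi Gset_s_eq [OF bis_Gset [OF bV(1)]] by simp
      then show ?thesis using vi True g mem [OF True] by blast
    next
      case False
      then have "i \<in> U0" using vi by blast
      then have "g = v" using vi VA by auto
      then show ?thesis using vi g by blast
    qed
  next
    fix g assume "g \<in> (V \<inter> S) \<union> ?J"
    then show "g \<in> (V \<otimes> (I \<union> (U0 - s ` I))) \<inter> S"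
    proof
      assume g: "g \<in> V \<inter> S"
      then have gA: "g \<in> A0" "g \<notin> K" using VA S(2) by auto
      then have "s g \<in> U0 - s ` I" using sI g by auto
      then have "g \<odot> s g \<in> V \<otimes> (I \<union> (U0 - s ` I))" using g by (intro prdI) auto
      then show ?thesis using g gA by simp
    next
      assume "g \<in> ?J"
      then obtain i where i: "i \<in> I" "i \<in> S" "g = \<phi> i \<odot> i" by blast
      then show ?thesis using \<phi> [OF i(1)] mem [OF i(1)] by (auto intro!: prdI)
    qed
  qed
  have "(V \<inter> S) \<inter> ?J = {}"
  proof (rule ccontr)
    assume "(V \<inter> S) \<inter> ?J \<noteq> {}"
    then obtain i where i: "i \<in> I" "i \<in> S" "\<phi> i \<odot> i \<in> V" "\<phi> i \<odot> i \<in> S" by blast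
    then have "\<phi> i \<odot> i \<notin> K" using S(2) by blast
    then have "s i \<in> s ` (V - K)" using src [OF i(1)] i by (metis DiffI imageI)
    then show False using sI i by blast
  qed
  moreover have "finite (V \<inter> S)" "finite (I \<inter> S)" using finite_bis_Int [OF _ S(3)] bV bI by auto
  moreover have "inj_on (\<lambda>i. \<phi> i \<odot> i) (I \<inter> S)"
  proof (rule inj_onI)
    fix i j assume ij: "i \<in> I \<inter> S" "j \<in> I \<inter> S" "\<phi> i \<odot> i = \<phi> j \<odot> j"
    then have "s i = s j" using src by (metis IntD1)
    then show "i = j" using ij Gset_s_eq [OF bis_Gset [OF bI]] by blast
  qed
  ultimately show ?thesis unfolding eq by (simp add: card_Un_disjoint card_image)
qed

text \<open>The 3-cycles fill at most 6 \<open>length ts\<close> / N of an orbit; the 2-cycles and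
  the excluded sources of V - K together fill at most (2 \<open>length es\<close> + 1) / N. The two
  systems are placed independently and may overlap each other.\<close>

lemma factorisation:
  assumes V: "full_bisection G V"
    and ts: "\<And>t. t \<in> set ts \<Longrightarrow> triangle_pair t" and es: "\<And>D. D \<in> set es \<Longrightarrow> bis D"
    and eq: "\<And>g. indicator V g + edge_sum es g = triangle_sum ts g"
    and N: "N = 6 * length ts + 2 * length es + 1"
    and smallV: "small N V"
    and small_ts: "\<And>A B. (A, B) \<in> set ts \<Longrightarrow> small N A \<and> small N B \<and> small N (A \<otimes> B) \<and>
      small N (iv ` A) \<and> small N (iv ` B) \<and> small N (iv ` (A \<otimes> B))"
    and small_es: "\<And>D. D \<in> set es \<Longrightarrow> small N D \<and> small N (iv ` D)"
  obtains a \<beta> b \<iota> where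
    "full_bisection G a" "full_bisection G \<beta>" "full_bisection G b" "full_bisection G \<iota>"
    "tau G V = tau G a \<circ> tau G \<beta> \<circ> tau G b \<circ> tau G \<iota>"
    "elementary G (tau G a)" "elementary G (tau G \<beta>)" "elementary G (tau G b)" "elementary G (tau G \<iota>)"
proof -
  have bV: "bis V" using V by (simp add: full_bisection_iff)
  have "\<forall>t\<in>set ts. \<exists>w c. placeable 3 w c \<and> (\<forall>x\<in>U0. N * w x \<le> 6 * card (orb x)) \<and>
    (\<forall>S. biinv S \<longrightarrow> S \<inter> K = {} \<longrightarrow>
      c S = (case t of (A, B) \<Rightarrow> card (A \<inter> S) + card (B \<inter> S) + card (iv ` (A \<otimes> B) \<inter> S)))"
  proof (rule ballI)
    fix t assume t: "t \<in> set ts"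
    obtain A B where AB: "t = (A, B)" by (cases t)
    have "bis A" "bis B" "s ` A = r ` B" using ts [OF t] by (simp_all add: AB triangle_pair_def)
    then show "\<exists>w c. placeable 3 w c \<and> (\<forall>x\<in>U0. N * w x \<le> 6 * card (orb x)) \<and>
      (\<forall>S. biinv S \<longrightarrow> S \<inter> K = {} \<longrightarrow>
        c S = (case t of (A, B) \<Rightarrow> card (A \<inter> S) + card (B \<inter> S) + card (iv ` (A \<otimes> B) \<inter> S)))"
      unfolding AB prod.case using small_ts [OF t [unfolded AB]] by (intro placeable_triangle_offK) auto
  qed
  then obtain w c where w: "\<And>t. t \<in> set ts \<Longrightarrow> placeable 3 (w t) (c t)"
      "\<And>t x. t \<in> set ts \<Longrightarrow> x \<in> U0 \<Longrightarrow> N * w t x \<le> 6 * card (orb x)"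
      "\<And>t S. t \<in> set ts \<Longrightarrow> biinv S \<Longrightarrow> S \<inter> K = {} \<Longrightarrow>
        c t S = (case t of (A, B) \<Rightarrow> card (A \<inter> S) + card (B \<inter> S) + card (iv ` (A \<otimes> B) \<inter> S))"
    unfolding bchoice_iff by blast
  have "\<forall>D\<in>set es. \<exists>w c. placeable 2 w c \<and> (\<forall>x\<in>U0. N * w x \<le> 2 * card (orb x)) \<and>
    (\<forall>S. S \<inter> K = {} \<longrightarrow> c S = card (D \<inter> S) + card (iv ` D \<inter> S))"
    using placeable_edge_offK es small_es by blast
  then obtain w' c' where w': "\<And>D. D \<in> set es \<Longrightarrow> placeable 2 (w' D) (c' D)"
      "\<And>D x. D \<in> set es \<Longrightarrow> x \<in> U0 \<Longrightarrow> N * w' D x \<le> 2 * card (orb x)"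
      "\<And>D S. D \<in> set es \<Longrightarrow> S \<inter> K = {} \<Longrightarrow> c' D S = card (D \<inter> S) + card (iv ` D \<inter> S)"
    unfolding bchoice_iff by blast
  have sum_w: "N * (\<Sum>t\<leftarrow>ts. w t x) \<le> 6 * length ts * card (orb x)" if x: "x \<in> U0" for x
    using w(2) [OF _ x] by (induction ts) (fastforce simp: algebra_simps)+
  have sum_w': "N * (\<Sum>D\<leftarrow>es. w' D x) \<le> 2 * length es * card (orb x)" if x: "x \<in> U0" for x
    using w'(2) [OF _ x] by (induction es) (fastforce simp: algebra_simps)+
  have N0: "N > 0" using N by simp
  have orbU: "U0 \<inter> orb x = orb x" for x using orb_units by blast
  have le: "(\<Sum>t\<leftarrow>ts. w t x) \<le> card (U0 \<inter> orb x)" if x: "x \<in> U0" for x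
  proof -
    have "N * (\<Sum>t\<leftarrow>ts. w t x) \<le> N * card (orb x)"
      using sum_w [OF x] unfolding N by (simp add: algebra_simps)
    then show ?thesis using N0 orbU by simp
  qed
  obtain \<beta> where \<beta>: "rot 3 \<beta>" "s ` \<beta> \<subseteq> U0" "\<forall>x\<in>U0. card (s ` \<beta> \<inter> orb x) = (\<Sum>t\<leftarrow>ts. w t x)"
    "\<forall>S x. biinv S \<longrightarrow> s ` S \<subseteq> orb x \<longrightarrow> card (\<beta> \<inter> S) = (\<Sum>t\<leftarrow>ts. c t S)"
    by (rule placeableE [OF placeable_sum_list KO_units subset_refl le]) (rule w(1))
  \<comment> \<open>Avoiding these sources is the assumption under which
    \<open>card_prd_completion\<close> adds the counts of V and of the involution.\<close>
  let ?E = "U0 - s ` (V - K)"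
  have VK: "s ` (V - K) \<in> KO" "s ` (V - K) \<subseteq> U0"
    using bis_KO [OF bV] K_KO bis_src_units [OF bV] by auto
  have E: "?E \<in> KO" "?E \<subseteq> U0" using VK by auto
  have le': "(\<Sum>D\<leftarrow>es. w' D x) \<le> card (?E \<inter> orb x)" if x: "x \<in> U0" for x
  proof -
    have "N * card (s ` (V - K) \<inter> orb x) \<le> card (orb x)" using smallV x by (simp add: small_def)
    then have "N * ((\<Sum>D\<leftarrow>es. w' D x) + card (s ` (V - K) \<inter> orb x)) \<le> (2 * length es + 1) * card (orb x)"
      using sum_w' [OF x] by (simp add: algebra_simps)
    also have "\<dots> \<le> N * card (orb x)" unfolding N by (intro mult_right_mono) auto
    finally have "(\<Sum>D\<leftarrow>es. w' D x) + card (s ` (V - K) \<inter> orb x) \<le> card (orb x)" using N0 by simp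
    then show ?thesis using orb_clopen_card_split [OF VK(2), of x] orbU [of x] by simp
  qed
  obtain \<iota> where \<iota>: "rot 2 \<iota>" "s ` \<iota> \<subseteq> ?E" "\<forall>x\<in>U0. card (s ` \<iota> \<inter> orb x) = (\<Sum>D\<leftarrow>es. w' D x)"
    "\<forall>S x. biinv S \<longrightarrow> s ` S \<subseteq> orb x \<longrightarrow> card (\<iota> \<inter> S) = (\<Sum>D\<leftarrow>es. c' D S)"
    by (rule placeableE [OF placeable_sum_list E le']) (rule w'(1))
  define \<beta>' where "\<beta>' = \<beta> \<union> (U0 - s ` \<beta>)"
  define \<iota>' where "\<iota>' = \<iota> \<union> (U0 - s ` \<iota>)"
  have p3: "prime (3 :: nat)" and p2: "prime (2 :: nat)" by simp_all
  note \<beta>' = rot_completion [OF p3 \<beta>(1), folded \<beta>'_def]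
    and \<iota>' = rot_completion [OF p2 \<iota>(1), folded \<iota>'_def]
  define \<alpha> where "\<alpha> = V \<otimes> \<iota>'"
  have \<alpha>: "full_bisection G \<alpha>" "tau G \<alpha> = tau G V \<circ> tau G \<iota>'"
    unfolding \<alpha>_def using full_bisection_prd [OF V \<iota>'(1)] by auto
  have count: "card (\<beta>' \<inter> S) = card (\<alpha> \<inter> S)"
    if S: "biinv S" "S \<inter> K = {}" "s ` S \<subseteq> orb x" for S x
  proof -
    have "\<beta>' \<inter> S = \<beta> \<inter> S" unfolding \<beta>'_def using S(2) unit_K by blast
    then have "card (\<beta>' \<inter> S) = (\<Sum>t\<leftarrow>ts. c t S)" using \<beta>(4) [rule_format, OF S(1,3)] by simp
    also have "\<dots> = (\<Sum>(A, B)\<leftarrow>ts. card (A \<inter> S) + card (B \<inter> S) + card (iv ` (A \<otimes> B) \<inter> S))"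
      by (intro arg_cong [of _ _ sum_list] map_cong refl) (rule w(3) [OF _ S(1,2)])
    also have "\<dots> = card (V \<inter> S) + (\<Sum>D\<leftarrow>es. card (D \<inter> S) + card (iv ` D \<inter> S))"
      using triangle_edge_count [OF bV _ es eq S(3)] ts by (force simp: triangle_pair_def)
    also have "(\<Sum>D\<leftarrow>es. card (D \<inter> S) + card (iv ` D \<inter> S)) = (\<Sum>D\<leftarrow>es. c' D S)"
      by (intro arg_cong [of _ _ sum_list] map_cong refl) (simp add: w'(3) S(2))
    also have "\<dots> = card (\<iota> \<inter> S)" using \<iota>(4) [rule_format, OF S(1,3)] by simp
    also have "card (V \<inter> S) + card (\<iota> \<inter> S) = card (\<alpha> \<inter> S)"
      unfolding \<alpha>_def \<iota>'_def using card_prd_completion [OF V \<iota>(1,2) S] by simp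
    finally show ?thesis .
  qed
  have dc: "card (\<beta>' \<inter> dcoset g) = card (\<alpha> \<inter> dcoset g)" if "g \<in> A0" for g
    by (rule card_eq_dcoset [OF \<beta>'(1) \<alpha>(1) count that])
  have b: "bis \<beta>'" "bis \<alpha>" using \<beta>'(1) \<alpha>(1) by (simp_all add: full_bisection_iff)
  obtain a b where ab: "bis a" "bis b" "a \<subseteq> K" "b \<subseteq> K" "s ` a = r ` \<beta>'" "r ` b = s ` \<beta>'"
    "a \<otimes> \<beta>' \<otimes> b = \<alpha>"
    by (rule matching_eq [OF b dc])
  have im: "s ` a = U0" "r ` b = U0" using ab \<beta>'(1) by (simp_all add: full_bisection_iff)
  have sub: "a \<subseteq> A0" "b \<subseteq> A0" "\<beta>' \<subseteq> A0" "a \<otimes> \<beta>' \<subseteq> A0" using ab b bis_arrows by auto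
  have "r ` \<alpha> = r ` a" "s ` \<alpha> = s ` b"
    unfolding ab(7) [symmetric] using sub ab(5,6) by (simp_all add: r_prd s_prd)
  then have full: "full_bisection G a" "full_bisection G b"
    using im ab \<alpha>(1) by (simp_all add: full_bisection_iff)
  have "tau G \<alpha> = tau G a \<circ> tau G \<beta>' \<circ> tau G b"
    unfolding ab(7) [symmetric]
    using full_bisection_prd [OF full(1) \<beta>'(1)] full_bisection_prd(2) [OF _ full(2)] by simp
  \<comment> \<open>As an involution, the last factor can be carried from the left-hand side of the
    matching to the right of b.\<close>
  moreover have inv: "tau G \<iota>' (tau G \<iota>' x) = x" for x
    using \<iota>'(3) [of x] by (cases "x \<in> U0") (simp_all add: numeral_2_eq_2 tau_eq)
  then have "tau G V = tau G \<alpha> \<circ> tau G \<iota>'" unfolding \<alpha>(2) by (simp add: fun_eq_iff)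
  ultimately have "tau G V = tau G a \<circ> tau G \<beta>' \<circ> tau G b \<circ> tau G \<iota>'" by simp
  then show ?thesis
    using that full \<beta>'(1,2) \<iota>'(1,2) elementary_tau_K ab(3,4) by blast
qed

end

theorem theorem7p13:
  fixes G :: "'a groupoid" and \<gamma> :: "'a \<Rightarrow> 'a"
  assumes "etale_groupoid G"
    and "second_countable (top G)"
    and "essentially_principal G"
    and "compactin (top G) (units G)"
    and "totally_disconnected_space (unit_top G)"
    and "almost_finite G"
    and "\<gamma> \<in> topological_full_group G"
    and "in_index_kernel G \<gamma>"
  shows "\<exists>\<gamma>1 \<gamma>2 \<gamma>3 \<gamma>4.
           \<gamma>1 \<in> topological_full_group G \<and> \<gamma>2 \<in> topological_full_group G \<and>
           \<gamma>3 \<in> topological_full_group G \<and> \<gamma>4 \<in> topological_full_group G \<and>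
           \<gamma> = \<gamma>1 \<circ> \<gamma>2 \<circ> \<gamma>3 \<circ> \<gamma>4 \<and>
           elementary G \<gamma>1 \<and> elementary G (\<gamma>2 \<circ> \<gamma>2) \<and>
           elementary G \<gamma>3 \<and> elementary G \<gamma>4 \<and>
           finite_order_on (units G) \<gamma>1 \<and> finite_order_on (units G) \<gamma>2 \<and>
           finite_order_on (units G) \<gamma>3 \<and> finite_order_on (units G) \<gamma>4"
proof -
  \<comment> \<open>Essential principality makes the unit space an interior.\<close>
  have "openin (top G) (units G)"
    using assms(3) unfolding essentially_principal_def by (metis openin_interior_of)
  moreover have "groupoid_axioms G"
    using assms(1) unfolding etale_groupoid_def topological_groupoid_def by blast
  ultimately interpret ample_groupoid G
    using assms(1,4,5) by unfold_locales
  obtain V F where V: "full_bisection G V" "\<gamma> = tau G V"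
    and F: "F \<in> Cc_int (prod_topology X0 X0) (composable G)" "delta2 G F = indicator V"
    using assms(8) unfolding in_index_kernel_def by blast
  obtain ts es where ts: "\<forall>t\<in>set ts. triangle_pair t" and es: "\<forall>D\<in>set es. bis D"
    and eq: "\<forall>g. delta2 G F g + edge_sum es g = triangle_sum ts g"
    using boxfun_triangles [OF Cc_int_boxfun [OF F(1)]] by blast
  have bis_ts: "bis A" "bis B" if "(A, B) \<in> set ts" for A B
    using ts that by (auto simp: triangle_pair_def)
  \<comment> \<open>Inverses and products are included because ranges and third sides also enter the
    room estimates.\<close>
  define \<D> where "\<D> = {V} \<union> (\<Union>D\<in>set es. {D, iv ` D}) \<union>
    (\<Union>(A, B)\<in>set ts. {A, B, A \<otimes> B, iv ` A, iv ` B, iv ` (A \<otimes> B)})"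
  have fin: "finite \<D>" unfolding \<D>_def by auto
  have bis_D: "bis D" if "D \<in> \<D>" for D
    using that V(1) bis_ts es unfolding \<D>_def full_bisection_iff by fastforce
  define C where "C = \<Union>\<D>"
  have C: "C \<in> KO" unfolding C_def using fin bis_D bis_KO by (intro KO_Union) auto
  define N where "N = 6 * length ts + 2 * length es + 1"
  have N0: "0 < N" by (simp add: N_def)
  have "compactin (top G) C \<and> 1 / real N > 0" using C N0 by (simp add: KO_def)
  then obtain K where K: "elementary_subgroupoid G K" and af: "\<forall>x\<in>units G.
      let Kx = {k \<in> K. src G k = x};
          CKx = {mul G c k | c k. c \<in> C \<and> k \<in> Kx \<and> src G c = rng G k}
      in real (card (CKx - Kx)) / real (card (rng G ` Kx)) < 1 / real N"
    using assms(6) unfolding almost_finite_def by blast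
  interpret elementary_pair G K by unfold_locales (rule K)
  have small: "small N D" if D: "D \<in> \<D>" for D
    unfolding small_def
  proof
    fix x assume x: "x \<in> U0"
    let ?CK = "{mul G c k |c k. c \<in> C \<and> k \<in> {k \<in> K. s k = x} \<and> s c = r k} - {k \<in> K. s k = x}"
    \<comment> \<open>Guards against division by zero, which would make the almost finiteness bound
      vacuous.\<close>
    have "card (orb x) > 0" using orb_self [OF x] by (auto simp: card_gt_0_iff)
    moreover have "real (card ?CK) / real (card (orb x)) < 1 / real N"
      using af x unfolding Let_def orb_def by blast
    ultimately have "real N * real (card ?CK) < real (card (orb x))"
      using N0 by (simp add: field_simps)
    then have "N * card ?CK < card (orb x)"
      unfolding of_nat_mult [symmetric] of_nat_less_iff .
    moreover have "D \<subseteq> C" using D by (auto simp: C_def)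
    then have "card (s ` (D - K) \<inter> orb x) \<le> card ?CK"
      by (rule offK_card_bound [OF C bis_D [OF D] _ x])
    then have "N * card (s ` (D - K) \<inter> orb x) \<le> N * card ?CK" by (rule mult_le_mono2)
    ultimately show "N * card (s ` (D - K) \<inter> orb x) \<le> card (orb x)" by linarith
  qed
  have eq': "indicator V g + edge_sum es g = triangle_sum ts g" for g
    using eq unfolding F(2) by blast
  have small_V: "small N V" by (rule small) (simp add: \<D>_def)
  have small_ts: "small N A \<and> small N B \<and> small N (A \<otimes> B) \<and>
      small N (iv ` A) \<and> small N (iv ` B) \<and> small N (iv ` (A \<otimes> B))" if "(A, B) \<in> set ts" for A B
    by (intro conjI small) (use that in \<open>auto simp: \<D>_def\<close>)
  have small_es: "small N D \<and> small N (iv ` D)" if "D \<in> set es" for D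
    by (intro conjI small) (use that in \<open>auto simp: \<D>_def\<close>)
  obtain a \<beta> b \<iota> where
    full: "full_bisection G a" "full_bisection G \<beta>" "full_bisection G b" "full_bisection G \<iota>"
    and prod: "tau G V = tau G a \<circ> tau G \<beta> \<circ> tau G b \<circ> tau G \<iota>"
    and el: "elementary G (tau G a)" "elementary G (tau G \<beta>)" "elementary G (tau G b)" "elementary G (tau G \<iota>)"
    by (rule factorisation [OF V(1) ts [rule_format] es [rule_format] eq' N_def small_V small_ts small_es])
  have "tau G W \<in> topological_full_group G" if "full_bisection G W" for W
    using that unfolding topological_full_group_def by blast
  moreover have "finite_order_on U0 f" if "elementary G f" for f
    using that unfolding elementary_def by blast
  ultimately show ?thesis
    using full prod el elementary_square [OF el(2)] unfolding V(2) by blast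
qed

end
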